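(* Let $A$ and $I$ be types, let $B$ be a type family over $A$, and let $t:A\to I$ and $s:\sum_{a:A}B(a)\to I$. Suppose that: - $A$ has decidable equality; - $B(a)$ is $\Pi$-compact for every $a:A$; - $I$ is a set. Then $\mathsf W_{s,t}(i)$ has decidable equality for every $i:I$.
   Context: The ambient theory is intensional Martin-Löf type theory with function extensionality. A type $Y$ is decidable if $Y+\neg Y$ holds. A type has decidable equality if $x=y$ is decidable for all of its elements $x,y$. A set is a type whose identity types are propositions. A type $X$ is $\Pi$-compact if for every type family $Y$ over $X$ with $Y(x)$ decidable for all $x:X$, the type $\prod_{x:X}Y(x)$ is decidable. The indexed $\mathsf W$-type $\mathsf W_{s,t}$ is the inductive type family over $I$ with a single constructor \[\mathsf{indexedsup}:\prod_{a:A}\Big(\prod_{b:B(a)}\mathsf W_{s,t}(s(a,b))\Big)\to\mathsf W_{s,t}(t(a)).\] *)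

theory Defs
  imports Main
begin

text \<open>
  Intensional Martin-Loef type theory as a deductive system. The system has a cumulative hierarchy
  of universes a la Russell, dependent products with eta, dependent sums, the empty, unit and natural
  numbers types, binary coproducts, identity types with eliminator \<open>J\<close> (no axiom K and no
  equality reflection), indexed W-types, and the axiom of function extensionality.

  Terms use de Bruijn indices. Only \<open>Pi\<close> and \<open>Lam\<close> bind a variable. Every other type former and
  eliminator takes type families, motives and branches as terms of function type, so the type
  family written \<open>B(a)\<close> on paper is \<open>B \<cdot> a\<close> for a term \<open>B\<close> of type \<open>A \<rightarrow> Univ n\<close>.
\<close>

datatype tm =
    Var nat
  | Univ nat
  | Pi tm tm | Lam tm tm | App tm tm (infixl "\<cdot>" 90)
  | Sig tm tm | Tup tm tm | SigElim tm tm tm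
  | Empty | EmptyElim tm tm
  | Unit | Star | UnitElim tm tm tm
  | NatT | ZeroT | SucT tm | NatElim tm tm tm tm
  | Coprod tm tm | InL tm | InR tm | CoprodElim tm tm tm tm
  | Idt tm tm tm | Refl tm | J tm tm tm tm tm
  | IW tm tm tm tm tm tm | Sup tm tm | IWElim tm tm tm tm
  | Funext tm tm tm

primrec ren :: "(nat \<Rightarrow> nat) \<Rightarrow> tm \<Rightarrow> tm" where
  "ren \<rho> (Var i) = Var (\<rho> i)"
| "ren \<rho> (Univ n) = Univ n"
| "ren \<rho> (Pi A B) = Pi (ren \<rho> A) (ren (case_nat 0 (Suc \<circ> \<rho>)) B)"
| "ren \<rho> (Lam A b) = Lam (ren \<rho> A) (ren (case_nat 0 (Suc \<circ> \<rho>)) b)"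
| "ren \<rho> (f \<cdot> a) = ren \<rho> f \<cdot> ren \<rho> a"
| "ren \<rho> (Sig A B) = Sig (ren \<rho> A) (ren \<rho> B)"
| "ren \<rho> (Tup a b) = Tup (ren \<rho> a) (ren \<rho> b)"
| "ren \<rho> (SigElim C d p) = SigElim (ren \<rho> C) (ren \<rho> d) (ren \<rho> p)"
| "ren \<rho> Empty = Empty"
| "ren \<rho> (EmptyElim C e) = EmptyElim (ren \<rho> C) (ren \<rho> e)"
| "ren \<rho> Unit = Unit"
| "ren \<rho> Star = Star"
| "ren \<rho> (UnitElim C d u) = UnitElim (ren \<rho> C) (ren \<rho> d) (ren \<rho> u)"
| "ren \<rho> NatT = NatT"
| "ren \<rho> ZeroT = ZeroT"
| "ren \<rho> (SucT m) = SucT (ren \<rho> m)"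
| "ren \<rho> (NatElim C z d m) = NatElim (ren \<rho> C) (ren \<rho> z) (ren \<rho> d) (ren \<rho> m)"
| "ren \<rho> (Coprod A B) = Coprod (ren \<rho> A) (ren \<rho> B)"
| "ren \<rho> (InL a) = InL (ren \<rho> a)"
| "ren \<rho> (InR b) = InR (ren \<rho> b)"
| "ren \<rho> (CoprodElim C l r p) = CoprodElim (ren \<rho> C) (ren \<rho> l) (ren \<rho> r) (ren \<rho> p)"
| "ren \<rho> (Idt A a b) = Idt (ren \<rho> A) (ren \<rho> a) (ren \<rho> b)"
| "ren \<rho> (Refl a) = Refl (ren \<rho> a)"
| "ren \<rho> (J C d a b p) = J (ren \<rho> C) (ren \<rho> d) (ren \<rho> a) (ren \<rho> b) (ren \<rho> p)"
| "ren \<rho> (IW A I B t s k) = IW (ren \<rho> A) (ren \<rho> I) (ren \<rho> B) (ren \<rho> t) (ren \<rho> s) (ren \<rho> k)"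
| "ren \<rho> (Sup a f) = Sup (ren \<rho> a) (ren \<rho> f)"
| "ren \<rho> (IWElim C h k w) = IWElim (ren \<rho> C) (ren \<rho> h) (ren \<rho> k) (ren \<rho> w)"
| "ren \<rho> (Funext f g h) = Funext (ren \<rho> f) (ren \<rho> g) (ren \<rho> h)"

definition wk :: "nat \<Rightarrow> tm \<Rightarrow> tm" where
  "wk n = ren (\<lambda>i. i + n)"

definition up :: "(nat \<Rightarrow> tm) \<Rightarrow> nat \<Rightarrow> tm" where
  "up \<sigma> = case_nat (Var 0) (wk 1 \<circ> \<sigma>)"

primrec subst :: "(nat \<Rightarrow> tm) \<Rightarrow> tm \<Rightarrow> tm" where
  "subst \<sigma> (Var i) = \<sigma> i"
| "subst \<sigma> (Univ n) = Univ n"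
| "subst \<sigma> (Pi A B) = Pi (subst \<sigma> A) (subst (up \<sigma>) B)"
| "subst \<sigma> (Lam A b) = Lam (subst \<sigma> A) (subst (up \<sigma>) b)"
| "subst \<sigma> (f \<cdot> a) = subst \<sigma> f \<cdot> subst \<sigma> a"
| "subst \<sigma> (Sig A B) = Sig (subst \<sigma> A) (subst \<sigma> B)"
| "subst \<sigma> (Tup a b) = Tup (subst \<sigma> a) (subst \<sigma> b)"
| "subst \<sigma> (SigElim C d p) = SigElim (subst \<sigma> C) (subst \<sigma> d) (subst \<sigma> p)"
| "subst \<sigma> Empty = Empty"
| "subst \<sigma> (EmptyElim C e) = EmptyElim (subst \<sigma> C) (subst \<sigma> e)"
| "subst \<sigma> Unit = Unit"
| "subst \<sigma> Star = Star"
| "subst \<sigma> (UnitElim C d u) = UnitElim (subst \<sigma> C) (subst \<sigma> d) (subst \<sigma> u)"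
| "subst \<sigma> NatT = NatT"
| "subst \<sigma> ZeroT = ZeroT"
| "subst \<sigma> (SucT m) = SucT (subst \<sigma> m)"
| "subst \<sigma> (NatElim C z d m) = NatElim (subst \<sigma> C) (subst \<sigma> z) (subst \<sigma> d) (subst \<sigma> m)"
| "subst \<sigma> (Coprod A B) = Coprod (subst \<sigma> A) (subst \<sigma> B)"
| "subst \<sigma> (InL a) = InL (subst \<sigma> a)"
| "subst \<sigma> (InR b) = InR (subst \<sigma> b)"
| "subst \<sigma> (CoprodElim C l r p) =
     CoprodElim (subst \<sigma> C) (subst \<sigma> l) (subst \<sigma> r) (subst \<sigma> p)"
| "subst \<sigma> (Idt A a b) = Idt (subst \<sigma> A) (subst \<sigma> a) (subst \<sigma> b)"
| "subst \<sigma> (Refl a) = Refl (subst \<sigma> a)"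
| "subst \<sigma> (J C d a b p) = J (subst \<sigma> C) (subst \<sigma> d) (subst \<sigma> a) (subst \<sigma> b) (subst \<sigma> p)"
| "subst \<sigma> (IW A I B t s k) =
     IW (subst \<sigma> A) (subst \<sigma> I) (subst \<sigma> B) (subst \<sigma> t) (subst \<sigma> s) (subst \<sigma> k)"
| "subst \<sigma> (Sup a f) = Sup (subst \<sigma> a) (subst \<sigma> f)"
| "subst \<sigma> (IWElim C h k w) = IWElim (subst \<sigma> C) (subst \<sigma> h) (subst \<sigma> k) (subst \<sigma> w)"
| "subst \<sigma> (Funext f g h) = Funext (subst \<sigma> f) (subst \<sigma> g) (subst \<sigma> h)"

definition inst :: "tm \<Rightarrow> tm \<Rightarrow> tm" where
  "inst b a = subst (case_nat a Var) b"

definition Arrow :: "tm \<Rightarrow> tm \<Rightarrow> tm" (infixr "\<rightarrow>" 70) where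
  "A \<rightarrow> B = Pi A (wk 1 B)"

text \<open>
  \<open>IW A I B t s k\<close> is the member at index \<open>k\<close> of the indexed W-type with shapes \<open>A\<close>, positions \<open>B\<close>
  and index type \<open>I\<close>. \<open>subtrees A I B t s a\<close> is the type \<open>\<Prod>b : B(a). W(s(a, b))\<close>, and
  \<open>IW_step A I B t s C\<close> is the type of the induction step for a motive \<open>C : \<Prod>k : I. W(k) \<rightarrow> Univ j\<close>:
  \<open>\<Prod>a : A. \<Prod>f : subtrees a. (\<Prod>b : B(a). C(s(a, b), f(b))) \<rightarrow> C(t(a), sup(a, f))\<close>.
\<close>

definition subtrees :: "tm \<Rightarrow> tm \<Rightarrow> tm \<Rightarrow> tm \<Rightarrow> tm \<Rightarrow> tm \<Rightarrow> tm" where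
  "subtrees A I B t s a =
     Pi (B \<cdot> a) (IW (wk 1 A) (wk 1 I) (wk 1 B) (wk 1 t) (wk 1 s) (wk 1 s \<cdot> Tup (wk 1 a) (Var 0)))"

definition IW_step :: "tm \<Rightarrow> tm \<Rightarrow> tm \<Rightarrow> tm \<Rightarrow> tm \<Rightarrow> tm \<Rightarrow> tm" where
  "IW_step A I B t s C =
     Pi A (Pi (subtrees (wk 1 A) (wk 1 I) (wk 1 B) (wk 1 t) (wk 1 s) (Var 0))
       (Pi (wk 2 B \<cdot> Var 1) (wk 3 C \<cdot> (wk 3 s \<cdot> Tup (Var 2) (Var 0)) \<cdot> (Var 1 \<cdot> Var 0))
         \<rightarrow> wk 2 C \<cdot> (wk 2 t \<cdot> Var 1) \<cdot> Sup (Var 1) (Var 0)))"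

text \<open>
  A context lists the types of its variables, the most recent first. The three judgements are
  well-formedness of contexts, typing, and judgemental equality. ``\<open>A\<close> is a type'' means that \<open>A\<close> is
  an element of some universe.

  Substitution and substitution of equals are primitive structural rules, in parallel form.
  Weakening is the instance of the former with \<open>\<sigma> = (\<lambda>i. Var (i + n))\<close>. Congruence for the formers that
  bind no variable is an instance of the latter, so only \<open>Pi\<close> and \<open>Lam\<close> have their own congruence rule.
\<close>

inductive
  wf_ctx :: "tm list \<Rightarrow> bool" ("\<turnstile> _ ctx" [60] 50) and
  has_type :: "tm list \<Rightarrow> tm \<Rightarrow> tm \<Rightarrow> bool" ("_ \<turnstile> _ \<^bold>: _" [60, 60, 60] 50) and
  jeq :: "tm list \<Rightarrow> tm \<Rightarrow> tm \<Rightarrow> tm \<Rightarrow> bool" ("_ \<turnstile> _ \<doteq> _ \<^bold>: _" [60, 60, 60, 60] 50)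
where
  ctx_nil: "\<turnstile> [] ctx"
| ctx_cons: "\<turnstile> \<Gamma> ctx \<Longrightarrow> \<Gamma> \<turnstile> A \<^bold>: Univ i \<Longrightarrow> \<turnstile> A # \<Gamma> ctx"

| var: "\<turnstile> \<Gamma> ctx \<Longrightarrow> i < length \<Gamma> \<Longrightarrow> \<Gamma> \<turnstile> Var i \<^bold>: wk (Suc i) (\<Gamma> ! i)"
| conv: "\<Gamma> \<turnstile> a \<^bold>: A \<Longrightarrow> \<Gamma> \<turnstile> A \<doteq> B \<^bold>: Univ i \<Longrightarrow> \<Gamma> \<turnstile> a \<^bold>: B"
| substitution:
    "\<lbrakk>\<Gamma> \<turnstile> a \<^bold>: A; \<turnstile> \<Gamma> ctx; \<turnstile> \<Delta> ctx;
      \<forall>i < length \<Gamma>. \<Delta> \<turnstile> \<sigma> i \<^bold>: subst \<sigma> (wk (Suc i) (\<Gamma> ! i))\<rbrakk>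
     \<Longrightarrow> \<Delta> \<turnstile> subst \<sigma> a \<^bold>: subst \<sigma> A"

| eq_refl: "\<Gamma> \<turnstile> a \<^bold>: A \<Longrightarrow> \<Gamma> \<turnstile> a \<doteq> a \<^bold>: A"
| eq_sym: "\<Gamma> \<turnstile> a \<doteq> b \<^bold>: A \<Longrightarrow> \<Gamma> \<turnstile> b \<doteq> a \<^bold>: A"
| eq_trans: "\<Gamma> \<turnstile> a \<doteq> b \<^bold>: A \<Longrightarrow> \<Gamma> \<turnstile> b \<doteq> c \<^bold>: A \<Longrightarrow> \<Gamma> \<turnstile> a \<doteq> c \<^bold>: A"
| eq_conv: "\<Gamma> \<turnstile> a \<doteq> b \<^bold>: A \<Longrightarrow> \<Gamma> \<turnstile> A \<doteq> B \<^bold>: Univ i \<Longrightarrow> \<Gamma> \<turnstile> a \<doteq> b \<^bold>: B"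
| eq_substitution:
    "\<lbrakk>\<Gamma> \<turnstile> a \<doteq> b \<^bold>: A; \<turnstile> \<Gamma> ctx; \<turnstile> \<Delta> ctx;
      \<forall>i < length \<Gamma>. \<Delta> \<turnstile> \<sigma> i \<doteq> \<tau> i \<^bold>: subst \<sigma> (wk (Suc i) (\<Gamma> ! i))\<rbrakk>
     \<Longrightarrow> \<Delta> \<turnstile> subst \<sigma> a \<doteq> subst \<tau> b \<^bold>: subst \<sigma> A"

| univ: "\<turnstile> \<Gamma> ctx \<Longrightarrow> \<Gamma> \<turnstile> Univ i \<^bold>: Univ (Suc i)"
| cumul: "\<Gamma> \<turnstile> A \<^bold>: Univ i \<Longrightarrow> \<Gamma> \<turnstile> A \<^bold>: Univ (Suc i)"
| eq_cumul: "\<Gamma> \<turnstile> A \<doteq> B \<^bold>: Univ i \<Longrightarrow> \<Gamma> \<turnstile> A \<doteq> B \<^bold>: Univ (Suc i)"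

| Pi_form: "\<Gamma> \<turnstile> A \<^bold>: Univ i \<Longrightarrow> A # \<Gamma> \<turnstile> B \<^bold>: Univ i \<Longrightarrow> \<Gamma> \<turnstile> Pi A B \<^bold>: Univ i"
| Pi_intro: "\<Gamma> \<turnstile> A \<^bold>: Univ i \<Longrightarrow> A # \<Gamma> \<turnstile> b \<^bold>: B \<Longrightarrow> \<Gamma> \<turnstile> Lam A b \<^bold>: Pi A B"
| Pi_elim: "\<Gamma> \<turnstile> f \<^bold>: Pi A B \<Longrightarrow> \<Gamma> \<turnstile> a \<^bold>: A \<Longrightarrow> \<Gamma> \<turnstile> f \<cdot> a \<^bold>: inst B a"
| Pi_beta: "A # \<Gamma> \<turnstile> b \<^bold>: B \<Longrightarrow> \<Gamma> \<turnstile> a \<^bold>: A \<Longrightarrow> \<Gamma> \<turnstile> Lam A b \<cdot> a \<doteq> inst b a \<^bold>: inst B a"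
| Pi_eta: "\<Gamma> \<turnstile> f \<^bold>: Pi A B \<Longrightarrow> \<Gamma> \<turnstile> f \<doteq> Lam A (wk 1 f \<cdot> Var 0) \<^bold>: Pi A B"
| Pi_cong:
    "\<Gamma> \<turnstile> A \<doteq> A' \<^bold>: Univ i \<Longrightarrow> A # \<Gamma> \<turnstile> B \<doteq> B' \<^bold>: Univ i \<Longrightarrow> \<Gamma> \<turnstile> Pi A B \<doteq> Pi A' B' \<^bold>: Univ i"
| Lam_cong:
    "\<Gamma> \<turnstile> A \<doteq> A' \<^bold>: Univ i \<Longrightarrow> A # \<Gamma> \<turnstile> b \<doteq> b' \<^bold>: B \<Longrightarrow> \<Gamma> \<turnstile> Lam A b \<doteq> Lam A' b' \<^bold>: Pi A B"

| Sig_form: "\<Gamma> \<turnstile> A \<^bold>: Univ i \<Longrightarrow> \<Gamma> \<turnstile> B \<^bold>: A \<rightarrow> Univ i \<Longrightarrow> \<Gamma> \<turnstile> Sig A B \<^bold>: Univ i"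
| Sig_intro:
    "\<lbrakk>\<Gamma> \<turnstile> A \<^bold>: Univ i; \<Gamma> \<turnstile> B \<^bold>: A \<rightarrow> Univ i; \<Gamma> \<turnstile> a \<^bold>: A; \<Gamma> \<turnstile> b \<^bold>: B \<cdot> a\<rbrakk> \<Longrightarrow> \<Gamma> \<turnstile> Tup a b \<^bold>: Sig A B"
| Sig_elim:
    "\<lbrakk>\<Gamma> \<turnstile> A \<^bold>: Univ i; \<Gamma> \<turnstile> B \<^bold>: A \<rightarrow> Univ i; \<Gamma> \<turnstile> C \<^bold>: Sig A B \<rightarrow> Univ j;
      \<Gamma> \<turnstile> d \<^bold>: Pi A (Pi (wk 1 B \<cdot> Var 0) (wk 2 C \<cdot> Tup (Var 1) (Var 0)));
      \<Gamma> \<turnstile> p \<^bold>: Sig A B\<rbrakk>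
     \<Longrightarrow> \<Gamma> \<turnstile> SigElim C d p \<^bold>: C \<cdot> p"
| Sig_comp:
    "\<lbrakk>\<Gamma> \<turnstile> A \<^bold>: Univ i; \<Gamma> \<turnstile> B \<^bold>: A \<rightarrow> Univ i; \<Gamma> \<turnstile> C \<^bold>: Sig A B \<rightarrow> Univ j;
      \<Gamma> \<turnstile> d \<^bold>: Pi A (Pi (wk 1 B \<cdot> Var 0) (wk 2 C \<cdot> Tup (Var 1) (Var 0)));
      \<Gamma> \<turnstile> a \<^bold>: A; \<Gamma> \<turnstile> b \<^bold>: B \<cdot> a\<rbrakk>
     \<Longrightarrow> \<Gamma> \<turnstile> SigElim C d (Tup a b) \<doteq> d \<cdot> a \<cdot> b \<^bold>: C \<cdot> Tup a b"

| Empty_form: "\<turnstile> \<Gamma> ctx \<Longrightarrow> \<Gamma> \<turnstile> Empty \<^bold>: Univ 0"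
| Empty_elim: "\<Gamma> \<turnstile> C \<^bold>: Empty \<rightarrow> Univ j \<Longrightarrow> \<Gamma> \<turnstile> e \<^bold>: Empty \<Longrightarrow> \<Gamma> \<turnstile> EmptyElim C e \<^bold>: C \<cdot> e"

| Unit_form: "\<turnstile> \<Gamma> ctx \<Longrightarrow> \<Gamma> \<turnstile> Unit \<^bold>: Univ 0"
| Unit_intro: "\<turnstile> \<Gamma> ctx \<Longrightarrow> \<Gamma> \<turnstile> Star \<^bold>: Unit"
| Unit_elim:
    "\<lbrakk>\<Gamma> \<turnstile> C \<^bold>: Unit \<rightarrow> Univ j; \<Gamma> \<turnstile> d \<^bold>: C \<cdot> Star; \<Gamma> \<turnstile> u \<^bold>: Unit\<rbrakk> \<Longrightarrow> \<Gamma> \<turnstile> UnitElim C d u \<^bold>: C \<cdot> u"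
| Unit_comp:
    "\<lbrakk>\<Gamma> \<turnstile> C \<^bold>: Unit \<rightarrow> Univ j; \<Gamma> \<turnstile> d \<^bold>: C \<cdot> Star\<rbrakk> \<Longrightarrow> \<Gamma> \<turnstile> UnitElim C d Star \<doteq> d \<^bold>: C \<cdot> Star"

| Nat_form: "\<turnstile> \<Gamma> ctx \<Longrightarrow> \<Gamma> \<turnstile> NatT \<^bold>: Univ 0"
| Nat_zero: "\<turnstile> \<Gamma> ctx \<Longrightarrow> \<Gamma> \<turnstile> ZeroT \<^bold>: NatT"
| Nat_suc: "\<Gamma> \<turnstile> m \<^bold>: NatT \<Longrightarrow> \<Gamma> \<turnstile> SucT m \<^bold>: NatT"
| Nat_elim:
    "\<lbrakk>\<Gamma> \<turnstile> C \<^bold>: NatT \<rightarrow> Univ j; \<Gamma> \<turnstile> z \<^bold>: C \<cdot> ZeroT;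
      \<Gamma> \<turnstile> d \<^bold>: Pi NatT (wk 1 C \<cdot> Var 0 \<rightarrow> wk 1 C \<cdot> SucT (Var 0)); \<Gamma> \<turnstile> m \<^bold>: NatT\<rbrakk>
     \<Longrightarrow> \<Gamma> \<turnstile> NatElim C z d m \<^bold>: C \<cdot> m"
| Nat_comp_zero:
    "\<lbrakk>\<Gamma> \<turnstile> C \<^bold>: NatT \<rightarrow> Univ j; \<Gamma> \<turnstile> z \<^bold>: C \<cdot> ZeroT;
      \<Gamma> \<turnstile> d \<^bold>: Pi NatT (wk 1 C \<cdot> Var 0 \<rightarrow> wk 1 C \<cdot> SucT (Var 0))\<rbrakk>
     \<Longrightarrow> \<Gamma> \<turnstile> NatElim C z d ZeroT \<doteq> z \<^bold>: C \<cdot> ZeroT"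
| Nat_comp_suc:
    "\<lbrakk>\<Gamma> \<turnstile> C \<^bold>: NatT \<rightarrow> Univ j; \<Gamma> \<turnstile> z \<^bold>: C \<cdot> ZeroT;
      \<Gamma> \<turnstile> d \<^bold>: Pi NatT (wk 1 C \<cdot> Var 0 \<rightarrow> wk 1 C \<cdot> SucT (Var 0)); \<Gamma> \<turnstile> m \<^bold>: NatT\<rbrakk>
     \<Longrightarrow> \<Gamma> \<turnstile> NatElim C z d (SucT m) \<doteq> d \<cdot> m \<cdot> NatElim C z d m \<^bold>: C \<cdot> SucT m"

| Coprod_form: "\<Gamma> \<turnstile> A \<^bold>: Univ i \<Longrightarrow> \<Gamma> \<turnstile> B \<^bold>: Univ i \<Longrightarrow> \<Gamma> \<turnstile> Coprod A B \<^bold>: Univ i"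
| Coprod_inl:
    "\<lbrakk>\<Gamma> \<turnstile> A \<^bold>: Univ i; \<Gamma> \<turnstile> B \<^bold>: Univ i; \<Gamma> \<turnstile> a \<^bold>: A\<rbrakk> \<Longrightarrow> \<Gamma> \<turnstile> InL a \<^bold>: Coprod A B"
| Coprod_inr:
    "\<lbrakk>\<Gamma> \<turnstile> A \<^bold>: Univ i; \<Gamma> \<turnstile> B \<^bold>: Univ i; \<Gamma> \<turnstile> b \<^bold>: B\<rbrakk> \<Longrightarrow> \<Gamma> \<turnstile> InR b \<^bold>: Coprod A B"
| Coprod_elim:
    "\<lbrakk>\<Gamma> \<turnstile> A \<^bold>: Univ i; \<Gamma> \<turnstile> B \<^bold>: Univ i; \<Gamma> \<turnstile> C \<^bold>: Coprod A B \<rightarrow> Univ j;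
      \<Gamma> \<turnstile> l \<^bold>: Pi A (wk 1 C \<cdot> InL (Var 0)); \<Gamma> \<turnstile> r \<^bold>: Pi B (wk 1 C \<cdot> InR (Var 0));
      \<Gamma> \<turnstile> p \<^bold>: Coprod A B\<rbrakk>
     \<Longrightarrow> \<Gamma> \<turnstile> CoprodElim C l r p \<^bold>: C \<cdot> p"
| Coprod_comp_inl:
    "\<lbrakk>\<Gamma> \<turnstile> A \<^bold>: Univ i; \<Gamma> \<turnstile> B \<^bold>: Univ i; \<Gamma> \<turnstile> C \<^bold>: Coprod A B \<rightarrow> Univ j;
      \<Gamma> \<turnstile> l \<^bold>: Pi A (wk 1 C \<cdot> InL (Var 0)); \<Gamma> \<turnstile> r \<^bold>: Pi B (wk 1 C \<cdot> InR (Var 0));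
      \<Gamma> \<turnstile> a \<^bold>: A\<rbrakk>
     \<Longrightarrow> \<Gamma> \<turnstile> CoprodElim C l r (InL a) \<doteq> l \<cdot> a \<^bold>: C \<cdot> InL a"
| Coprod_comp_inr:
    "\<lbrakk>\<Gamma> \<turnstile> A \<^bold>: Univ i; \<Gamma> \<turnstile> B \<^bold>: Univ i; \<Gamma> \<turnstile> C \<^bold>: Coprod A B \<rightarrow> Univ j;
      \<Gamma> \<turnstile> l \<^bold>: Pi A (wk 1 C \<cdot> InL (Var 0)); \<Gamma> \<turnstile> r \<^bold>: Pi B (wk 1 C \<cdot> InR (Var 0));
      \<Gamma> \<turnstile> b \<^bold>: B\<rbrakk>
     \<Longrightarrow> \<Gamma> \<turnstile> CoprodElim C l r (InR b) \<doteq> r \<cdot> b \<^bold>: C \<cdot> InR b"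

| Id_form: "\<lbrakk>\<Gamma> \<turnstile> A \<^bold>: Univ i; \<Gamma> \<turnstile> a \<^bold>: A; \<Gamma> \<turnstile> b \<^bold>: A\<rbrakk> \<Longrightarrow> \<Gamma> \<turnstile> Idt A a b \<^bold>: Univ i"
| Id_intro: "\<Gamma> \<turnstile> A \<^bold>: Univ i \<Longrightarrow> \<Gamma> \<turnstile> a \<^bold>: A \<Longrightarrow> \<Gamma> \<turnstile> Refl a \<^bold>: Idt A a a"
| Id_elim:
    "\<lbrakk>\<Gamma> \<turnstile> A \<^bold>: Univ i;
      \<Gamma> \<turnstile> C \<^bold>: Pi A (Pi (wk 1 A) (Idt (wk 2 A) (Var 1) (Var 0) \<rightarrow> Univ j));
      \<Gamma> \<turnstile> d \<^bold>: Pi A (wk 1 C \<cdot> Var 0 \<cdot> Var 0 \<cdot> Refl (Var 0));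
      \<Gamma> \<turnstile> a \<^bold>: A; \<Gamma> \<turnstile> b \<^bold>: A; \<Gamma> \<turnstile> p \<^bold>: Idt A a b\<rbrakk>
     \<Longrightarrow> \<Gamma> \<turnstile> J C d a b p \<^bold>: C \<cdot> a \<cdot> b \<cdot> p"
| Id_comp:
    "\<lbrakk>\<Gamma> \<turnstile> A \<^bold>: Univ i;
      \<Gamma> \<turnstile> C \<^bold>: Pi A (Pi (wk 1 A) (Idt (wk 2 A) (Var 1) (Var 0) \<rightarrow> Univ j));
      \<Gamma> \<turnstile> d \<^bold>: Pi A (wk 1 C \<cdot> Var 0 \<cdot> Var 0 \<cdot> Refl (Var 0));
      \<Gamma> \<turnstile> a \<^bold>: A\<rbrakk>
     \<Longrightarrow> \<Gamma> \<turnstile> J C d a a (Refl a) \<doteq> d \<cdot> a \<^bold>: C \<cdot> a \<cdot> a \<cdot> Refl a"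

| IW_form:
    "\<lbrakk>\<Gamma> \<turnstile> A \<^bold>: Univ i; \<Gamma> \<turnstile> I \<^bold>: Univ i; \<Gamma> \<turnstile> B \<^bold>: A \<rightarrow> Univ i; \<Gamma> \<turnstile> t \<^bold>: A \<rightarrow> I; \<Gamma> \<turnstile> s \<^bold>: Sig A B \<rightarrow> I;
      \<Gamma> \<turnstile> k \<^bold>: I\<rbrakk>
     \<Longrightarrow> \<Gamma> \<turnstile> IW A I B t s k \<^bold>: Univ i"
| IW_intro:
    "\<lbrakk>\<Gamma> \<turnstile> A \<^bold>: Univ i; \<Gamma> \<turnstile> I \<^bold>: Univ i; \<Gamma> \<turnstile> B \<^bold>: A \<rightarrow> Univ i; \<Gamma> \<turnstile> t \<^bold>: A \<rightarrow> I; \<Gamma> \<turnstile> s \<^bold>: Sig A B \<rightarrow> I;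
      \<Gamma> \<turnstile> a \<^bold>: A; \<Gamma> \<turnstile> f \<^bold>: subtrees A I B t s a\<rbrakk>
     \<Longrightarrow> \<Gamma> \<turnstile> Sup a f \<^bold>: IW A I B t s (t \<cdot> a)"
| IW_elim:
    "\<lbrakk>\<Gamma> \<turnstile> A \<^bold>: Univ i; \<Gamma> \<turnstile> I \<^bold>: Univ i; \<Gamma> \<turnstile> B \<^bold>: A \<rightarrow> Univ i; \<Gamma> \<turnstile> t \<^bold>: A \<rightarrow> I; \<Gamma> \<turnstile> s \<^bold>: Sig A B \<rightarrow> I;
      \<Gamma> \<turnstile> C \<^bold>: Pi I (IW (wk 1 A) (wk 1 I) (wk 1 B) (wk 1 t) (wk 1 s) (Var 0) \<rightarrow> Univ j);
      \<Gamma> \<turnstile> h \<^bold>: IW_step A I B t s C;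
      \<Gamma> \<turnstile> k \<^bold>: I; \<Gamma> \<turnstile> w \<^bold>: IW A I B t s k\<rbrakk>
     \<Longrightarrow> \<Gamma> \<turnstile> IWElim C h k w \<^bold>: C \<cdot> k \<cdot> w"
| IW_comp:
    "\<lbrakk>\<Gamma> \<turnstile> A \<^bold>: Univ i; \<Gamma> \<turnstile> I \<^bold>: Univ i; \<Gamma> \<turnstile> B \<^bold>: A \<rightarrow> Univ i; \<Gamma> \<turnstile> t \<^bold>: A \<rightarrow> I; \<Gamma> \<turnstile> s \<^bold>: Sig A B \<rightarrow> I;
      \<Gamma> \<turnstile> C \<^bold>: Pi I (IW (wk 1 A) (wk 1 I) (wk 1 B) (wk 1 t) (wk 1 s) (Var 0) \<rightarrow> Univ j);
      \<Gamma> \<turnstile> h \<^bold>: IW_step A I B t s C;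
      \<Gamma> \<turnstile> a \<^bold>: A; \<Gamma> \<turnstile> f \<^bold>: subtrees A I B t s a\<rbrakk>
     \<Longrightarrow> \<Gamma> \<turnstile> IWElim C h (t \<cdot> a) (Sup a f) \<doteq>
           h \<cdot> a \<cdot> f \<cdot> Lam (B \<cdot> a)
             (IWElim (wk 1 C) (wk 1 h) (wk 1 s \<cdot> Tup (wk 1 a) (Var 0)) (wk 1 f \<cdot> Var 0))
         \<^bold>: C \<cdot> (t \<cdot> a) \<cdot> Sup a f"

| funext:
    "\<lbrakk>\<Gamma> \<turnstile> Pi A B \<^bold>: Univ i; \<Gamma> \<turnstile> f \<^bold>: Pi A B; \<Gamma> \<turnstile> g \<^bold>: Pi A B;
      \<Gamma> \<turnstile> h \<^bold>: Pi A (Idt B (wk 1 f \<cdot> Var 0) (wk 1 g \<cdot> Var 0))\<rbrakk>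
     \<Longrightarrow> \<Gamma> \<turnstile> Funext f g h \<^bold>: Idt (Pi A B) f g"

text \<open>Propositions as types: a type is said to hold in a context if it has an element there.\<close>

definition holds :: "tm list \<Rightarrow> tm \<Rightarrow> bool" (infix "\<tturnstile>" 50) where
  "\<Gamma> \<tturnstile> T \<longleftrightarrow> (\<exists>e. \<Gamma> \<turnstile> e \<^bold>: T)"

definition decidable :: "tm \<Rightarrow> tm" where
  "decidable Y = Coprod Y (Y \<rightarrow> Empty)"

definition has_decidable_equality :: "tm \<Rightarrow> tm" where
  "has_decidable_equality X = Pi X (Pi (wk 1 X) (decidable (Idt (wk 2 X) (Var 1) (Var 0))))"

definition is_proposition :: "tm \<Rightarrow> tm" where
  "is_proposition P = Pi P (Pi (wk 1 P) (Idt (wk 2 P) (Var 1) (Var 0)))"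

definition is_set :: "tm \<Rightarrow> tm" where
  "is_set X = Pi X (Pi (wk 1 X) (is_proposition (Idt (wk 2 X) (Var 1) (Var 0))))"

text \<open>
  \<open>\<Prod>Y : X \<rightarrow> Univ n. (\<Prod>x : X. decidable (Y(x))) \<rightarrow> decidable (\<Prod>x : X. Y(x))\<close>. Type families are indexed by
  the universe in which they take values.
\<close>

definition Pi_compact :: "nat \<Rightarrow> tm \<Rightarrow> tm" where
  "Pi_compact n X =
     Pi (X \<rightarrow> Univ n)
       (Pi (wk 1 X) (decidable (Var 1 \<cdot> Var 0)) \<rightarrow> decidable (Pi (wk 1 X) (Var 1 \<cdot> Var 0)))"

end

theory Submission
  imports Defs
begin

text \<open>
  Fix \<open>w = sup(a, f)\<close> and prove by induction on \<open>w' : W(k)\<close> that \<open>p\<^sub>* w = w'\<close> is decidable for every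
  \<open>p : t(a) = k\<close>. Transporting \<open>w\<close> along \<open>p\<close> lets the index of \<open>w'\<close> vary. Let \<open>w' = sup(a', f')\<close> and decide
  \<open>a = a'\<close>. If \<open>a \<noteq> a'\<close>, then \<open>p\<^sub>* w \<noteq> w'\<close>, because the shape map \<open>W(k) \<rightarrow> A\<close> is invariant under transport.
  If \<open>a = a'\<close>, path induction identifies the two shapes, and then \<open>p : t(a) = t(a)\<close> is \<open>refl\<close> because \<open>I\<close>
  is a set. It remains to decide \<open>sup(a, f) = sup(a, f')\<close>. By the outer induction hypothesis and
  \<open>\<Pi>\<close>-compactness of \<open>B(a)\<close>, the type \<open>\<Prod>b. f(b) = f'(b)\<close> is decidable, and it is logically equivalent to
  the equation by function extensionality in one direction and injectivity of \<open>sup(a, -)\<close> in the other.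

  Only inhabitation matters for most of the argument, so it is carried out as natural deduction for
  the judgement \<open>\<Gamma> \<tturnstile> T\<close> over arbitrary contexts and terms. Proof terms are named only where types depend
  on them, that is for transport and for functions defined by recursion.
\<close>

section \<open>Substitution\<close>

text \<open>Two problems with loops shape the argument. The first is about \<open>I\<close>. Trees
  at different indices can be compared only over a path \<open>p\<close> between the indices, but
  \<open>p : t(a) = t(a')\<close> has values of \<open>t\<close> as endpoints, so path induction
  cannot contract it. Identifying \<open>a\<close> with \<open>a'\<close> leaves a loop, and without
  axiom K a loop need not be \<open>refl\<close>; this is where it matters that \<open>I\<close> is
  a set. The second is about \<open>A\<close>. From \<open>sup(a, f) = sup(a, g)\<close> one would
  expect \<open>f = g\<close> only up to transport along some loop at \<open>a\<close>. The remedy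
  is to let one fixed decision of \<open>a = a\<close> choose the loop: the same loop is then used
  for \<open>f\<close> and for \<open>g\<close>, and transport along a fixed loop can be cancelled
  without knowing which loop it is. Both uses of path induction with dependent data follow one
  pattern: everything whose type mentions the moving endpoint is generalised before the path is
  contracted.\<close>

abbreviation scons :: "tm \<Rightarrow> (nat \<Rightarrow> tm) \<Rightarrow> nat \<Rightarrow> tm" (infixr "#." 65) where
  "a #. \<sigma> \<equiv> case_nat a \<sigma>"

definition shift :: "nat \<Rightarrow> nat \<Rightarrow> tm" where
  "shift k = (\<lambda>i. Var (i + k))"

lemma ren_eq_subst: "ren \<rho> a = subst (\<lambda>i. Var (\<rho> i)) a"
proof (induction a arbitrary: \<rho>)
qed (auto simp: up_def wk_def fun_eq_iff intro!: arg_cong2[where f = subst] split: nat.splits)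

lemma wk_eq_subst: "wk k a = subst (shift k) a"
  by (simp add: wk_def shift_def ren_eq_subst)

lemma subst_ren: "subst \<sigma> (ren \<rho> a) = subst (\<lambda>i. \<sigma> (\<rho> i)) a"
proof (induction a arbitrary: \<sigma> \<rho>)
qed (auto simp: up_def fun_eq_iff intro!: arg_cong2[where f = subst] split: nat.splits)

lemma ren_ren: "ren \<rho> (ren \<rho>' a) = ren (\<lambda>i. \<rho> (\<rho>' i)) a"
  by (simp add: ren_eq_subst[of \<rho>] ren_eq_subst[of "\<lambda>i. \<rho> (\<rho>' i)"] subst_ren)

lemma ren_subst: "ren \<rho> (subst \<sigma> a) = subst (\<lambda>i. ren \<rho> (\<sigma> i)) a"
proof (induction a arbitrary: \<sigma> \<rho>)
qed (auto simp: up_def wk_def ren_ren fun_eq_iff intro!: arg_cong2[where f = subst] split: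
    nat.splits)

text \<open>Under a binder \<open>up\<close> weakens the substitution, so the induction step must
  move a renaming past a substitution from either side. That is why \<open>subst_ren\<close> and
  \<open>ren_subst\<close> come first.\<close>

lemma subst_subst: "subst \<tau> (subst \<sigma> a) = subst (\<lambda>i. subst \<tau> (\<sigma> i)) a"
proof (induction a arbitrary: \<sigma> \<tau>)
qed (auto simp: up_def wk_def ren_subst subst_ren fun_eq_iff intro!: arg_cong2[where f = subst]
    split: nat.splits)

lemma subst_Var [simp]: "subst Var a = a"
proof -
  have "up Var = Var" by (auto simp: up_def wk_def fun_eq_iff split: nat.splits)
  then show ?thesis by (induction a) auto
qed

definition comp_subst :: "(nat \<Rightarrow> tm) \<Rightarrow> (nat \<Rightarrow> tm) \<Rightarrow> nat \<Rightarrow> tm" (infixr "\<odot>" 70) where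
  "\<tau> \<odot> \<sigma> = (\<lambda>i. subst \<tau> (\<sigma> i))"

text \<open>
  The simplifier brings every weakening and instantiation into the form \<open>subst \<sigma> a\<close> with
  \<open>\<sigma> = a\<^sub>1 #. \<dots> #. a\<^sub>m #. shift k\<close>. Numerals become
  successors so that \<open>shift\<close> can cancel against \<open>#.\<close>.
\<close>

declare wk_eq_subst [simp] numeral_eq_Suc [simp]

lemma subst_comp [simp]: "subst \<tau> (subst \<sigma> a) = subst (\<tau> \<odot> \<sigma>) a"
  by (simp add: subst_subst comp_subst_def)

lemma up_eq [simp]: "up \<sigma> = Var 0 #. shift (Suc 0) \<odot> \<sigma>"
  by (auto simp: up_def comp_subst_def fun_eq_iff split: nat.splits)

lemma shift_apply [simp]: "shift k i = Var (i + k)"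
  by (simp add: shift_def)

lemma shift_0 [simp]: "shift 0 = Var"
  by (simp add: shift_def)

lemma scons_shift [simp]: "Var k #. shift (Suc k) = shift k"
  by (auto simp: shift_def fun_eq_iff split: nat.splits)

lemma comp_apply [simp]: "(\<tau> \<odot> \<sigma>) i = subst \<tau> (\<sigma> i)"
  by (simp add: comp_subst_def)

lemma comp_scons [simp]: "\<tau> \<odot> (a #. \<sigma>) = subst \<tau> a #. \<tau> \<odot> \<sigma>"
  by (auto simp: comp_subst_def fun_eq_iff split: nat.splits)

lemma comp_shift_Suc [simp]: "(a #. \<sigma>) \<odot> shift (Suc k) = \<sigma> \<odot> shift k"
  by (auto simp: fun_eq_iff)

lemma comp_shift_shift [simp]: "shift j \<odot> shift k = shift (j + k)"
  by (auto simp: fun_eq_iff)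

lemma comp_assoc [simp]: "(\<rho> \<odot> \<tau>) \<odot> \<sigma> = \<rho> \<odot> (\<tau> \<odot> \<sigma>)"
  by (auto simp: fun_eq_iff)

text \<open>As \<open>comp_assoc\<close> rotates composites to the right, a redex
  \<open>(a #. \<sigma>) \<odot> shift (Suc k)\<close> can be hidden inside
  \<open>(a #. \<sigma>) \<odot> (shift (Suc k) \<odot> \<tau>)\<close>. This law and the next
  restate the cancellation for that shape.\<close>

lemma comp_shift_Suc_comp [simp]: "(a #. \<sigma>) \<odot> (shift (Suc k) \<odot> \<tau>) = \<sigma> \<odot> (shift k \<odot> \<tau>)"
  by (simp flip: comp_assoc)

lemma comp_shift_shift_comp [simp]: "shift j \<odot> (shift k \<odot> \<sigma>) = shift (j + k) \<odot> \<sigma>"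
  by (simp flip: comp_assoc)

lemma comp_Var [simp]: "\<sigma> \<odot> Var = \<sigma>" "Var \<odot> \<sigma> = \<sigma>"
  by (auto simp: fun_eq_iff)

lemma inst_eq [simp]: "inst b a = subst (a #. Var) b"
  by (simp add: inst_def)

lemma subst_Arrow [simp]: "subst \<sigma> (A \<rightarrow> B) = subst \<sigma> A \<rightarrow> subst \<sigma> B"
  by (simp add: Arrow_def)

lemma subst_subtrees [simp]:
  "subst \<sigma> (subtrees A I B t s a) =
   subtrees (subst \<sigma> A) (subst \<sigma> I) (subst \<sigma> B) (subst \<sigma> t) (subst \<sigma> s) (subst \<sigma> a)"
  by (simp add: subtrees_def)

lemma subst_decidable [simp]: "subst \<sigma> (decidable X) = decidable (subst \<sigma> X)"
  by (simp add: decidable_def)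

lemma subst_has_decidable_equality [simp]:
  "subst \<sigma> (has_decidable_equality X) = has_decidable_equality (subst \<sigma> X)"
  by (simp add: has_decidable_equality_def)

lemma subst_is_proposition [simp]: "subst \<sigma> (is_proposition X) = is_proposition (subst \<sigma> X)"
  by (simp add: is_proposition_def)

lemma subst_is_set [simp]: "subst \<sigma> (is_set X) = is_set (subst \<sigma> X)"
  by (simp add: is_set_def)

lemma subst_Pi_compact [simp]: "subst \<sigma> (Pi_compact n X) = Pi_compact n (subst \<sigma> X)"
  by (simp add: Pi_compact_def)

section \<open>Structural rules\<close>

text \<open>Every rule has a premise in the context of its conclusion or asks for that context to be
  well formed, so mutual rule induction suffices. \<open>True\<close> stands in for the context
  judgement, about which there is nothing to show.\<close>

lemma
  shows "\<turnstile> \<Gamma> ctx \<Longrightarrow> True"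
    and ctx_of_type: "\<Gamma> \<turnstile> a \<^bold>: A \<Longrightarrow> \<turnstile> \<Gamma> ctx"
    and ctx_of_eq: "\<Gamma> \<turnstile> a \<doteq> b \<^bold>: A \<Longrightarrow> \<turnstile> \<Gamma> ctx"
  by (induction \<Gamma> and \<Gamma> a A and \<Gamma> a b A rule: wf_ctx_has_type_jeq.inducts) auto

lemma cumul_le: "\<Gamma> \<turnstile> A \<^bold>: Univ i \<Longrightarrow> i \<le> j \<Longrightarrow> \<Gamma> \<turnstile> A \<^bold>: Univ j"
  by (induction j) (auto intro: cumul simp: le_Suc_eq)

lemma eq_cumul_le: "\<Gamma> \<turnstile> A \<doteq> B \<^bold>: Univ i \<Longrightarrow> i \<le> j \<Longrightarrow> \<Gamma> \<turnstile> A \<doteq> B \<^bold>: Univ j"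
  by (induction j) (auto intro: eq_cumul simp: le_Suc_eq)

text \<open>Hides the universe level. Rules such as \<open>Pi_form\<close> want one level for all
  premises; with the level existentially bound, it is raised to a maximum once, in
  \<open>type_Pi\<close> and \<open>eq_type_Pi\<close>, and need not be tracked afterwards.\<close>

definition is_type :: "tm list \<Rightarrow> tm \<Rightarrow> bool" ("_ \<turnstile> _ type" [60, 60] 50) where
  "\<Gamma> \<turnstile> A type \<longleftrightarrow> (\<exists>i. \<Gamma> \<turnstile> A \<^bold>: Univ i)"

definition eq_type :: "tm list \<Rightarrow> tm \<Rightarrow> tm \<Rightarrow> bool" ("_ \<turnstile> _ \<doteq> _ type" [60, 60, 60] 50) where
  "\<Gamma> \<turnstile> A \<doteq> B type \<longleftrightarrow> (\<exists>i. \<Gamma> \<turnstile> A \<doteq> B \<^bold>: Univ i)"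

lemma typeI: "\<Gamma> \<turnstile> A \<^bold>: Univ i \<Longrightarrow> \<Gamma> \<turnstile> A type"
  by (auto simp: is_type_def)

lemma eq_typeI: "\<Gamma> \<turnstile> A \<doteq> B \<^bold>: Univ i \<Longrightarrow> \<Gamma> \<turnstile> A \<doteq> B type"
  by (auto simp: eq_type_def)

lemma ctx_consI: "\<Gamma> \<turnstile> A type \<Longrightarrow> \<turnstile> A # \<Gamma> ctx"
  by (auto simp: is_type_def intro: ctx_cons ctx_of_type)

lemma ctx_consD: "\<turnstile> A # \<Gamma> ctx \<Longrightarrow> \<turnstile> \<Gamma> ctx" "\<turnstile> A # \<Gamma> ctx \<Longrightarrow> \<Gamma> \<turnstile> A type"
  by (auto simp: is_type_def elim: wf_ctx.cases)

lemma ctx_head: "A # \<Gamma> \<turnstile> a \<^bold>: T \<Longrightarrow> \<Gamma> \<turnstile> A type"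
  by (rule ctx_consD(2)[OF ctx_of_type])

lemma ctx_of_is_type: "\<Gamma> \<turnstile> A type \<Longrightarrow> \<turnstile> \<Gamma> ctx"
  by (auto simp: is_type_def intro: ctx_of_type)

lemma type_Univ: "\<turnstile> \<Gamma> ctx \<Longrightarrow> \<Gamma> \<turnstile> Univ i type"
  by (blast intro: typeI univ)

lemma type_Pi:
  assumes "A # \<Gamma> \<turnstile> B type"
  shows "\<Gamma> \<turnstile> Pi A B type"
proof -
  obtain j where j: "A # \<Gamma> \<turnstile> B \<^bold>: Univ j" using assms by (auto simp: is_type_def)
  then obtain i where i: "\<Gamma> \<turnstile> A \<^bold>: Univ i"
    using ctx_head[of A \<Gamma>] by (auto simp: is_type_def)
  show ?thesis
    by (rule typeI[OF Pi_form[OF cumul_le[OF i, of "max i j"] cumul_le[OF j, of "max i j"]]]) auto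
qed

lemma eq_type_Pi:
  assumes "\<Gamma> \<turnstile> A \<doteq> A' type" "A # \<Gamma> \<turnstile> B \<doteq> B' type"
  shows "\<Gamma> \<turnstile> Pi A B \<doteq> Pi A' B' type"
proof -
  obtain i j where "\<Gamma> \<turnstile> A \<doteq> A' \<^bold>: Univ i" "A # \<Gamma> \<turnstile> B \<doteq> B' \<^bold>: Univ j"
    using assms by (auto simp: eq_type_def)
  then show ?thesis
    by (intro eq_typeI[OF Pi_cong[where i = "max i j"]]) (auto intro: eq_cumul_le)
qed

lemma eq_type_refl: "\<Gamma> \<turnstile> A type \<Longrightarrow> \<Gamma> \<turnstile> A \<doteq> A type"
  by (auto simp: is_type_def eq_type_def intro: eq_refl)

lemma eq_type_sym: "\<Gamma> \<turnstile> A \<doteq> B type \<Longrightarrow> \<Gamma> \<turnstile> B \<doteq> A type"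
  by (auto simp: eq_type_def intro: eq_sym)

lemma conv_type: "\<Gamma> \<turnstile> A \<doteq> B type \<Longrightarrow> \<Gamma> \<turnstile> a \<^bold>: A \<Longrightarrow> \<Gamma> \<turnstile> a \<^bold>: B"
  by (auto simp: eq_type_def intro: conv)

lemma eq_conv_type: "\<Gamma> \<turnstile> A \<doteq> B type \<Longrightarrow> \<Gamma> \<turnstile> a \<doteq> b \<^bold>: A \<Longrightarrow> \<Gamma> \<turnstile> a \<doteq> b \<^bold>: B"
  by (auto simp: eq_type_def intro: eq_conv)

text \<open>Morphisms of contexts: \<open>\<sigma>\<close> interprets the variables of \<Gamma> by
  terms over \<Delta>. With well-formedness of both contexts included, this is exactly the side
  condition of the rule \<open>substitution\<close>.\<close>

definition subst_map :: "tm list \<Rightarrow> (nat \<Rightarrow> tm) \<Rightarrow> tm list \<Rightarrow> bool" where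
  "subst_map \<Delta> \<sigma> \<Gamma> \<longleftrightarrow> \<turnstile> \<Delta> ctx \<and> \<turnstile> \<Gamma> ctx \<and> (\<forall>i < length \<Gamma>. \<Delta> \<turnstile> \<sigma> i \<^bold>: subst \<sigma> (wk (Suc i) (\<Gamma> ! i)))"

lemma subst_map_type: "subst_map \<Delta> \<sigma> \<Gamma> \<Longrightarrow> \<Gamma> \<turnstile> a \<^bold>: A \<Longrightarrow> \<Delta> \<turnstile> subst \<sigma> a \<^bold>: subst \<sigma> A"
  unfolding subst_map_def by (blast intro: substitution)

lemma subst_map_eq: "subst_map \<Delta> \<sigma> \<Gamma> \<Longrightarrow> \<Gamma> \<turnstile> a \<doteq> b \<^bold>: A \<Longrightarrow> \<Delta> \<turnstile> subst \<sigma> a \<doteq> subst \<sigma> b \<^bold>: subst \<sigma> A"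
  unfolding subst_map_def by (blast intro: eq_substitution eq_refl)

lemma subst_map_is_type: "subst_map \<Delta> \<sigma> \<Gamma> \<Longrightarrow> \<Gamma> \<turnstile> A type \<Longrightarrow> \<Delta> \<turnstile> subst \<sigma> A type"
  unfolding is_type_def using subst_map_type by fastforce

lemma subst_map_eq_type: "subst_map \<Delta> \<sigma> \<Gamma> \<Longrightarrow> \<Gamma> \<turnstile> A \<doteq> B type \<Longrightarrow> \<Delta> \<turnstile> subst \<sigma> A \<doteq> subst \<sigma> B type"
  unfolding eq_type_def using subst_map_eq by fastforce

lemma subst_map_holds: "subst_map \<Delta> \<sigma> \<Gamma> \<Longrightarrow> \<Gamma> \<tturnstile> A \<Longrightarrow> \<Delta> \<tturnstile> subst \<sigma> A"
  unfolding holds_def using subst_map_type by blast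

lemma subst_map_shift:
  assumes "\<turnstile> \<Delta> @ \<Gamma> ctx"
  shows "subst_map (\<Delta> @ \<Gamma>) (shift (length \<Delta>)) \<Gamma>"
proof -
  have "\<turnstile> \<Gamma> ctx" using assms by (induction \<Delta>) (auto dest: ctx_consD)
  moreover have "\<Delta> @ \<Gamma> \<turnstile> Var (i + length \<Delta>) \<^bold>: wk (Suc (i + length \<Delta>)) (\<Gamma> ! i)" if "i < length \<Gamma>"
      for i
    using var[OF assms, of "i + length \<Delta>"] that by (simp add: nth_append)
  ultimately show ?thesis
    using assms unfolding subst_map_def by (simp add: add.commute)
qed

lemma subst_map_Var: "\<turnstile> \<Gamma> ctx \<Longrightarrow> subst_map \<Gamma> Var \<Gamma>"
  using subst_map_shift[of "[]"] by simp

lemma subst_map_shift1: "\<turnstile> X # \<Gamma> ctx \<Longrightarrow> subst_map (X # \<Gamma>) (shift (Suc 0)) \<Gamma>"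
  using subst_map_shift[of "[X]"] by simp

lemma subst_map_scons:
  assumes "subst_map \<Delta> \<sigma> \<Gamma>" "\<Gamma> \<turnstile> X type" "\<Delta> \<turnstile> a \<^bold>: subst \<sigma> X"
  shows "subst_map \<Delta> (a #. \<sigma>) (X # \<Gamma>)"
  unfolding subst_map_def
proof (intro conjI allI impI)
  fix i assume "i < length (X # \<Gamma>)"
  then show "\<Delta> \<turnstile> (a #. \<sigma>) i \<^bold>: subst (a #. \<sigma>) (wk (Suc i) ((X # \<Gamma>) ! i))"
    using assms by (cases i) (auto simp: subst_map_def)
qed (use assms in \<open>auto simp: subst_map_def intro: ctx_consI\<close>)

lemma subst_map_up:
  assumes "subst_map \<Delta> \<sigma> \<Gamma>" "\<Gamma> \<turnstile> X type"
  shows "subst_map (subst \<sigma> X # \<Delta>) (Var 0 #. shift (Suc 0) \<odot> \<sigma>) (X # \<Gamma>)"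
proof (rule subst_map_scons)
  have c: "\<turnstile> subst \<sigma> X # \<Delta> ctx" using assms by (auto intro: ctx_consI subst_map_is_type)
  show "subst_map (subst \<sigma> X # \<Delta>) (shift (Suc 0) \<odot> \<sigma>) \<Gamma>"
    using assms(1) c subst_map_type[OF subst_map_shift1[OF c], of
        "\<sigma> _"] unfolding subst_map_def by fastforce
  show "subst \<sigma> X # \<Delta> \<turnstile> Var 0 \<^bold>: subst (shift (Suc 0) \<odot> \<sigma>) X"
    using var[OF c, of 0] by simp
qed fact

text \<open>The two parallel substitutions differ only at index 0 and agree by reflexivity
  elsewhere. Congruence for any former that binds no variable follows by putting a fresh variable in
  place of the varying argument.\<close>

lemma eq_inst:
  assumes "X # \<Gamma> \<turnstile> c \<^bold>: C" "\<Gamma> \<turnstile> a \<doteq> b \<^bold>: X"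
  shows "\<Gamma> \<turnstile> subst (a #. Var) c \<doteq> subst (b #. Var) c \<^bold>: subst (a #. Var) C"
proof (rule eq_substitution[OF eq_refl[OF assms(1)]])
  have g: "\<turnstile> \<Gamma> ctx" using assms(2) by (rule ctx_of_eq)
  show "\<turnstile> X # \<Gamma> ctx" "\<turnstile> \<Gamma> ctx" using assms by (auto intro: ctx_of_type ctx_of_eq)
  have "\<Gamma> \<turnstile> (a #. Var) i \<doteq> (b #. Var) i \<^bold>: subst (a #. Var) (wk (Suc i) ((X # \<Gamma>) ! i))"
    if "i < length (X # \<Gamma>)" for i
    using that assms(2) eq_refl[OF var[OF g]] by (cases i) auto
  then show "\<forall>i<length (X # \<Gamma>). \<Gamma> \<turnstile> (a #. Var) i \<doteq> (b #. Var) i \<^bold>: subst (a #. Var) (wk (Suc i)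
      ((X # \<Gamma>) ! i))"
    by blast
qed

lemma eq_inst_type:
  assumes "X # \<Gamma> \<turnstile> C type" "\<Gamma> \<turnstile> a \<doteq> b \<^bold>: X"
  shows "\<Gamma> \<turnstile> subst (a #. Var) C \<doteq> subst (b #. Var) C type"
  using assms eq_inst[OF _ assms(2)] unfolding is_type_def eq_type_def by fastforce

lemma var0: "\<Gamma> \<turnstile> X type \<Longrightarrow> X # \<Gamma> \<turnstile> Var 0 \<^bold>: subst (shift (Suc 0)) X"
  using var[OF ctx_consI, of \<Gamma> X 0] by simp

lemma wk_type: "\<Gamma> \<turnstile> a \<^bold>: A \<Longrightarrow> \<Gamma> \<turnstile> X type \<Longrightarrow> X # \<Gamma> \<turnstile> subst (shift (Suc 0)) a \<^bold>: subst (shift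
    (Suc 0)) A"
  by (rule subst_map_type[OF subst_map_shift1[OF ctx_consI]])

lemma type_inst: "X # \<Gamma> \<turnstile> b \<^bold>: B \<Longrightarrow> \<Gamma> \<turnstile> a \<^bold>: X \<Longrightarrow> \<Gamma> \<turnstile> subst (a #. Var) b \<^bold>: subst (a #. Var) B"
  by (rule subst_map_type[OF subst_map_scons[OF subst_map_Var]])
     (auto intro: ctx_of_type ctx_consD)

lemma is_type_inst: "X # \<Gamma> \<turnstile> B type \<Longrightarrow> \<Gamma> \<turnstile> a \<^bold>: X \<Longrightarrow> \<Gamma> \<turnstile> subst (a #. Var) B type"
  unfolding is_type_def using type_inst by fastforce

text \<open>The function position is abstracted: \<open>Var 0 \<cdot> wk 1 a\<close> is typed over a
  variable of type \<open>Pi A B\<close>, and \<open>eq_inst\<close> then puts the two equal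
  functions in its place.\<close>

lemma App_eq:
  assumes "\<Gamma> \<turnstile> f \<doteq> g \<^bold>: Pi A B" "\<Gamma> \<turnstile> a \<^bold>: A" "A # \<Gamma> \<turnstile> B type"
  shows "\<Gamma> \<turnstile> f \<cdot> a \<doteq> g \<cdot> a \<^bold>: subst (a #. Var) B"
proof -
  let ?P = "Pi A B"
  have P: "\<Gamma> \<turnstile> ?P type" using assms by (intro type_Pi)
  have "?P # \<Gamma> \<turnstile> Var 0 \<cdot> subst (shift (Suc 0)) a \<^bold>: subst (shift (Suc 0)) (subst (a #. Var) B)"
    using Pi_elim[OF var0[OF P, simplified] wk_type[OF assms(2) P]] by simp
  from eq_inst[OF this assms(1)] show ?thesis by simp
qed

lemma beta1:
  assumes "X # \<Gamma> \<turnstile> c \<^bold>: T" "\<Gamma> \<turnstile> a \<^bold>: X"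
  shows "\<Gamma> \<turnstile> Lam X c \<cdot> a \<doteq> subst (a #. Var) c \<^bold>: subst (a #. Var) T"
  using Pi_beta[OF assms] by simp

lemma Lam_type: "X # \<Gamma> \<turnstile> c \<^bold>: T \<Longrightarrow> \<Gamma> \<turnstile> Lam X c \<^bold>: Pi X T"
  using ctx_head[of X \<Gamma>] by (auto simp: is_type_def intro: Pi_intro)

lemma App_type: "\<Gamma> \<turnstile> f \<^bold>: Pi X T \<Longrightarrow> \<Gamma> \<turnstile> a \<^bold>: X \<Longrightarrow> \<Gamma> \<turnstile> f \<cdot> a \<^bold>: subst (a #. Var) T"
  using Pi_elim by simp

lemma beta2:
  assumes c: "Y # X # \<Gamma> \<turnstile> c \<^bold>: T" and T: "Y # X # \<Gamma> \<turnstile> T type"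
    and a: "\<Gamma> \<turnstile> a \<^bold>: X" and b: "\<Gamma> \<turnstile> b \<^bold>: subst (a #. Var) Y"
  shows "\<Gamma> \<turnstile> Lam X (Lam Y c) \<cdot> a \<cdot> b \<doteq> subst (b #. a #. Var) c \<^bold>: subst (b #. a #. Var) T"
proof -
  have X: "\<Gamma> \<turnstile> X type" and Y: "X # \<Gamma> \<turnstile> Y type"
    using c by (auto dest!: ctx_of_type dest: ctx_consD)
  have m: "subst_map \<Gamma> (a #. Var) (X # \<Gamma>)"
    using a X by (intro subst_map_scons subst_map_Var) (auto intro: ctx_of_type)
  note m' = subst_map_up[OF m Y, simplified]
  have "\<Gamma> \<turnstile> Lam X (Lam Y c) \<cdot> a \<doteq> subst (a #. Var) (Lam Y c) \<^bold>: subst (a #. Var) (Pi Y T)"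
    using beta1[OF Lam_type[OF c] a] .
  then have "\<Gamma> \<turnstile> Lam X (Lam Y c) \<cdot> a \<cdot> b \<doteq> subst (a #. Var) (Lam Y c) \<cdot> b \<^bold>: subst
      (b #. a #. Var) T"
    using App_eq[OF _ b] subst_map_is_type[OF m' T] by fastforce
  moreover have "\<Gamma> \<turnstile> subst (a #. Var) (Lam Y c) \<cdot> b \<doteq> subst (b #. a #. Var) c \<^bold>: subst
      (b #. a #. Var) T"
    using beta1[OF subst_map_type[OF m' c] b] by simp
  ultimately show ?thesis by (rule eq_trans)
qed

lemma beta3:
  assumes c: "Z # Y # X # \<Gamma> \<turnstile> c \<^bold>: T" and T: "Z # Y # X # \<Gamma> \<turnstile> T type"
    and a: "\<Gamma> \<turnstile> a \<^bold>: X" and b: "\<Gamma> \<turnstile> b \<^bold>: subst (a #. Var) Y" and d: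
        "\<Gamma> \<turnstile> d \<^bold>: subst (b #. a #. Var) Z"
  shows "\<Gamma> \<turnstile> Lam X (Lam Y (Lam Z c)) \<cdot> a \<cdot> b \<cdot> d \<doteq> subst (d #. b #. a #. Var) c
           \<^bold>: subst (d #. b #. a #. Var) T"
proof -
  have X: "\<Gamma> \<turnstile> X type" and Y: "X # \<Gamma> \<turnstile> Y type" and Z: "Y # X # \<Gamma> \<turnstile> Z type"
    using c by (auto dest!: ctx_of_type dest: ctx_consD)
  have m: "subst_map \<Gamma> (b #. a #. Var) (Y # X # \<Gamma>)"
    using a b X Y by (intro subst_map_scons subst_map_Var) (auto intro: ctx_of_type)
  note m' = subst_map_up[OF m Z, simplified]
  have "\<Gamma> \<turnstile> Lam X (Lam Y (Lam Z c)) \<cdot> a \<cdot> b \<doteq> subst (b #. a #. Var) (Lam Z c) \<^bold>: subst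
      (b #. a #. Var) (Pi Z T)"
    using beta2[OF Lam_type[OF c] type_Pi[OF T] a b] .
  then have "\<Gamma> \<turnstile> Lam X (Lam Y (Lam Z c)) \<cdot> a \<cdot> b \<cdot> d \<doteq> subst (b #. a #. Var) (Lam Z c) \<cdot> d \<^bold>: subst
      (d #. b #. a #. Var) T"
    using App_eq[OF _ d] subst_map_is_type[OF m' T] by fastforce
  moreover have "\<Gamma> \<turnstile> subst (b #. a #. Var) (Lam Z c) \<cdot> d \<doteq> subst (d #. b #. a #. Var) c \<^bold>: subst
      (d #. b #. a #. Var) T"
    using beta1[OF subst_map_type[OF m' c] d] by simp
  ultimately show ?thesis by (rule eq_trans)
qed

text \<open>Motives are closed off by \<open>Lam\<close> over \<Gamma>, but the types of branches
  and results contain them weakened or substituted. So the contraction is needed for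
  \<open>subst \<sigma> (Lam X c)\<close>.\<close>

lemma beta1_subst:
  assumes c: "X # \<Gamma> \<turnstile> c \<^bold>: T" and m: "subst_map \<Delta> \<sigma> \<Gamma>" and a: "\<Delta> \<turnstile> a \<^bold>: subst \<sigma> X"
  shows "\<Delta> \<turnstile> subst \<sigma> (Lam X c) \<cdot> a \<doteq> subst (a #. \<sigma>) c \<^bold>: subst (a #. \<sigma>) T"
  using beta1[OF subst_map_type[OF subst_map_up[OF m ctx_head[OF c]] c] a] by simp

lemma beta2_subst:
  assumes c: "Y # X # \<Gamma> \<turnstile> c \<^bold>: T" and T: "Y # X # \<Gamma> \<turnstile> T type" and m: "subst_map \<Delta> \<sigma> \<Gamma>"
    and a: "\<Delta> \<turnstile> a \<^bold>: subst \<sigma> X" and b: "\<Delta> \<turnstile> b \<^bold>: subst (a #. \<sigma>) Y"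
  shows "\<Delta> \<turnstile> subst \<sigma> (Lam X (Lam Y c)) \<cdot> a \<cdot> b \<doteq> subst (b #. a #. \<sigma>) c \<^bold>: subst (b #. a #. \<sigma>) T"
proof -
  have Y: "X # \<Gamma> \<turnstile> Y type" and X: "\<Gamma> \<turnstile> X type"
    using ctx_head[OF c] by (auto intro: ctx_consD ctx_of_is_type)
  note m2 = subst_map_up[OF subst_map_up[OF m X] Y]
  show ?thesis
    using beta2[OF subst_map_type[OF m2 c] subst_map_is_type[OF m2 T] a] b by simp
qed

lemma beta3_subst:
  assumes c: "Z # Y # X # \<Gamma> \<turnstile> c \<^bold>: T" and T: "Z # Y # X # \<Gamma> \<turnstile> T type" and m: "subst_map \<Delta> \<sigma> \<Gamma>"
    and a: "\<Delta> \<turnstile> a \<^bold>: subst \<sigma> X" and b: "\<Delta> \<turnstile> b \<^bold>: subst (a #. \<sigma>) Y"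
    and d: "\<Delta> \<turnstile> d \<^bold>: subst (b #. a #. \<sigma>) Z"
  shows "\<Delta> \<turnstile> subst \<sigma> (Lam X (Lam Y (Lam Z c))) \<cdot> a \<cdot> b \<cdot> d \<doteq> subst (d #. b #. a #. \<sigma>) c
           \<^bold>: subst (d #. b #. a #. \<sigma>) T"
proof -
  have Z: "Y # X # \<Gamma> \<turnstile> Z type" and Y: "X # \<Gamma> \<turnstile> Y type" and X: "\<Gamma> \<turnstile> X type"
    using ctx_head[OF c] by (auto dest: ctx_of_is_type ctx_consD)
  note m3 = subst_map_up[OF subst_map_up[OF subst_map_up[OF m X] Y] Z]
  show ?thesis
    using beta3[OF subst_map_type[OF m3 c] subst_map_is_type[OF m3 T] a] b d by simp
qed

section \<open>Elimination rules with open motives\<close>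

text \<open>
  A motive is given below by an open term \<open>C\<close> in the context extended by the scrutinee
      and its indices,
  so that no beta redexes show up in the types.
\<close>

lemma J_rules:
  assumes A: "\<Gamma> \<turnstile> A \<^bold>: Univ i"
    and C: "Idt (wk 2 A) (Var 1) (Var 0) # wk 1 A # A # \<Gamma> \<turnstile> C \<^bold>: Univ j"
    and d: "A # \<Gamma> \<turnstile> d \<^bold>: subst (Refl (Var 0) #. Var 0 #. Var) C"
    and a: "\<Gamma> \<turnstile> a \<^bold>: A"
  defines "M \<equiv> Lam A (Lam (wk 1 A) (Lam (Idt (wk 2 A) (Var 1) (Var 0)) C))"
  shows J_type: "\<Gamma> \<turnstile> b \<^bold>: A \<Longrightarrow> \<Gamma> \<turnstile> p \<^bold>: Idt A a b \<Longrightarrow> \<Gamma>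
      \<turnstile> J M (Lam A d) a b p \<^bold>: subst (p #. b #. a #. Var) C"
    and J_eq: "\<Gamma> \<turnstile> J M (Lam A d) a a (Refl a) \<doteq> subst (a #. Var) d \<^bold>: subst
        (Refl a #. a #. a #. Var) C"
proof -
  have g: "\<turnstile> \<Gamma> ctx" by (rule ctx_of_type[OF A])
  have U: "Idt (wk 2 A) (Var 1) (Var 0) # wk 1 A # A # \<Gamma> \<turnstile> Univ j type"
    using C by (intro type_Univ) (rule ctx_of_type)
  have M: "\<Gamma> \<turnstile> M \<^bold>: Pi A (Pi (wk 1 A) (Idt (wk 2 A) (Var 1) (Var 0) \<rightarrow> Univ j))"
    unfolding M_def Arrow_def using C by (auto intro!: Lam_type)
  \<comment> \<open>Stated for all \<open>\<sigma>\<close> because it is used twice: with a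
    weakening, for the type of the branch, and with the identity, for the type of the
    result.\<close>
  have beta: "\<Delta> \<turnstile> subst \<sigma> M \<cdot> a \<cdot> b \<cdot> p \<doteq> subst (p #. b #. a #. \<sigma>) C type"
    if "subst_map \<Delta> \<sigma> \<Gamma>" "\<Delta> \<turnstile> a \<^bold>: subst \<sigma> A" "\<Delta> \<turnstile> b \<^bold>: subst \<sigma> A" "\<Delta> \<turnstile> p \<^bold>: Idt (subst \<sigma> A) a b"
    for \<Delta> \<sigma> a b p
    using beta3_subst[OF C U that(1,2)] that(3,4) unfolding M_def by (auto intro: eq_typeI)
  have A': "\<Gamma> \<turnstile> A type" by (rule typeI[OF A])
  have "A # \<Gamma> \<turnstile> subst (shift (Suc 0)) M \<cdot> Var 0 \<cdot> Var 0 \<cdot> Refl (Var 0) \<doteq> subst (Refl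
      (Var 0) #. Var 0 #. Var 0 #. shift (Suc 0)) C type"
    using var0[OF A'] wk_type[OF A A']
    by (intro beta subst_map_shift1 ctx_consI Id_intro) (auto intro: A')
  then have "\<Gamma> \<turnstile> Pi A (subst (Refl (Var 0) #. Var 0 #. Var) C) \<doteq> Pi A (wk 1 M \<cdot> Var 0 \<cdot> Var 0 \<cdot> Refl
      (Var 0)) type"
    by (intro eq_type_Pi eq_type_refl A') (auto intro: eq_type_sym)
  from conv_type[OF this Lam_type[OF d]]
  have d': "\<Gamma> \<turnstile> Lam A d \<^bold>: Pi A (wk 1 M \<cdot> Var 0 \<cdot> Var 0 \<cdot> Refl (Var 0))" .
  note beta0 = beta[OF subst_map_Var[OF g], unfolded subst_Var]
  show "\<Gamma> \<turnstile> J M (Lam A d) a b p \<^bold>: subst (p #. b #. a #. Var) C"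
    if "\<Gamma> \<turnstile> b \<^bold>: A" "\<Gamma> \<turnstile> p \<^bold>: Idt A a b"
    using conv_type[OF beta0 Id_elim[OF A M d' a that]] a that by simp
  have "\<Gamma> \<turnstile> J M (Lam A d) a a (Refl a) \<doteq> Lam A d \<cdot> a \<^bold>: subst (Refl a #. a #. a #. Var) C"
    using eq_conv_type[OF beta0 Id_comp[OF A M d' a]] a Id_intro[OF A a] by simp
  then show "\<Gamma> \<turnstile> J M (Lam A d) a a (Refl a) \<doteq> subst (a #. Var) d \<^bold>: subst
      (Refl a #. a #. a #. Var) C"
    using beta1[OF d a] by (auto intro: eq_trans)
qed

lemma Coprod_rules:
  assumes P: "\<Gamma> \<turnstile> P \<^bold>: Univ i" and Q: "\<Gamma> \<turnstile> Q \<^bold>: Univ i"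
    and C: "Coprod P Q # \<Gamma> \<turnstile> C \<^bold>: Univ j"
    and l: "P # \<Gamma> \<turnstile> l \<^bold>: subst (InL (Var 0) #. shift 1) C"
    and r: "Q # \<Gamma> \<turnstile> r \<^bold>: subst (InR (Var 0) #. shift 1) C"
  defines "M \<equiv> CoprodElim (Lam (Coprod P Q) C) (Lam P l) (Lam Q r)"
  shows CoprodElim_type: "\<Gamma> \<turnstile> z \<^bold>: Coprod P Q \<Longrightarrow> \<Gamma> \<turnstile> M z \<^bold>: subst (z #. Var) C"
    and CoprodElim_InL: "\<Gamma> \<turnstile> a \<^bold>: P \<Longrightarrow> \<Gamma> \<turnstile> M (InL a) \<doteq> subst (a #. Var) l \<^bold>: subst (InL a #. Var) C"
proof -
  have P': "\<Gamma> \<turnstile> P type" and Q': "\<Gamma> \<turnstile> Q type" using P Q by (auto intro: typeI)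
  have g: "\<turnstile> \<Gamma> ctx" by (rule ctx_of_type[OF P])
  let ?C = "Lam (Coprod P Q) C"
  have M: "\<Gamma> \<turnstile> ?C \<^bold>: Coprod P Q \<rightarrow> Univ j"
    unfolding Arrow_def using C by (auto intro!: Lam_type)
  have beta: "\<Delta> \<turnstile> subst \<sigma> ?C \<cdot> z \<doteq> subst (z #. \<sigma>) C type"
    if "subst_map \<Delta> \<sigma> \<Gamma>" "\<Delta> \<turnstile> z \<^bold>: Coprod (subst \<sigma> P) (subst \<sigma> Q)" for \<Delta> \<sigma> z
    using beta1_subst[OF C that(1)] that(2) by (auto intro: eq_typeI)
  note beta0 = beta[OF subst_map_Var[OF g], unfolded subst_Var]
  have wk: "X # \<Gamma> \<turnstile> subst (shift (Suc 0)) Y \<^bold>: Univ i" if "\<Gamma> \<turnstile> X type" "\<Gamma> \<turnstile> Y \<^bold>: Univ i" for X Y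
    using wk_type[OF that(2,1)] by simp
  have "P # \<Gamma> \<turnstile> wk 1 ?C \<cdot> InL (Var 0) \<doteq> subst (InL (Var 0) #. shift 1) C type"
    using beta[OF subst_map_shift1[OF ctx_consI[OF P']] Coprod_inl[OF wk[OF P' P] wk[OF P' Q]
        var0[OF P']]] by simp
  then have l': "\<Gamma> \<turnstile> Lam P l \<^bold>: Pi P (wk 1 ?C \<cdot> InL (Var 0))"
    using l P' by (intro conv_type[OF _ Lam_type[OF l]] eq_type_Pi eq_type_refl) (auto intro:
        eq_type_sym)
  have "Q # \<Gamma> \<turnstile> wk 1 ?C \<cdot> InR (Var 0) \<doteq> subst (InR (Var 0) #. shift 1) C type"
    using beta[OF subst_map_shift1[OF ctx_consI[OF Q']] Coprod_inr[OF wk[OF Q' P] wk[OF Q' Q]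
        var0[OF Q']]] by simp
  then have r': "\<Gamma> \<turnstile> Lam Q r \<^bold>: Pi Q (wk 1 ?C \<cdot> InR (Var 0))"
    using r Q' by (intro conv_type[OF _ Lam_type[OF r]] eq_type_Pi eq_type_refl) (auto intro:
        eq_type_sym)
  show "\<Gamma> \<turnstile> M z \<^bold>: subst (z #. Var) C" if "\<Gamma> \<turnstile> z \<^bold>: Coprod P Q"
    using conv_type[OF beta0 Coprod_elim[OF P Q M l' r' that]] that unfolding M_def by simp
  show "\<Gamma> \<turnstile> M (InL a) \<doteq> subst (a #. Var) l \<^bold>: subst (InL a #. Var) C" if "\<Gamma> \<turnstile> a \<^bold>: P"
    using eq_trans[OF eq_conv_type[OF beta0 Coprod_comp_inl[OF P Q M l' r' that], simplified]]
      beta1[OF l that] Coprod_inl[OF P Q that] unfolding M_def by simp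
qed

section \<open>Signatures of indexed W-types and elimination of trees\<close>

abbreviation IW_family :: "tm \<Rightarrow> tm \<Rightarrow> tm \<Rightarrow> tm \<Rightarrow> tm \<Rightarrow> tm" where
  "IW_family A I B t s \<equiv> IW (wk 1 A) (wk 1 I) (wk 1 B) (wk 1 t) (wk 1 s) (Var 0)"

abbreviation subtrees_family :: "tm \<Rightarrow> tm \<Rightarrow> tm \<Rightarrow> tm \<Rightarrow> tm \<Rightarrow> tm" where
  "subtrees_family A I B t s \<equiv> subtrees (wk 1 A) (wk 1 I) (wk 1 B) (wk 1 t) (wk 1 s) (Var 0)"

text \<open>The premises common to the formation, introduction and elimination rules, bundled so
  that they are weakened and substituted together.\<close>

definition IW_sig :: "nat \<Rightarrow> tm list \<Rightarrow> tm \<Rightarrow> tm \<Rightarrow> tm \<Rightarrow> tm \<Rightarrow> tm \<Rightarrow> bool" where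
  "IW_sig n \<Gamma> A I B t s \<longleftrightarrow> \<Gamma> \<turnstile> A \<^bold>: Univ n \<and> \<Gamma> \<turnstile> I \<^bold>: Univ n \<and> \<Gamma> \<turnstile> B \<^bold>: A \<rightarrow> Univ n \<and>
     \<Gamma> \<turnstile> t \<^bold>: A \<rightarrow> I \<and> \<Gamma> \<turnstile> s \<^bold>: Sig A B \<rightarrow> I"

lemma IW_sig_subst:
  assumes m: "subst_map \<Delta> \<sigma> \<Gamma>" and w: "IW_sig n \<Gamma> A I B t s"
  shows "IW_sig n \<Delta> (subst \<sigma> A) (subst \<sigma> I) (subst \<sigma> B) (subst \<sigma> t) (subst \<sigma> s)"
  using w subst_map_type[OF m, of A "Univ n"] subst_map_type[OF m, of I
      "Univ n"] subst_map_type[OF m, of B "A \<rightarrow> Univ n"]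
    subst_map_type[OF m, of t "A \<rightarrow> I"] subst_map_type[OF m, of s "Sig A B \<rightarrow> I"]
  unfolding IW_sig_def by simp

lemma Arrow_App: "\<Gamma> \<turnstile> f \<^bold>: A \<rightarrow> B \<Longrightarrow> \<Gamma> \<turnstile> a \<^bold>: A \<Longrightarrow> \<Gamma> \<turnstile> f \<cdot> a \<^bold>: B"
  unfolding Arrow_def using App_type by fastforce

context
  fixes n \<Gamma> A I B t s
  assumes w: "IW_sig n \<Gamma> A I B t s"
begin

lemma IW_sig_ctx: "\<turnstile> \<Gamma> ctx"
  using w by (auto simp: IW_sig_def intro: ctx_of_type)

lemma IW_sig_A: "\<Gamma> \<turnstile> A \<^bold>: Univ n" and IW_sig_I: "\<Gamma> \<turnstile> I \<^bold>: Univ n"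
  using w by (auto simp: IW_sig_def)

lemma IW_sig_B: "\<Gamma> \<turnstile> a \<^bold>: A \<Longrightarrow> \<Gamma> \<turnstile> B \<cdot> a \<^bold>: Univ n"
  using w Arrow_App by (force simp: IW_sig_def)

lemma IW_sig_t: "\<Gamma> \<turnstile> a \<^bold>: A \<Longrightarrow> \<Gamma> \<turnstile> t \<cdot> a \<^bold>: I"
  using w Arrow_App by (force simp: IW_sig_def)

lemma IW_sig_s: "\<Gamma> \<turnstile> a \<^bold>: A \<Longrightarrow> \<Gamma> \<turnstile> b \<^bold>: B \<cdot> a \<Longrightarrow> \<Gamma> \<turnstile> s \<cdot> Tup a b \<^bold>: I"
  using w Arrow_App Sig_intro by (auto simp: IW_sig_def)

lemma IW_sig_IW: "\<Gamma> \<turnstile> k \<^bold>: I \<Longrightarrow> \<Gamma> \<turnstile> IW A I B t s k \<^bold>: Univ n"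
  using w IW_form by (auto simp: IW_sig_def)

lemma IW_sig_Sup: "\<Gamma> \<turnstile> a \<^bold>: A \<Longrightarrow> \<Gamma> \<turnstile> f \<^bold>: subtrees A I B t s a \<Longrightarrow> \<Gamma> \<turnstile> Sup a f \<^bold>: IW A I B t s (t \<cdot> a)"
  using w IW_intro by (auto simp: IW_sig_def)

lemma IW_sig_app: "\<Gamma> \<turnstile> f \<^bold>: subtrees A I B t s a \<Longrightarrow> \<Gamma> \<turnstile> b \<^bold>: B \<cdot> a \<Longrightarrow> \<Gamma>
    \<turnstile> f \<cdot> b \<^bold>: IW A I B t s (s \<cdot> Tup a b)"
  unfolding subtrees_def by (drule (1) App_type) simp

end

lemma IW_sig_wk:
  assumes "IW_sig n \<Gamma> A I B t s" and X: "\<Gamma> \<turnstile> X type"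
  shows "IW_sig n (X # \<Gamma>) (wk 1 A) (wk 1 I) (wk 1 B) (wk 1 t) (wk 1 s)"
  using IW_sig_subst[OF subst_map_shift1[OF ctx_consI[OF X]]] assms(1) by simp

lemma IW_sig_subtrees:
  assumes w: "IW_sig n \<Gamma> A I B t s" and a: "\<Gamma> \<turnstile> a \<^bold>: A"
  shows "\<Gamma> \<turnstile> subtrees A I B t s a \<^bold>: Univ n"
proof -
  have X: "\<Gamma> \<turnstile> B \<cdot> a type" by (rule typeI[OF IW_sig_B[OF w a]])
  show ?thesis
    unfolding subtrees_def
    using IW_sig_IW[OF IW_sig_wk[OF w X] IW_sig_s[OF IW_sig_wk[OF w X]]] wk_type[OF a X] var0[OF X]
    by (intro Pi_form IW_sig_B[OF w a]) simp
qed

text \<open>\<open>H\<close> is the type of the induction hypotheses. Typing is proved along an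
  arbitrary context morphism because the eliminator also occurs under binders: in the recursive
  calls of the computation rule and in functions defined by recursion. The term \<open>r\<close>
  stands for the recursive results; where \<open>h\<close> ignores its innermost variable, nothing
  more about \<open>r\<close> has to be known.\<close>

lemma IW_rules:
  assumes w: "IW_sig n \<Gamma> A I B t s"
    and C: "IW_family A I B t s # I # \<Gamma> \<turnstile> C \<^bold>: Univ j"
  defines "H \<equiv> Pi (wk 2 B \<cdot> Var 1) (subst (Var 1 \<cdot> Var 0 #. wk 3 s \<cdot> Tup (Var 2)
      (Var 0) #. shift 3) C)"
  assumes h: "H # subtrees_family A I B t s # A # \<Gamma> \<turnstile> h
      \<^bold>: subst (Sup (Var 2) (Var 1) #. wk 3 t \<cdot> Var 2 #. shift 3) C"
  defines "M \<equiv> Lam I (Lam (IW_family A I B t s) C)"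
    and "N \<equiv> Lam A (Lam (subtrees_family A I B t s) (Lam H h))"
  shows IWElim_type: "subst_map \<Delta> \<sigma> \<Gamma> \<Longrightarrow> \<Delta> \<turnstile> k \<^bold>: subst \<sigma> I \<Longrightarrow>
      \<Delta> \<turnstile> u \<^bold>: IW (subst \<sigma> A) (subst \<sigma> I) (subst \<sigma> B) (subst \<sigma> t) (subst \<sigma> s) k \<Longrightarrow>
      \<Delta> \<turnstile> IWElim (subst \<sigma> M) (subst \<sigma> N) k u \<^bold>: subst (u #. k #. \<sigma>) C"
    and IWElim_Sup: "\<Gamma> \<turnstile> a \<^bold>: A \<Longrightarrow> \<Gamma> \<turnstile> f \<^bold>: subtrees A I B t s a \<Longrightarrow>
      \<exists>r. \<Gamma> \<turnstile> IWElim M N (t \<cdot> a) (Sup a f) \<doteq> subst (r #. f #. a #. Var) h \<^bold>: subst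
          (Sup a f #. t \<cdot> a #. Var) C"
proof -
  let ?S = "subtrees_family A I B t s"
  let ?W = "IW_family A I B t s"
  let ?C = "Lam I (Lam ?W C)"
  let ?h = "Lam A (Lam ?S (Lam H h))"
  note g = IW_sig_ctx[OF w]
  have rules: "\<Gamma> \<turnstile> A \<^bold>: Univ n" "\<Gamma> \<turnstile> I \<^bold>: Univ n" "\<Gamma> \<turnstile> B \<^bold>: A \<rightarrow> Univ n" "\<Gamma> \<turnstile> t \<^bold>: A \<rightarrow> I"
      "\<Gamma> \<turnstile> s \<^bold>: Sig A B \<rightarrow> I"
    using w by (auto simp: IW_sig_def)
  have At: "\<Gamma> \<turnstile> A type" by (rule typeI[OF rules(1)])
  have CT: "\<Gamma> \<turnstile> ?C \<^bold>: Pi I (?W \<rightarrow> Univ j)"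
    unfolding Arrow_def using C by (auto intro!: Lam_type)
  have U: "?W # I # \<Gamma> \<turnstile> Univ j type"
    using C by (intro type_Univ) (rule ctx_of_type)
  have beta: "\<Delta> \<turnstile> subst \<sigma> ?C \<cdot> k \<cdot> u \<doteq> subst (u #. k #. \<sigma>) C type"
    if "subst_map \<Delta> \<sigma> \<Gamma>" "\<Delta> \<turnstile> k \<^bold>: subst \<sigma> I"
      "\<Delta> \<turnstile> u \<^bold>: IW (subst \<sigma> A) (subst \<sigma> I) (subst \<sigma> B) (subst \<sigma> t) (subst \<sigma> s) k" for \<Delta> \<sigma> k u
    using beta2_subst[OF C U that(1,2)] that(3) by (auto intro: eq_typeI)
  note beta0 = beta[OF subst_map_Var[OF g], unfolded subst_Var]
  note w1 = IW_sig_wk[OF w At]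
  have v1: "A # \<Gamma> \<turnstile> Var 0 \<^bold>: wk 1 A" using var0[OF At] by simp
  have St: "A # \<Gamma> \<turnstile> ?S type" by (rule typeI[OF IW_sig_subtrees[OF w1 v1]])
  note w2 = IW_sig_wk[OF w1 St]
  have v21: "?S # A # \<Gamma> \<turnstile> Var 1 \<^bold>: wk 2 A" using wk_type[OF v1 St] by simp
  have v20: "?S # A # \<Gamma> \<turnstile> Var 0 \<^bold>: subtrees (wk 2 A) (wk 2 I) (wk 2 B) (wk 2 t) (wk 2 s) (Var 1)"
    using var0[OF St] by simp
  have Bt: "?S # A # \<Gamma> \<turnstile> wk 2 B \<cdot> Var 1 type"
    using typeI[OF IW_sig_B[OF w2]] v21 by simp
  note w3 = IW_sig_wk[OF w2 Bt]
  have v32: "wk 2 B \<cdot> Var 1 # ?S # A # \<Gamma> \<turnstile> Var 2 \<^bold>: wk 3 A" using wk_type[OF v21 Bt] by simp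
  have v31: "wk 2 B \<cdot> Var 1 # ?S # A # \<Gamma> \<turnstile> Var 1 \<^bold>: subtrees (wk 3 A) (wk 3 I) (wk 3 B) (wk 3 t)
      (wk 3 s) (Var 2)"
    using wk_type[OF v20 Bt] by simp
  have v30: "wk 2 B \<cdot> Var 1 # ?S # A # \<Gamma> \<turnstile> Var 0 \<^bold>: wk 3 B \<cdot> Var 2" using var0[OF Bt] by simp
  have m3: "subst_map (X # ?S # A # \<Gamma>) (shift 3) \<Gamma>" if "?S # A # \<Gamma> \<turnstile> X type" for X
    using subst_map_shift[of "[X, ?S, A]" \<Gamma>] ctx_consI[OF that] by simp
  \<comment> \<open>\<open>HB\<close> and \<open>TB\<close> contract the beta redexes in the
    hypothesis and in the conclusion of \<open>IW_step\<close>, so that a branch over the open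
    motive gets the type that \<open>IW_elim\<close> asks for.\<close>
  have HB: "wk 2 B \<cdot> Var 1 # ?S # A # \<Gamma> \<turnstile> wk 3 ?C \<cdot> (wk 3 s \<cdot> Tup (Var 2) (Var 0)) \<cdot>
      (Var 1 \<cdot> Var 0) \<doteq>
     subst (Var 1 \<cdot> Var 0 #. wk 3 s \<cdot> Tup (Var 2) (Var 0) #. shift 3) C type"
    using beta[OF m3[OF Bt]] IW_sig_s[OF w3] IW_sig_app[OF w3] v32 v31 v30 by simp
  have Ht: "?S # A # \<Gamma> \<turnstile> H type" by (rule ctx_head[OF h])
  note w3' = IW_sig_wk[OF w2 Ht]
  have u2: "H # ?S # A # \<Gamma> \<turnstile> Var 2 \<^bold>: wk 3 A" using wk_type[OF v21 Ht] by simp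
  have u1: "H # ?S # A # \<Gamma> \<turnstile> Var 1 \<^bold>: subtrees (wk 3 A) (wk 3 I) (wk 3 B) (wk 3 t) (wk 3 s) (Var 2)"
    using wk_type[OF v20 Ht] by simp
  have TB: "H # ?S # A # \<Gamma> \<turnstile> wk 3 ?C \<cdot> (wk 3 t \<cdot> Var 2) \<cdot> Sup (Var 2) (Var 1) \<doteq>
     subst (Sup (Var 2) (Var 1) #. wk 3 t \<cdot> Var 2 #. shift 3) C type"
    using beta[OF m3[OF Ht]] IW_sig_t[OF w3'] IW_sig_Sup[OF w3'] u2 u1 by simp
  have "\<Gamma> \<turnstile> Pi A (Pi ?S (Pi H (subst (Sup (Var 2) (Var 1) #. wk 3 t \<cdot> Var 2 #. shift 3) C))) \<doteq>
     Pi A (Pi ?S (Pi (Pi (wk 2 B \<cdot> Var 1) (wk 3 ?C \<cdot> (wk 3 s \<cdot> Tup (Var 2) (Var 0)) \<cdot>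
         (Var 1 \<cdot> Var 0)))
        (wk 3 ?C \<cdot> (wk 3 t \<cdot> Var 2) \<cdot> Sup (Var 2) (Var 1)))) type"
    unfolding H_def
    by (intro eq_type_Pi eq_type_refl At St Bt eq_type_sym[OF HB]
        eq_type_sym[OF TB[unfolded H_def]])
  from conv_type[OF this Lam_type[OF Lam_type[OF Lam_type[OF h]]]]
  have hT: "\<Gamma> \<turnstile> ?h \<^bold>: IW_step A I B t s ?C"
    by (simp add: IW_step_def Arrow_def)
  have W: "\<Delta> \<turnstile> IWElim (subst \<sigma> ?C) (subst \<sigma> ?h) k u \<^bold>: subst (u #. k #. \<sigma>) C"
    if m: "subst_map \<Delta> \<sigma> \<Gamma>" and k: "\<Delta> \<turnstile> k \<^bold>: subst \<sigma> I"
      and u: "\<Delta> \<turnstile> u \<^bold>: IW (subst \<sigma> A) (subst \<sigma> I) (subst \<sigma> B) (subst \<sigma> t) (subst \<sigma> s) k" for \<Delta> \<sigma> k u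
  proof (rule conv_type[OF beta[OF m k u] IW_elim])
    show "\<Delta> \<turnstile> subst \<sigma> A \<^bold>: Univ n" "\<Delta> \<turnstile> subst \<sigma> I \<^bold>: Univ n" "\<Delta> \<turnstile> subst \<sigma> B \<^bold>: subst \<sigma> A \<rightarrow> Univ n"
      "\<Delta> \<turnstile> subst \<sigma> t \<^bold>: subst \<sigma> A \<rightarrow> subst \<sigma> I"
          "\<Delta> \<turnstile> subst \<sigma> s \<^bold>: Sig (subst \<sigma> A) (subst \<sigma> B) \<rightarrow> subst \<sigma> I"
      using IW_sig_subst[OF m w] by (auto simp: IW_sig_def)
    show "\<Delta> \<turnstile> subst \<sigma> ?C \<^bold>: Pi (subst \<sigma> I) (IW (wk 1 (subst \<sigma> A)) (wk 1 (subst \<sigma> I)) (wk 1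
        (subst \<sigma> B)) (wk 1 (subst \<sigma> t)) (wk 1 (subst \<sigma> s)) (Var 0) \<rightarrow> Univ j)"
      using subst_map_type[OF m CT] by simp
    show "\<Delta> \<turnstile> subst \<sigma> ?h \<^bold>: IW_step (subst \<sigma> A) (subst \<sigma> I) (subst \<sigma> B) (subst \<sigma> t) (subst \<sigma> s)
        (subst \<sigma> ?C)"
      using subst_map_type[OF m hT] by (simp add: IW_step_def)
  qed (use k u in auto)
  then show "subst_map \<Delta> \<sigma> \<Gamma> \<Longrightarrow> \<Delta> \<turnstile> k \<^bold>: subst \<sigma> I \<Longrightarrow>
      \<Delta> \<turnstile> u \<^bold>: IW (subst \<sigma> A) (subst \<sigma> I) (subst \<sigma> B) (subst \<sigma> t) (subst \<sigma> s) k \<Longrightarrow>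
      \<Delta> \<turnstile> IWElim (subst \<sigma> M) (subst \<sigma> N) k u \<^bold>: subst (u #. k #. \<sigma>) C"
    unfolding M_def N_def by blast
  show "\<exists>r. \<Gamma> \<turnstile> IWElim M N (t \<cdot> a) (Sup a f) \<doteq> subst (r #. f #. a #. Var) h \<^bold>: subst
      (Sup a f #. t \<cdot> a #. Var) C"
    if a: "\<Gamma> \<turnstile> a \<^bold>: A" and f: "\<Gamma> \<turnstile> f \<^bold>: subtrees A I B t s a"
  proof -
    \<comment> \<open>The witness is dictated by \<open>IW_comp\<close>: at each position, the
      eliminator applied to the subtree there.\<close>
    let ?r = "Lam (B \<cdot> a) (IWElim (wk 1 ?C) (wk 1 ?h) (wk 1 s \<cdot> Tup (wk 1 a) (Var 0))
        (wk 1 f \<cdot> Var 0))"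
    have Ba: "\<Gamma> \<turnstile> B \<cdot> a type" by (rule typeI[OF IW_sig_B[OF w a]])
    have ma: "subst_map \<Gamma> (f #. a #. Var) (?S # A # \<Gamma>)"
      using a f by (intro subst_map_scons subst_map_Var g At St) auto
    have k1: "B \<cdot> a # \<Gamma> \<turnstile> wk 1 s \<cdot> Tup (wk 1 a) (Var 0) \<^bold>: wk 1 I"
      and q1: "B \<cdot> a # \<Gamma> \<turnstile> wk 1 f \<cdot> Var 0 \<^bold>: IW (wk 1 A) (wk 1 I) (wk 1 B) (wk 1 t) (wk 1 s)
          (wk 1 s \<cdot> Tup (wk 1 a) (Var 0))"
      using IW_sig_s[OF IW_sig_wk[OF w Ba]] IW_sig_app[OF IW_sig_wk[OF w Ba]] wk_type[OF a Ba]
          wk_type[OF f Ba] var0[OF Ba]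
      by simp_all
    have "B \<cdot> a # \<Gamma> \<turnstile> IWElim (wk 1 ?C) (wk 1 ?h) (wk 1 s \<cdot> Tup (wk 1 a) (Var 0)) (wk 1 f \<cdot> Var 0)
       \<^bold>: subst (wk 1 f \<cdot> Var 0 #. wk 1 s \<cdot> Tup (wk 1 a) (Var 0) #. shift 1) C"
      using W[OF subst_map_shift1[OF ctx_consI[OF Ba]]] k1 q1 by simp
    from Lam_type[OF this] have r: "\<Gamma> \<turnstile> ?r \<^bold>: subst (f #. a #. Var) H"
      by (simp add: H_def)
    have mC: "subst_map (H # ?S # A # \<Gamma>) (Sup (Var 2) (Var 1) #. wk 3 t \<cdot> Var 2 #. shift 3)
        (?W # I # \<Gamma>)"
      using IW_sig_t[OF w3'] IW_sig_Sup[OF w3'] u2 u1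
      by (intro subst_map_scons m3[OF Ht] typeI[OF rules(2)] ctx_head[OF C]) simp_all
    have ht: "H # ?S # A # \<Gamma> \<turnstile> subst (Sup (Var 2) (Var 1) #. wk 3 t \<cdot> Var 2 #. shift 3) C type"
      using subst_map_type[OF mC C] by (auto intro: typeI)
    have "\<Gamma> \<turnstile> ?h \<cdot> a \<cdot> f \<cdot> ?r \<doteq> subst (?r #. f #. a #. Var) h \<^bold>: subst (Sup a f #. t \<cdot> a #. Var) C"
      using beta3[OF h ht a _ r] f by simp
    moreover have "\<Gamma> \<turnstile> IWElim M N (t \<cdot> a) (Sup a f) \<doteq> ?h \<cdot> a \<cdot> f \<cdot> ?r \<^bold>: subst
        (Sup a f #. t \<cdot> a #. Var) C"
      using eq_conv_type[OF beta0 IW_comp[OF rules CT hT a f]] IW_sig_t[OF w a] IW_sig_Sup[OF w a f]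
          unfolding M_def N_def by simp
    ultimately show ?thesis by (blast intro: eq_trans)
  qed
qed

section \<open>Natural deduction for inhabitation\<close>

lemma holdsI: "\<Gamma> \<turnstile> e \<^bold>: T \<Longrightarrow> \<Gamma> \<tturnstile> T"
  by (auto simp: holds_def)

lemma holds_wk: "\<Gamma> \<tturnstile> T \<Longrightarrow> \<Gamma> \<turnstile> X type \<Longrightarrow> X # \<Gamma> \<tturnstile> subst (shift (Suc 0)) T"
  by (rule subst_map_holds[OF subst_map_shift1[OF ctx_consI]])

lemma holds_Pi: "A # \<Gamma> \<tturnstile> B \<Longrightarrow> \<Gamma> \<tturnstile> Pi A B"
  unfolding holds_def by (blast intro: Lam_type)

lemma holds_Pi_D: "\<Gamma> \<tturnstile> Pi A B \<Longrightarrow> \<Gamma> \<turnstile> a \<^bold>: A \<Longrightarrow> \<Gamma> \<tturnstile> subst (a #. Var) B"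
  unfolding holds_def by (blast intro: App_type)

lemma holds_Pi_open:
  assumes "\<Gamma> \<tturnstile> Pi X T" "\<Gamma> \<turnstile> X type"
  shows "X # \<Gamma> \<tturnstile> T"
  using holds_Pi_D[OF holds_wk[OF assms, simplified] var0[OF assms(2)]] by simp

lemma holds_Arrow: "A # \<Gamma> \<tturnstile> subst (shift (Suc 0)) B \<Longrightarrow> \<Gamma> \<tturnstile> A \<rightarrow> B"
  unfolding Arrow_def by (rule holds_Pi) simp

lemma holds_mp: "\<Gamma> \<tturnstile> A \<rightarrow> B \<Longrightarrow> \<Gamma> \<tturnstile> A \<Longrightarrow> \<Gamma> \<tturnstile> B"
  unfolding holds_def by (blast intro: Arrow_App)

lemma holds_conv: "\<Gamma> \<turnstile> A \<doteq> B type \<Longrightarrow> \<Gamma> \<tturnstile> A \<Longrightarrow> \<Gamma> \<tturnstile> B"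
  unfolding holds_def by (blast intro: conv_type)

lemma wk_Univ: "\<Gamma> \<turnstile> A \<^bold>: Univ i \<Longrightarrow> \<Gamma> \<turnstile> X type \<Longrightarrow> X # \<Gamma> \<turnstile> subst (shift (Suc 0)) A \<^bold>: Univ i"
  using wk_type[of \<Gamma> A "Univ i"] by simp

lemma Arrow_form: "\<Gamma> \<turnstile> A \<^bold>: Univ i \<Longrightarrow> \<Gamma> \<turnstile> B \<^bold>: Univ i \<Longrightarrow> \<Gamma> \<turnstile> A \<rightarrow> B \<^bold>: Univ i"
  unfolding Arrow_def by (auto intro!: Pi_form wk_Univ typeI)

lemma holds_Id_refl: "\<Gamma> \<turnstile> A \<^bold>: Univ i \<Longrightarrow> \<Gamma> \<turnstile> a \<^bold>: A \<Longrightarrow> \<Gamma> \<tturnstile> Idt A a a"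
  by (rule holdsI[OF Id_intro])

lemma Id_cong:
  assumes A: "\<Gamma> \<turnstile> A \<^bold>: Univ i" and a: "\<Gamma> \<turnstile> a \<doteq> a' \<^bold>: A" and b: "\<Gamma> \<turnstile> b \<doteq> b' \<^bold>: A"
    and t: "\<Gamma> \<turnstile> b \<^bold>: A" "\<Gamma> \<turnstile> a' \<^bold>: A"
  shows "\<Gamma> \<turnstile> Idt A a b \<doteq> Idt A a' b' \<^bold>: Univ i"
proof -
  have A': "\<Gamma> \<turnstile> A type" by (rule typeI[OF A])
  have "A # \<Gamma> \<turnstile> Idt (wk 1 A) (Var 0) (wk 1 b) \<^bold>: Univ i"
      "A # \<Gamma> \<turnstile> Idt (wk 1 A) (wk 1 a') (Var 0) \<^bold>: Univ i"
    using wk_Univ[OF A A'] var0[OF A'] wk_type[OF t(1) A'] wk_type[OF t(2) A']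
    by (auto intro!: Id_form)
  from eq_inst[OF this(1) a] eq_inst[OF this(2) b] show ?thesis
    by (auto intro: eq_trans)
qed

lemmas Id_eq_type = Id_cong[THEN eq_typeI]

lemma holds_Id_conv:
  assumes A: "\<Gamma> \<turnstile> A \<^bold>: Univ i" and a: "\<Gamma> \<turnstile> a \<doteq> a' \<^bold>: A" and b: "\<Gamma> \<turnstile> b \<doteq> b' \<^bold>: A"
    and t: "\<Gamma> \<turnstile> b \<^bold>: A" "\<Gamma> \<turnstile> a' \<^bold>: A" and h: "\<Gamma> \<tturnstile> Idt A a b"
  shows "\<Gamma> \<tturnstile> Idt A a' b'"
  by (rule holds_conv[OF Id_eq_type[OF A a b t] h])

lemma holds_J:
  assumes C: "Idt (wk 2 A) (Var 1) (Var 0) # wk 1 A # A # \<Gamma> \<turnstile> C \<^bold>: Univ j"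
    and d: "A # \<Gamma> \<tturnstile> subst (Refl (Var 0) #. Var 0 #. Var) C"
    and "\<Gamma> \<turnstile> A \<^bold>: Univ i" "\<Gamma> \<turnstile> a \<^bold>: A" "\<Gamma> \<turnstile> b \<^bold>: A" "\<Gamma> \<turnstile> p \<^bold>: Idt A a b"
  shows "\<Gamma> \<tturnstile> subst (p #. b #. a #. Var) C"
  using J_type[OF _ C] assms unfolding holds_def by blast

section \<open>Transport\<close>

text \<open>The motive of \<open>J\<close> is the function type from \<open>P\<close> at the first
  endpoint to \<open>P\<close> at the second, because the type of \<open>u\<close> mentions an
  endpoint that \<open>J\<close> generalises. The branch is the identity, and \<open>u\<close> is
  supplied as an argument afterwards.\<close>

definition transport :: "tm \<Rightarrow> tm \<Rightarrow> tm \<Rightarrow> tm \<Rightarrow> tm \<Rightarrow> tm \<Rightarrow> tm" where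
  "transport A P a b p u =
     J (Lam A (Lam (wk 1 A) (Lam (Idt (wk 2 A) (Var 1) (Var 0))
         (subst (Var 2 #. shift 3) P \<rightarrow> subst (Var 1 #. shift 3) P))))
       (Lam A (Lam P (Var 0))) a b p \<cdot> u"

lemma subst_transport [simp]:
  "subst \<sigma> (transport A P a b p u) =
   transport (subst \<sigma> A) (subst (up \<sigma>) P) (subst \<sigma> a) (subst \<sigma> b) (subst \<sigma> p) (subst \<sigma> u)"
  by (simp add: transport_def)

text \<open>The context in which motives of \<open>J\<close> live: \<open>Var 2\<close> and
  \<open>Var 1\<close> are the endpoints and \<open>Var 0\<close> is the path.\<close>

lemma Id_ctx:
  assumes A: "\<Gamma> \<turnstile> A \<^bold>: Univ i"
  shows "A # \<Gamma> \<turnstile> wk 1 A type"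
    and "wk 1 A # A # \<Gamma> \<turnstile> Idt (wk 2 A) (Var 1) (Var 0) type"
    and "subst_map (Idt (wk 2 A) (Var 1) (Var 0) # wk 1 A # A # \<Gamma>) (shift 3) \<Gamma>"
    and "Idt (wk 2 A) (Var 1) (Var 0) # wk 1 A # A # \<Gamma> \<turnstile> Var 2 \<^bold>: wk 3 A"
    and "Idt (wk 2 A) (Var 1) (Var 0) # wk 1 A # A # \<Gamma> \<turnstile> Var 1 \<^bold>: wk 3 A"
    and "Idt (wk 2 A) (Var 1) (Var 0) # wk 1 A # A # \<Gamma> \<turnstile> Var 0 \<^bold>: Idt (wk 3 A) (Var 2) (Var 1)"
proof -
  have A0: "\<Gamma> \<turnstile> A type" by (rule typeI[OF A])
  have A1: "A # \<Gamma> \<turnstile> wk 1 A \<^bold>: Univ i" using wk_Univ[OF A A0] by simp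
  then show A1': "A # \<Gamma> \<turnstile> wk 1 A type" by (rule typeI)
  have A2: "wk 1 A # A # \<Gamma> \<turnstile> wk 2 A \<^bold>: Univ i" using wk_Univ[OF A1 A1'] by simp
  have "wk 1 A # A # \<Gamma> \<turnstile> Var 0 \<^bold>: wk 2 A" "wk 1 A # A # \<Gamma> \<turnstile> Var 1 \<^bold>: wk 2 A"
    using var0[OF A1'] wk_type[OF var0[OF A0] A1'] by simp_all
  then show I: "wk 1 A # A # \<Gamma> \<turnstile> Idt (wk 2 A) (Var 1) (Var 0) type"
    by (intro typeI[OF Id_form[OF A2]])
  note c = ctx_consI[OF I]
  show "subst_map (Idt (wk 2 A) (Var 1) (Var 0) # wk 1 A # A # \<Gamma>) (shift 3) \<Gamma>"
    using subst_map_shift[of "[Idt (wk 2 A) (Var 1) (Var 0), wk 1 A, A]"] c by simp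
  show "Idt (wk 2 A) (Var 1) (Var 0) # wk 1 A # A # \<Gamma> \<turnstile> Var 2 \<^bold>: wk 3 A"
    "Idt (wk 2 A) (Var 1) (Var 0) # wk 1 A # A # \<Gamma> \<turnstile> Var 1 \<^bold>: wk 3 A"
    "Idt (wk 2 A) (Var 1) (Var 0) # wk 1 A # A # \<Gamma> \<turnstile> Var 0 \<^bold>: Idt (wk 3 A) (Var 2) (Var 1)"
    using var[OF c, of 0] var[OF c, of 1] var[OF c, of 2] by simp_all
qed

lemma
  assumes A: "\<Gamma> \<turnstile> A \<^bold>: Univ i" and P: "A # \<Gamma> \<turnstile> P \<^bold>: Univ j"
    and a: "\<Gamma> \<turnstile> a \<^bold>: A" and u: "\<Gamma> \<turnstile> u \<^bold>: subst (a #. Var) P"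
  shows transport_type: "\<Gamma> \<turnstile> b \<^bold>: A \<Longrightarrow> \<Gamma> \<turnstile> p \<^bold>: Idt A a b \<Longrightarrow> \<Gamma>
      \<turnstile> transport A P a b p u \<^bold>: subst (b #. Var) P"
    and transport_Refl: "\<Gamma> \<turnstile> transport A P a a (Refl a) u \<doteq> u \<^bold>: subst (a #. Var) P"
proof -
  note I = Id_ctx[OF A]
  have A0: "\<Gamma> \<turnstile> A type" by (rule typeI[OF A])
  have P0: "A # \<Gamma> \<turnstile> P type" by (rule typeI[OF P])
  let ?C = "subst (Var 2 #. shift 3) P \<rightarrow> subst (Var 1 #. shift 3) P"
  have m: "subst_map (Idt (wk 2 A) (Var 1) (Var 0) # wk 1 A # A # \<Gamma>) (x #. shift 3) (A # \<Gamma>)"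
    if "Idt (wk 2 A) (Var 1) (Var 0) # wk 1 A # A # \<Gamma> \<turnstile> x \<^bold>: wk 3 A" for x
    using that by (intro subst_map_scons I A0) simp
  have C: "Idt (wk 2 A) (Var 1) (Var 0) # wk 1 A # A # \<Gamma> \<turnstile> ?C \<^bold>: Univ j"
    using subst_map_type[OF m[OF I(4)] P] subst_map_type[OF m[OF I(5)] P]
        by (intro Arrow_form) simp_all
  have d: "A # \<Gamma> \<turnstile> Lam P (Var 0) \<^bold>: subst (Refl (Var 0) #. Var 0 #. Var) ?C"
    using Lam_type[OF var0[OF P0]] by (simp add: Arrow_def)
  have aP: "\<Gamma> \<turnstile> subst (a #. Var) P type" by (rule is_type_inst[OF P0 a])
  show "\<Gamma> \<turnstile> transport A P a b p u \<^bold>: subst (b #. Var) P" if "\<Gamma> \<turnstile> b \<^bold>: A" "\<Gamma> \<turnstile> p \<^bold>: Idt A a b"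
    using Arrow_App[of \<Gamma> _ "subst (a #. Var) P"] J_type[OF A C d a that] u unfolding transport_def
        by simp
  have "\<Gamma> \<turnstile> transport A P a a (Refl a) u \<doteq> Lam (subst (a #. Var) P) (Var 0) \<cdot> u \<^bold>: subst
      (a #. Var) P"
    using App_eq[of \<Gamma> _ _ "subst (a #. Var) P" "wk 1 (subst (a #. Var) P)" u] J_eq[OF A C d a] u
      subst_map_is_type[OF subst_map_shift1[OF ctx_consI[OF aP]] aP]
    unfolding transport_def Arrow_def by simp
  moreover have "\<Gamma> \<turnstile> Lam (subst (a #. Var) P) (Var 0) \<cdot> u \<doteq> u \<^bold>: subst (a #. Var) P"
    using beta1[OF var0[OF aP] u] by simp
  ultimately show "\<Gamma> \<turnstile> transport A P a a (Refl a) u \<doteq> u \<^bold>: subst (a #. Var) P"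
    by (rule eq_trans)
qed

lemma holds_transport:
  assumes "A # \<Gamma> \<turnstile> P \<^bold>: Univ j" "\<Gamma> \<tturnstile> Idt A a b" "\<Gamma> \<tturnstile> subst (a #. Var) P"
    "\<Gamma> \<turnstile> A \<^bold>: Univ i" "\<Gamma> \<turnstile> a \<^bold>: A" "\<Gamma> \<turnstile> b \<^bold>: A"
  shows "\<Gamma> \<tturnstile> subst (b #. Var) P"
  using assms transport_type unfolding holds_def by blast

text \<open>Reflexivity at \<open>e(a)\<close> is transported in the family
  \<open>x \<mapsto> (e(a) = e(x))\<close>.\<close>

lemma holds_ap:
  assumes p: "\<Gamma> \<tturnstile> Idt A a b" and e: "A # \<Gamma> \<turnstile> e \<^bold>: wk 1 X" and X: "\<Gamma> \<turnstile> X \<^bold>: Univ j"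
    and A: "\<Gamma> \<turnstile> A \<^bold>: Univ i" and a: "\<Gamma> \<turnstile> a \<^bold>: A" and b: "\<Gamma> \<turnstile> b \<^bold>: A"
  shows "\<Gamma> \<tturnstile> Idt X (subst (a #. Var) e) (subst (b #. Var) e)"
proof -
  have A0: "\<Gamma> \<turnstile> A type" by (rule typeI[OF A])
  have ea: "\<Gamma> \<turnstile> subst (a #. Var) e \<^bold>: X" using type_inst[OF e a] by simp
  have "A # \<Gamma> \<turnstile> Idt (wk 1 X) (wk 1 (subst (a #. Var) e)) e \<^bold>: Univ j"
    using wk_Univ[OF X A0] wk_type[OF ea A0] e by (intro Id_form) simp_all
  from holds_transport[OF this p _ A a b] show ?thesis
    using holds_Id_refl[OF X ea] by simp
qed

lemma holds_Id_trans:
  assumes p: "\<Gamma> \<tturnstile> Idt A a b" and q: "\<Gamma> \<tturnstile> Idt A b c" and A: "\<Gamma> \<turnstile> A \<^bold>: Univ i"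
    and a: "\<Gamma> \<turnstile> a \<^bold>: A" and b: "\<Gamma> \<turnstile> b \<^bold>: A" and c: "\<Gamma> \<turnstile> c \<^bold>: A"
  shows "\<Gamma> \<tturnstile> Idt A a c"
proof -
  have A0: "\<Gamma> \<turnstile> A type" by (rule typeI[OF A])
  have "A # \<Gamma> \<turnstile> Idt (wk 1 A) (wk 1 a) (Var 0) \<^bold>: Univ i"
    using wk_Univ[OF A A0] wk_type[OF a A0] var0[OF A0] by (intro Id_form) simp_all
  from holds_transport[OF this q _ A b c] show ?thesis
    using p by simp
qed

lemma holds_funext:
  assumes "\<Gamma> \<tturnstile> Pi A (Idt B (wk 1 f \<cdot> Var 0) (wk 1 g \<cdot> Var 0))"
    "\<Gamma> \<turnstile> Pi A B \<^bold>: Univ i" "\<Gamma> \<turnstile> f \<^bold>: Pi A B" "\<Gamma> \<turnstile> g \<^bold>: Pi A B"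
  shows "\<Gamma> \<tturnstile> Idt (Pi A B) f g"
  using assms funext unfolding holds_def by blast

section \<open>Case analysis and decidable types\<close>

lemma holds_Coprod_dep:
  assumes "Coprod P Q # \<Gamma> \<turnstile> C \<^bold>: Univ j"
    "P # \<Gamma> \<tturnstile> subst (InL (Var 0) #. shift 1) C" "Q # \<Gamma> \<tturnstile> subst (InR (Var 0) #. shift 1) C"
    "\<Gamma> \<turnstile> P \<^bold>: Univ i" "\<Gamma> \<turnstile> Q \<^bold>: Univ i" "\<Gamma> \<turnstile> z \<^bold>: Coprod P Q"
  shows "\<Gamma> \<tturnstile> subst (z #. Var) C"
  using assms CoprodElim_type unfolding holds_def by blast

lemma holds_Empty: "\<Gamma> \<tturnstile> Empty \<Longrightarrow> \<Gamma> \<turnstile> C \<^bold>: Univ j \<Longrightarrow> \<Gamma> \<tturnstile> C"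
proof -
  assume "\<Gamma> \<tturnstile> Empty" and C: "\<Gamma> \<turnstile> C \<^bold>: Univ j"
  then obtain e where e: "\<Gamma> \<turnstile> e \<^bold>: Empty" by (auto simp: holds_def)
  have E: "\<Gamma> \<turnstile> Empty type" by (rule typeI[OF Empty_form[OF ctx_of_type[OF C]]])
  have C1: "Empty # \<Gamma> \<turnstile> subst (shift (Suc 0)) C \<^bold>: Univ j" by (rule wk_Univ[OF C E])
  have "\<Gamma> \<turnstile> Lam Empty (wk 1 C) \<^bold>: Empty \<rightarrow> Univ j"
    unfolding Arrow_def using Lam_type[OF C1] by simp
  from holdsI[OF Empty_elim[OF this e]] show "\<Gamma> \<tturnstile> C"
    using beta1[OF C1 e] by (auto dest!: eq_typeI holds_conv)
qed

lemma not_form: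
  assumes "\<Gamma> \<turnstile> X \<^bold>: Univ n"
  shows "\<Gamma> \<turnstile> X \<rightarrow> Empty \<^bold>: Univ n"
  using assms cumul_le[OF Empty_form[OF ctx_of_type[OF assms]]] by (intro Arrow_form) simp_all

lemma decidable_form: "\<Gamma> \<turnstile> X \<^bold>: Univ n \<Longrightarrow> \<Gamma> \<turnstile> decidable X \<^bold>: Univ n"
  unfolding decidable_def by (intro Coprod_form not_form)

lemma decidable_yes: "\<Gamma> \<turnstile> X \<^bold>: Univ n \<Longrightarrow> \<Gamma> \<tturnstile> X \<Longrightarrow> \<Gamma> \<tturnstile> decidable X"
  unfolding decidable_def holds_def by (blast intro: Coprod_inl not_form)

lemma decidable_no: "\<Gamma> \<turnstile> X \<^bold>: Univ n \<Longrightarrow> \<Gamma> \<tturnstile> X \<rightarrow> Empty \<Longrightarrow> \<Gamma> \<tturnstile> decidable X"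
  unfolding decidable_def holds_def by (blast intro: Coprod_inr not_form)

lemma decidable_cases:
  assumes d: "\<Gamma> \<tturnstile> decidable X" and X: "\<Gamma> \<turnstile> X \<^bold>: Univ n" and C: "\<Gamma> \<turnstile> C \<^bold>: Univ j"
    and yes: "X # \<Gamma> \<tturnstile> subst (shift (Suc 0)) C" and no: "(X \<rightarrow> Empty) # \<Gamma> \<tturnstile> subst (shift (Suc 0)) C"
  shows "\<Gamma> \<tturnstile> C"
proof -
  from d obtain z where z: "\<Gamma> \<turnstile> z \<^bold>: Coprod X (X \<rightarrow> Empty)" by (auto simp: decidable_def holds_def)
  have "Coprod X (X \<rightarrow> Empty) # \<Gamma> \<turnstile> subst (shift (Suc 0)) C \<^bold>: Univ j"
    by (rule wk_Univ[OF C typeI[OF Coprod_form[OF X not_form[OF X]]]])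
  from holds_Coprod_dep[OF this _ _ X not_form[OF X] z] show ?thesis
    using yes no by simp
qed

text \<open>The universe itself serves as the context entry: \<open>decidable (Var 0)\<close> is
  formed over a variable of type \<open>Univ n\<close>, for which the two equal types are then
  substituted.\<close>

lemma decidable_conv:
  assumes "\<Gamma> \<turnstile> X \<doteq> Y \<^bold>: Univ n" "\<Gamma> \<tturnstile> decidable X"
  shows "\<Gamma> \<tturnstile> decidable Y"
proof -
  have "Univ n # \<Gamma> \<turnstile> Var 0 \<^bold>: Univ n"
    using var0[OF type_Univ[OF ctx_of_eq[OF assms(1)]]] by simp
  then have "Univ n # \<Gamma> \<turnstile> decidable (Var 0) type" by (intro typeI decidable_form)
  from eq_inst_type[OF this assms(1)] show ?thesis
    using assms(2) by (auto dest: holds_conv)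
qed

text \<open>Compactness speaks of families given as functions. The open family \<open>P\<close> is
  passed as \<open>Lam X P\<close>, and the resulting redexes are contracted in the premise and in
  the conclusion.\<close>

lemma Pi_compact_D:
  assumes c: "\<Gamma> \<tturnstile> Pi_compact n X" and X: "\<Gamma> \<turnstile> X \<^bold>: Univ n" and P: "X # \<Gamma> \<turnstile> P \<^bold>: Univ n"
    and d: "X # \<Gamma> \<tturnstile> decidable P"
  shows "\<Gamma> \<tturnstile> decidable (Pi X P)"
proof -
  have X0: "\<Gamma> \<turnstile> X type" by (rule typeI[OF X])
  have "\<Gamma> \<turnstile> Lam X P \<^bold>: X \<rightarrow> Univ n"
    unfolding Arrow_def using Lam_type[OF P] by simp
  from holds_Pi_D[OF c[unfolded Pi_compact_def] this]
  have "\<Gamma> \<tturnstile> Pi X (decidable (wk 1 (Lam X P) \<cdot> Var 0)) \<rightarrow> decidable (Pi X (wk 1 (Lam X P) \<cdot> Var 0))"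
    by simp
  moreover have b: "X # \<Gamma> \<turnstile> wk 1 (Lam X P) \<cdot> Var 0 \<doteq> P \<^bold>: Univ n"
    using beta1_subst[OF P subst_map_shift1[OF ctx_consI[OF X0]] var0[OF X0]] by simp
  ultimately have "\<Gamma> \<tturnstile> decidable (Pi X (wk 1 (Lam X P) \<cdot> Var 0))"
    using decidable_conv[OF eq_sym d] by (blast intro: holds_mp holds_Pi)
  with Pi_cong[OF eq_refl[OF X] b] show ?thesis
    by (rule decidable_conv)
qed

lemma holds_imp_eq: "\<Gamma> \<turnstile> X \<doteq> Y type \<Longrightarrow> \<Gamma> \<turnstile> X type \<Longrightarrow> \<Gamma> \<tturnstile> X \<rightarrow> Y"
  by (rule holds_Arrow[OF holdsI])
     (rule conv_type[OF subst_map_eq_type[OF subst_map_shift1[OF ctx_consI]] var0])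

lemma holds_imp_trans:
  assumes "\<Gamma> \<tturnstile> X \<rightarrow> Y" "\<Gamma> \<tturnstile> Y \<rightarrow> Z" "\<Gamma> \<turnstile> X type"
  shows "\<Gamma> \<tturnstile> X \<rightarrow> Z"
  by (rule holds_Arrow[OF holds_mp[OF holds_wk[OF assms(2,3), simplified]
      holds_mp[OF holds_wk[OF assms(1,3), simplified] holdsI[OF var0[OF assms(3)]]]]])

lemma decidable_iff:
  assumes d: "\<Gamma> \<tturnstile> decidable X" and X: "\<Gamma> \<turnstile> X \<^bold>: Univ n" and Y: "\<Gamma> \<turnstile> Y \<^bold>: Univ n"
    and XY: "\<Gamma> \<tturnstile> X \<rightarrow> Y" and YX: "\<Gamma> \<tturnstile> Y \<rightarrow> X"
  shows "\<Gamma> \<tturnstile> decidable Y"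
proof (rule decidable_cases[OF d X decidable_form[OF Y]])
  note X0 = typeI[OF X] and N0 = typeI[OF not_form[OF X]]
  show "X # \<Gamma> \<tturnstile> subst (shift (Suc 0)) (decidable Y)"
    using decidable_yes[OF wk_Univ[OF Y X0] holds_mp[OF holds_wk[OF XY X0, simplified]
        holdsI[OF var0[OF X0]]]]
    by simp
  show "(X \<rightarrow> Empty) # \<Gamma> \<tturnstile> subst (shift (Suc 0)) (decidable Y)"
    using decidable_no[OF wk_Univ[OF Y N0] holds_imp_trans[OF holds_wk[OF YX N0, simplified]
        holdsI[OF var0[OF N0, simplified]] typeI[OF wk_Univ[OF Y N0]]]] by simp
qed

text \<open>The type of \<open>u\<close> depends on the endpoint, so the path induction treats all
  \<open>u\<close> at once, with motive
  \<open>\<Prod>u : P(x). Q(x, u) \<rightarrow> Q(y, p\<^sub>* u)\<close>. This is what makes the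
  shape map invariant under transport.\<close>

lemma transport_induct:
  assumes A: "\<Gamma> \<turnstile> A \<^bold>: Univ i" and P: "A # \<Gamma> \<turnstile> P \<^bold>: Univ j" and Q: "P # A # \<Gamma> \<turnstile> Q \<^bold>: Univ j"
    and a: "\<Gamma> \<turnstile> a \<^bold>: A" and b: "\<Gamma> \<turnstile> b \<^bold>: A" and p: "\<Gamma> \<turnstile> p \<^bold>: Idt A a b"
    and u: "\<Gamma> \<turnstile> u \<^bold>: subst (a #. Var) P" and h: "\<Gamma> \<tturnstile> subst (u #. a #. Var) Q"
  shows "\<Gamma> \<tturnstile> subst (transport A P a b p u #. b #. Var) Q"
proof -
  note I = Id_ctx[OF A]
  let ?\<Delta> = "Idt (wk 2 A) (Var 1) (Var 0) # wk 1 A # A # \<Gamma>"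
  have A0: "\<Gamma> \<turnstile> A type" by (rule typeI[OF A])
  have P0: "A # \<Gamma> \<turnstile> P type" by (rule typeI[OF P])
  let ?P = "subst (Var 2 #. shift 3) P"
  let ?tr = "transport (wk 4 A) (subst (Var 0 #. shift 5) P) (Var 3) (Var 2) (Var 1) (Var 0)"
  let ?Q1 = "subst (Var 0 #. Var 3 #. shift 4) Q"
  let ?Q2 = "subst (?tr #. Var 2 #. shift 4) Q"
  have P2: "?\<Delta> \<turnstile> ?P \<^bold>: Univ j"
    using subst_map_type[OF subst_map_scons[OF I(3) A0] P, of "Var 2"] I(4) by simp
  have P2': "?\<Delta> \<turnstile> ?P type" by (rule typeI[OF P2])
  have m: "subst_map (?P # ?\<Delta>) (shift 4) \<Gamma>"
    using subst_map_shift[of "[?P, Idt (wk 2 A) (Var 1) (Var 0), wk 1 A, A]"] ctx_consI[OF P2']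
        by simp
  have v: "?P # ?\<Delta> \<turnstile> Var 3 \<^bold>: wk 4 A" "?P # ?\<Delta> \<turnstile> Var 2 \<^bold>: wk 4 A"
    "?P # ?\<Delta> \<turnstile> Var 1 \<^bold>: Idt (wk 4 A) (Var 3) (Var 2)"
        "?P # ?\<Delta> \<turnstile> Var 0 \<^bold>: subst (Var 3 #. shift 4) P"
    using I(4-6)[THEN wk_type, OF P2'] var0[OF P2'] by simp_all
  have P4: "wk 4 A # ?P # ?\<Delta> \<turnstile> subst (Var 0 #. shift 5) P \<^bold>: Univ j"
    using subst_map_type[OF subst_map_up[OF m A0] P] by simp
  have tr: "?P # ?\<Delta> \<turnstile> ?tr \<^bold>: subst (Var 2 #. shift 4) P"
    using transport_type[OF subst_map_type[OF m A, simplified] P4[simplified], of "Var 3" "Var 0"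
        "Var 2" "Var 1"] v by simp
  have Q12: "?P # ?\<Delta> \<turnstile> ?Q1 \<^bold>: Univ j" "?P # ?\<Delta> \<turnstile> ?Q2 \<^bold>: Univ j"
    using subst_map_type[OF subst_map_scons[OF subst_map_scons[OF m A0] P0] Q, of "Var 3" "Var 0"]
      subst_map_type[OF subst_map_scons[OF subst_map_scons[OF m A0] P0] Q, of "Var 2"
          ?tr] v tr by simp_all
  have C: "?\<Delta> \<turnstile> Pi ?P (?Q1 \<rightarrow> ?Q2) \<^bold>: Univ j"
    by (intro Pi_form Arrow_form P2 Q12)
  let ?Qr = "subst (transport (wk 2 A) (subst (Var 0 #. shift 3) P) (Var 1) (Var 1) (Refl (Var 1))
      (Var 0) #. Var 1 #. shift 2) Q"
  note mPA = subst_map_shift[of "[P, A]" \<Gamma>, simplified, OF ctx_consI[OF P0]]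
  have w: "P # A # \<Gamma> \<turnstile> Var 1 \<^bold>: wk 2 A" "P # A # \<Gamma> \<turnstile> Var 0 \<^bold>: subst (Var 1 #. shift 2) P"
    using wk_type[OF var0[OF A0] P0] var0[OF P0] by simp_all
  \<comment> \<open>On \<open>Refl\<close> the transport of \<open>Var 0\<close> is judgementally
    \<open>Var 0\<close>. Hence both sides of the implication are the same type up to conversion,
    and the identity function proves it.\<close>
  have e: "P # A # \<Gamma> \<turnstile> transport (wk 2 A) (subst (Var 0 #. shift 3) P) (Var 1) (Var 1) (Refl
      (Var 1)) (Var 0) \<doteq> Var 0
      \<^bold>: subst (shift 1) P"
    using transport_Refl[OF subst_map_type[OF mPA A, simplified]
        subst_map_type[OF subst_map_up[OF mPA A0] P, simplified], of "Var 1" "Var 0"]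
      w by simp
  have "subst (shift (Suc 0)) P # P # A # \<Gamma> \<turnstile> subst (Var 0 #. shift 2) Q type"
    using subst_map_is_type[OF subst_map_up[OF subst_map_shift1[OF ctx_consI[OF P0]] P0]
        typeI[OF Q]] by simp
  from eq_inst_type[OF this e[THEN eq_sym, simplified]] have "P # A # \<Gamma> \<turnstile> Q \<doteq> ?Qr type"
    by simp
  from holds_imp_eq[OF this typeI[OF Q]] have
      "A # \<Gamma> \<tturnstile> subst (Refl (Var 0) #. Var 0 #. Var) (Pi ?P (?Q1 \<rightarrow> ?Q2))"
    by (simp add: holds_Pi)
  from holds_J[OF C this A a b p] have "\<Gamma> \<tturnstile> subst (p #. b #. a #. Var) (Pi ?P (?Q1 \<rightarrow> ?Q2))" .
  then have "\<Gamma> \<tturnstile> Pi (subst (a #. Var) P)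
    (subst (Var 0 #. wk 1 a #. shift 1) Q \<rightarrow>
       subst (transport (wk 1 A) (subst (Var 0 #. shift 2) P) (wk 1 a) (wk 1 b) (wk 1 p)
           (Var 0) #. wk 1 b #. shift 1) Q)"
    by simp
  from holds_Pi_D[OF this u] have "\<Gamma> \<tturnstile> subst (u #. a #. Var) Q \<rightarrow> subst
      (transport A P a b p u #. b #. Var) Q"
    by simp
  from holds_mp[OF this h] show ?thesis .
qed

text \<open>By path induction with \<open>u\<close> and \<open>v\<close> generalised, the path
  becomes \<open>Refl\<close> and both transports vanish judgementally. Since the endpoints were
  arbitrary, the result may afterwards be used for loops, on which path induction could not be
  started.\<close>

lemma transport_inj:
  assumes A: "\<Gamma> \<turnstile> A \<^bold>: Univ i" and P: "A # \<Gamma> \<turnstile> P \<^bold>: Univ j"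
    and a: "\<Gamma> \<turnstile> a \<^bold>: A" and b: "\<Gamma> \<turnstile> b \<^bold>: A" and p: "\<Gamma> \<turnstile> p \<^bold>: Idt A a b"
    and u: "\<Gamma> \<turnstile> u \<^bold>: subst (a #. Var) P" and v: "\<Gamma> \<turnstile> v \<^bold>: subst (a #. Var) P"
  shows "\<Gamma> \<tturnstile> Idt (subst (b #. Var) P) (transport A P a b p u) (transport A P a b p v) \<rightarrow> Idt (subst
      (a #. Var) P) u v"
proof -
  note I = Id_ctx[OF A]
  let ?\<Delta> = "Idt (wk 2 A) (Var 1) (Var 0) # wk 1 A # A # \<Gamma>"
  have A0: "\<Gamma> \<turnstile> A type" by (rule typeI[OF A])
  have P0: "A # \<Gamma> \<turnstile> P type" by (rule typeI[OF P])
  let ?P = "subst (Var 2 #. shift 3) P"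
  let ?P' = "wk 1 ?P"
  let ?tr = "transport (wk 5 A) (subst (Var 0 #. shift 6) P) (Var 4) (Var 3) (Var 2)"
  have P2: "?\<Delta> \<turnstile> ?P \<^bold>: Univ j"
    using subst_map_type[OF subst_map_scons[OF I(3) A0] P, of "Var 2"] I(4) by simp
  have P2': "?\<Delta> \<turnstile> ?P type" by (rule typeI[OF P2])
  have P3: "?P # ?\<Delta> \<turnstile> ?P' \<^bold>: Univ j" using wk_Univ[OF P2 P2'] by simp
  have P3': "?P # ?\<Delta> \<turnstile> ?P' type" by (rule typeI[OF P3])
  have m: "subst_map (?P' # ?P # ?\<Delta>) (shift 5) \<Gamma>"
    using subst_map_shift[of "[?P', ?P, Idt (wk 2 A) (Var 1) (Var 0), wk 1 A, A]"] ctx_consI[OF P3']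
        by simp
  have x: "?P' # ?P # ?\<Delta> \<turnstile> Var 4 \<^bold>: wk 5 A" "?P' # ?P # ?\<Delta> \<turnstile> Var 3 \<^bold>: wk 5 A"
    "?P' # ?P # ?\<Delta> \<turnstile> Var 2 \<^bold>: Idt (wk 5 A) (Var 4) (Var 3)"
    "?P' # ?P # ?\<Delta> \<turnstile> Var 1 \<^bold>: subst (Var 4 #. shift 5) P"
        "?P' # ?P # ?\<Delta> \<turnstile> Var 0 \<^bold>: subst (Var 4 #. shift 5) P"
    using I(4-6)[THEN wk_type, OF P2', THEN wk_type, OF P3'] wk_type[OF var0[OF P2'] P3']
        var0[OF P3'] by simp_all
  have P5: "wk 5 A # ?P' # ?P # ?\<Delta> \<turnstile> subst (Var 0 #. shift 6) P \<^bold>: Univ j"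
    using subst_map_type[OF subst_map_up[OF m A0] P] by simp
  have tr: "?P' # ?P # ?\<Delta> \<turnstile> ?tr w \<^bold>: subst (Var 3 #. shift 5) P" if
      "?P' # ?P # ?\<Delta> \<turnstile> w \<^bold>: subst (Var 4 #. shift 5) P" for w
    using transport_type[OF subst_map_type[OF m A, simplified] P5[simplified], of "Var 4" w "Var 3"
        "Var 2"] x that by simp
  have P45: "?P' # ?P # ?\<Delta> \<turnstile> subst (Var 4 #. shift 5) P \<^bold>: Univ j"
      "?P' # ?P # ?\<Delta> \<turnstile> subst (Var 3 #. shift 5) P \<^bold>: Univ j"
    using subst_map_type[OF subst_map_scons[OF m A0] P, of
        "Var 4"] subst_map_type[OF subst_map_scons[OF m A0] P, of "Var 3"] x by simp_all
  let ?C = "Pi ?P (Pi ?P' (Idt (subst (Var 3 #. shift 5) P) (?tr (Var 1)) (?tr (Var 0)) \<rightarrow>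
     Idt (subst (Var 4 #. shift 5) P) (Var 1) (Var 0)))"
  have C: "?\<Delta> \<turnstile> ?C \<^bold>: Univ j"
    by (intro Pi_form Arrow_form Id_form P2 P3 P45 tr x)
  have P1: "P # A # \<Gamma> \<turnstile> wk 1 P \<^bold>: Univ j" using wk_Univ[OF P P0] by simp
  have P1': "P # A # \<Gamma> \<turnstile> wk 1 P type" by (rule typeI[OF P1])
  let ?\<Theta> = "wk 1 P # P # A # \<Gamma>"
  have mr: "subst_map ?\<Theta> (shift 3) \<Gamma>"
    using subst_map_shift[of "[wk 1 P, P, A]"] ctx_consI[OF P1'] by simp
  have y: "?\<Theta> \<turnstile> Var 2 \<^bold>: wk 3 A" "?\<Theta> \<turnstile> Var 1 \<^bold>: wk 2 P" "?\<Theta> \<turnstile> Var 0 \<^bold>: wk 2 P"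
    using wk_type[OF wk_type[OF var0[OF A0] P0] P1'] wk_type[OF var0[OF P0] P1'] var0[OF P1']
        by simp_all
  have P3r: "?\<Theta> \<turnstile> wk 2 P \<^bold>: Univ j" using wk_Univ[OF P1 P1'] by simp
  let ?trr = "transport (wk 3 A) (subst (Var 0 #. shift 4) P) (Var 2) (Var 2) (Refl (Var 2))"
  have e: "?\<Theta> \<turnstile> ?trr w \<doteq> w \<^bold>: wk 2 P" "?\<Theta> \<turnstile> ?trr w \<^bold>: wk 2 P" if "?\<Theta> \<turnstile> w \<^bold>: wk 2 P" for w
    using transport_Refl[OF subst_map_type[OF mr A, simplified]
        subst_map_type[OF subst_map_up[OF mr A0] P, simplified], of "Var 2" w]
      transport_type[OF subst_map_type[OF mr A, simplified] subst_map_type[OF subst_map_up[OF mr A0]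
          P, simplified], of "Var 2" w "Var 2" "Refl (Var 2)"]
      that y Id_intro[OF subst_map_type[OF mr A, simplified]] by simp_all
  have "?\<Theta> \<turnstile> Idt (wk 2 P) (?trr (Var 1)) (?trr (Var 0)) \<doteq> Idt (wk 2 P) (Var 1) (Var 0) type"
    by (intro Id_eq_type[OF P3r] e y)
  from holds_imp_eq[OF this typeI[OF Id_form[OF P3r]]]
  have "?\<Theta> \<tturnstile> Idt (wk 2 P) (?trr (Var 1)) (?trr (Var 0)) \<rightarrow> Idt (wk 2 P) (Var 1) (Var 0)"
    using e(2) y by blast
  then have "A # \<Gamma> \<tturnstile> Pi P (Pi (wk 1 P) (Idt (wk 2 P) (?trr (Var 1)) (?trr (Var 0)) \<rightarrow> Idt (wk 2 P)
      (Var 1) (Var 0)))"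
    by (intro holds_Pi)
  then have "A # \<Gamma> \<tturnstile> subst (Refl (Var 0) #. Var 0 #. Var) ?C"
    by simp
  from holds_J[OF C this A a b p] have "\<Gamma> \<tturnstile> subst (p #. b #. a #. Var) ?C" .
  note r = holds_Pi_D[OF this[simplified], of u, simplified, OF u]
  show ?thesis using holds_Pi_D[OF r, of v] v by simp
qed

section \<open>Shapes and injectivity of the constructor\<close>

text \<open>A constant motive and a branch that ignores the recursive results give definition by
  cases on trees, with a judgemental computation rule. The two uses are the shape of a tree and, for
  a fixed \<open>a\<close>, its function of subtrees cast to \<open>a\<close>.\<close>

lemma IW_rec:
  assumes w: "IW_sig n \<Gamma> A I B t s" and X: "\<Gamma> \<turnstile> X \<^bold>: Univ j"
    and e: "subtrees_family A I B t s # A # \<Gamma> \<turnstile> e \<^bold>: wk 2 X"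
  shows "\<exists>F. \<Gamma> \<turnstile> F \<^bold>: Pi I (IW_family A I B t s \<rightarrow> wk 1 X) \<and>
    (\<forall>a f. \<Gamma> \<turnstile> a \<^bold>: A \<longrightarrow> \<Gamma> \<turnstile> f \<^bold>: subtrees A I B t s a \<longrightarrow>
       \<Gamma> \<turnstile> F \<cdot> (t \<cdot> a) \<cdot> Sup a f \<doteq> subst (f #. a #. Var) e \<^bold>: X)"
proof -
  let ?S = "subtrees_family A I B t s"
  let ?W = "IW_family A I B t s"
  let ?H = "Pi (wk 2 B \<cdot> Var 1) (wk 3 X)"
  have I0: "\<Gamma> \<turnstile> I type" and A0: "\<Gamma> \<turnstile> A type" by (auto intro: typeI IW_sig_I[OF w] IW_sig_A[OF w])
  have W0: "I # \<Gamma> \<turnstile> ?W type"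
    using IW_sig_IW[OF IW_sig_wk[OF w I0]] var0[OF I0] by (auto intro: typeI)
  have m: "subst_map (?W # I # \<Gamma>) (shift 2) \<Gamma>"
    using subst_map_shift[of "[?W, I]"] ctx_consI[OF W0] by simp
  have S0: "A # \<Gamma> \<turnstile> ?S type" by (rule ctx_head[OF e])
  have m': "subst_map (?S # A # \<Gamma>) (shift 2) \<Gamma>"
    using subst_map_shift[of "[?S, A]"] ctx_consI[OF S0] by simp
  have "?S # A # \<Gamma> \<turnstile> Var 1 \<^bold>: wk 2 A" using wk_type[OF var0[OF A0] S0] by simp
  then have B: "?S # A # \<Gamma> \<turnstile> wk 2 B \<cdot> Var 1 type"
    using IW_sig_B[OF IW_sig_subst[OF m' w], of "Var 1"] by (auto intro: typeI)
  have m3: "subst_map (wk 2 B \<cdot> Var 1 # ?S # A # \<Gamma>) (shift 3) \<Gamma>"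
    using subst_map_shift[of "[wk 2 B \<cdot> Var 1, ?S, A]"] ctx_consI[OF B] by simp
  have H: "?S # A # \<Gamma> \<turnstile> ?H type"
    using subst_map_type[OF m3 X] by (intro type_Pi) (auto intro: typeI)
  have C: "?W # I # \<Gamma> \<turnstile> wk 2 X \<^bold>: Univ j" using subst_map_type[OF m X] by simp
  let ?C = "Lam I (Lam ?W (wk 2 X))"
  let ?h = "Lam A (Lam ?S (Lam ?H (wk 1 e)))"
  have h': "?H # ?S # A # \<Gamma> \<turnstile> wk 1 e \<^bold>: wk 3 X" using wk_type[OF e H] by simp
  then have h: "Pi (wk 2 B \<cdot> Var 1) (subst (Var 1 \<cdot> Var 0 #. wk 3 s \<cdot> Tup (Var 2)
      (Var 0) #. shift 3) (wk 2 X)) # ?S # A # \<Gamma>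
     \<turnstile> wk 1 e \<^bold>: subst (Sup (Var 2) (Var 1) #. wk 3 t \<cdot> Var 2 #. shift 3) (wk 2 X)" by simp
  let ?F = "Lam I (Lam ?W (IWElim (wk 2 ?C) (wk 2 ?h) (Var 1) (Var 0)))"
  have F0: "?W # I # \<Gamma> \<turnstile> IWElim (wk 2 ?C) (wk 2 ?h) (Var 1) (Var 0) \<^bold>: wk 2 X"
    using IWElim_type[OF w C h m, of "Var 1" "Var 0"] wk_type[OF var0[OF I0] W0] var0[OF W0] by simp
  have F: "\<Gamma> \<turnstile> ?F \<^bold>: Pi I (?W \<rightarrow> wk 1 X)"
    using Lam_type[OF Lam_type[OF F0]] by (simp add: Arrow_def)
  have "\<Gamma> \<turnstile> ?F \<cdot> (t \<cdot> a) \<cdot> Sup a f \<doteq> subst (f #. a #. Var) e \<^bold>: X"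
    if a: "\<Gamma> \<turnstile> a \<^bold>: A" and f: "\<Gamma> \<turnstile> f \<^bold>: subtrees A I B t s a" for a f
  proof -
    have "\<Gamma> \<turnstile> ?F \<cdot> (t \<cdot> a) \<cdot> Sup a f \<doteq> IWElim ?C ?h (t \<cdot> a) (Sup a f) \<^bold>: X"
      using beta2[OF F0 typeI[OF C] IW_sig_t[OF w a]] IW_sig_Sup[OF w a f] by simp
    \<comment> \<open>\<open>wk 1 e\<close> does not mention the recursive results, so
      \<open>r\<close> disappears when the substitution is simplified.\<close>
    moreover obtain r where "\<Gamma> \<turnstile> IWElim ?C ?h (t \<cdot> a) (Sup a f) \<doteq> subst (r #. f #. a #. Var)
        (wk 1 e) \<^bold>: X"
      using IWElim_Sup[OF w C h a f] by auto
    ultimately show ?thesis by (auto intro: eq_trans)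
  qed
  with F show ?thesis by blast
qed

text \<open>
  For \<open>a = b\<close> this is injective in \<open>u\<close>, although the loop contained in \<open>z\<close> need not be \<open>refl\<close>.
  That makes Hedberg's theorem for \<open>A\<close> dispensable.
\<close>

definition cast_or :: "tm \<Rightarrow> tm \<Rightarrow> tm \<Rightarrow> tm \<Rightarrow> tm \<Rightarrow> tm \<Rightarrow> tm \<Rightarrow> tm" where
  "cast_or A P a b z u v =
     CoprodElim (Lam (decidable (Idt A a b)) (wk 1 (subst (b #. Var) P)))
       (Lam (Idt A a b) (transport (wk 1 A) (subst (Var 0 #. shift 2) P) (wk 1 a) (wk 1 b) (Var 0)
           (wk 1 u)))
       (Lam (Idt A a b \<rightarrow> Empty) (wk 1 v)) z"

lemma subst_cast_or [simp]:
  "subst \<sigma> (cast_or A P a b z u v) =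
   cast_or (subst \<sigma> A) (subst (up \<sigma>) P) (subst \<sigma> a) (subst \<sigma> b) (subst \<sigma> z) (subst \<sigma> u) (subst \<sigma> v)"
  by (simp add: cast_or_def)

lemma
  assumes A: "\<Gamma> \<turnstile> A \<^bold>: Univ i" and P: "A # \<Gamma> \<turnstile> P \<^bold>: Univ j"
    and a: "\<Gamma> \<turnstile> a \<^bold>: A" and b: "\<Gamma> \<turnstile> b \<^bold>: A"
    and u: "\<Gamma> \<turnstile> u \<^bold>: subst (a #. Var) P" and v: "\<Gamma> \<turnstile> v \<^bold>: subst (b #. Var) P"
  shows cast_or_type: "\<Gamma> \<turnstile> z \<^bold>: decidable (Idt A a b) \<Longrightarrow> \<Gamma>
      \<turnstile> cast_or A P a b z u v \<^bold>: subst (b #. Var) P"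
    and cast_or_InL: "\<Gamma> \<turnstile> q \<^bold>: Idt A a b \<Longrightarrow>
      \<Gamma> \<turnstile> cast_or A P a b (InL q) u v \<doteq> transport A P a b q u \<^bold>: subst (b #. Var) P"
proof -
  have A0: "\<Gamma> \<turnstile> A type" by (rule typeI[OF A])
  have Id: "\<Gamma> \<turnstile> Idt A a b \<^bold>: Univ i" by (rule Id_form[OF A a b])
  have Id0: "\<Gamma> \<turnstile> Idt A a b type" by (rule typeI[OF Id])
  have Pb: "\<Gamma> \<turnstile> subst (b #. Var) P \<^bold>: Univ j" using type_inst[OF P b] by simp
  have C: "decidable (Idt A a b) # \<Gamma> \<turnstile> wk 1 (subst (b #. Var) P) \<^bold>: Univ j"
    using wk_Univ[OF Pb typeI[OF decidable_form[OF Id]]] by simp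
  have m: "subst_map (Idt A a b # \<Gamma>) (shift (Suc 0)) \<Gamma>"
      by (rule subst_map_shift1[OF ctx_consI[OF Id0]])
  have l: "Idt A a b # \<Gamma> \<turnstile> transport (wk 1 A) (subst (Var 0 #. shift 2) P) (wk 1 a) (wk 1 b) (Var 0)
      (wk 1 u)
     \<^bold>: subst (InL (Var 0) #. shift 1) (wk 1 (subst (b #. Var) P))"
    using transport_type[OF subst_map_type[OF m A, simplified]
        subst_map_type[OF subst_map_up[OF m A0] P, simplified], of "wk 1 a" "wk 1 u" "wk 1 b"
        "Var 0"]
      wk_type[OF a Id0] wk_type[OF b Id0] wk_type[OF u Id0] var0[OF Id0] by simp
  have N0: "\<Gamma> \<turnstile> Idt A a b \<rightarrow> Empty type" by (rule typeI[OF not_form[OF Id]])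
  have r: "(Idt A a b \<rightarrow> Empty) # \<Gamma> \<turnstile> wk 1 v \<^bold>: subst (InR (Var 0) #. shift 1) (wk 1 (subst
      (b #. Var) P))"
    using wk_type[OF v N0] by simp
  note E = CoprodElim_type[OF Id not_form[OF Id] C[unfolded decidable_def] l r]
    CoprodElim_InL[OF Id not_form[OF Id] C[unfolded decidable_def] l r]
  show "\<Gamma> \<turnstile> cast_or A P a b z u v \<^bold>: subst (b #. Var) P" if "\<Gamma> \<turnstile> z \<^bold>: decidable (Idt A a b)"
    using E(1)[of z] that unfolding cast_or_def decidable_def by simp
  show "\<Gamma> \<turnstile> cast_or A P a b (InL q) u v \<doteq> transport A P a b q u \<^bold>: subst (b #. Var) P" if
      "\<Gamma> \<turnstile> q \<^bold>: Idt A a b"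
    using E(2)[OF that] unfolding cast_or_def decidable_def by simp
qed

text \<open>It is not known whether \<open>z\<close> computes to a proof or a refutation, so the
  implication is proved for a variable decision. For \<open>InL q\<close> both casts are transports
  along the same loop \<open>q\<close>, and \<open>transport_inj\<close> does not ask which loop it
  is. A refutation contradicts reflexivity at \<open>a\<close>.\<close>

lemma cast_or_inj:
  assumes A: "\<Gamma> \<turnstile> A \<^bold>: Univ n" and P: "A # \<Gamma> \<turnstile> P \<^bold>: Univ n" and a: "\<Gamma> \<turnstile> a \<^bold>: A"
    and u: "\<Gamma> \<turnstile> u \<^bold>: subst (a #. Var) P" and v: "\<Gamma> \<turnstile> v \<^bold>: subst (a #. Var) P" and w:
        "\<Gamma> \<turnstile> w \<^bold>: subst (a #. Var) P"
    and z: "\<Gamma> \<turnstile> z \<^bold>: decidable (Idt A a a)"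
    and h: "\<Gamma> \<tturnstile> Idt (subst (a #. Var) P) (cast_or A P a a z u w) (cast_or A P a a z v w)"
  shows "\<Gamma> \<tturnstile> Idt (subst (a #. Var) P) u v"
proof -
  let ?Pa = "subst (a #. Var) P"
  let ?D = "decidable (Idt A a a)"
  have A0: "\<Gamma> \<turnstile> A type" by (rule typeI[OF A])
  have Id: "\<Gamma> \<turnstile> Idt A a a \<^bold>: Univ n" by (rule Id_form[OF A a a])
  have Id0: "\<Gamma> \<turnstile> Idt A a a type" by (rule typeI[OF Id])
  have D0: "\<Gamma> \<turnstile> ?D type" by (rule typeI[OF decidable_form[OF Id]])
  have N: "\<Gamma> \<turnstile> Idt A a a \<rightarrow> Empty \<^bold>: Univ n" by (rule not_form[OF Id])
  have N0: "\<Gamma> \<turnstile> Idt A a a \<rightarrow> Empty type" by (rule typeI[OF N])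
  have Pa: "\<Gamma> \<turnstile> ?Pa \<^bold>: Univ n" using type_inst[OF P a] by simp
  let ?c = "\<lambda>u. cast_or (wk 1 A) (subst (Var 0 #. shift 2) P) (wk 1 a) (wk 1 a) (Var 0) (wk 1 u)
      (wk 1 w)"
  let ?C = "Idt (wk 1 ?Pa) (?c u) (?c v) \<rightarrow> Idt (wk 1 ?Pa) (wk 1 u) (wk 1 v)"
  have wk: "X # \<Gamma> \<turnstile> wk 1 A \<^bold>: Univ n" "wk 1 A # X # \<Gamma> \<turnstile> subst (Var 0 #. shift 2) P \<^bold>: Univ n"
    "X # \<Gamma> \<turnstile> wk 1 a \<^bold>: wk 1 A" "X # \<Gamma> \<turnstile> wk 1 u \<^bold>: wk 1 ?Pa" "X # \<Gamma> \<turnstile> wk 1 v \<^bold>: wk 1 ?Pa"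
        "X # \<Gamma> \<turnstile> wk 1 w \<^bold>: wk 1 ?Pa"
    "X # \<Gamma> \<turnstile> wk 1 ?Pa \<^bold>: Univ n"
    if "\<Gamma> \<turnstile> X type" for X
    using wk_Univ[OF A that] wk_type[OF a that] wk_type[OF u that] wk_type[OF v that]
        wk_type[OF w that] wk_Univ[OF Pa that]
      subst_map_type[OF subst_map_up[OF subst_map_shift1[OF ctx_consI[OF that]] A0] P] by simp_all
  have c: "X # \<Gamma> \<turnstile> cast_or (wk 1 A) (subst (Var 0 #. shift 2) P) (wk 1 a) (wk 1 a) z (wk 1 u)
      (wk 1 w) \<^bold>: wk 1 ?Pa"
    if "\<Gamma> \<turnstile> X type" "X # \<Gamma> \<turnstile> z \<^bold>: decidable (Idt (wk 1 A) (wk 1 a) (wk 1 a))" "\<Gamma> \<turnstile> u \<^bold>: ?Pa"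
        for X z u
    using cast_or_type[OF wk(1,2)[OF that(1)] wk(3,3)[OF that(1)], of "wk 1 u" "wk 1 w"
        z] that wk_type[OF that(3,1)]
      wk(6)[OF that(1)] by simp
  have C: "?D # \<Gamma> \<turnstile> ?C \<^bold>: Univ n"
    using var0[OF D0] u v by (intro Arrow_form Id_form wk c D0) simp_all
  let ?\<Delta> = "Idt A a a # \<Gamma>"
  let ?t = "\<lambda>u. transport (wk 1 A) (subst (Var 0 #. shift 2) P) (wk 1 a) (wk 1 a) (Var 0) (wk 1 u)"
  let ?l = "\<lambda>u. cast_or (wk 1 A) (subst (Var 0 #. shift 2) P) (wk 1 a) (wk 1 a) (InL (Var 0))
      (wk 1 u) (wk 1 w)"
  note W = wk[OF Id0]
  have q: "?\<Delta> \<turnstile> Var 0 \<^bold>: Idt (wk 1 A) (wk 1 a) (wk 1 a)" using var0[OF Id0] by simp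
  have lt: "?\<Delta> \<turnstile> ?l u \<doteq> ?t u \<^bold>: wk 1 ?Pa" "?\<Delta> \<turnstile> ?t u \<^bold>: wk 1 ?Pa" "?\<Delta> \<turnstile> ?l u \<^bold>: wk 1 ?Pa" if
      "\<Gamma> \<turnstile> u \<^bold>: ?Pa" for u
    using cast_or_InL[OF W(1,2,3,3), of "wk 1 u" "wk 1 w"
        "Var 0"] transport_type[OF W(1,2,3) _ W(3) q, of "wk 1 u"]
      c[OF Id0 _ that, of "InL (Var 0)"] Coprod_inl[OF Id_form[OF W(1,3,3)]
          not_form[OF Id_form[OF W(1,3,3)]] q]
      wk_type[OF that Id0] W(6) q
    by (simp_all add: decidable_def)
  have "?\<Delta> \<turnstile> Idt (wk 1 ?Pa) (?l u) (?l v) \<doteq> Idt (wk 1 ?Pa) (?t u) (?t v) type"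
    by (intro Id_eq_type[OF W(7)] lt u v)
  then have "?\<Delta> \<tturnstile> Idt (wk 1 ?Pa) (?l u) (?l v) \<rightarrow> Idt (wk 1 ?Pa) (?t u) (?t v)"
    by (rule holds_imp_eq) (intro typeI[OF Id_form[OF W(7)]] lt u v)
  moreover have "?\<Delta> \<tturnstile> Idt (wk 1 ?Pa) (?t u) (?t v) \<rightarrow> Idt (wk 1 ?Pa) (wk 1 u) (wk 1 v)"
    using transport_inj[OF W(1,2,3,3) q, of "wk 1 u" "wk 1 v"] W by simp
  ultimately have "?\<Delta> \<tturnstile> Idt (wk 1 ?Pa) (?l u) (?l v) \<rightarrow> Idt (wk 1 ?Pa) (wk 1 u) (wk 1 v)"
    by (rule holds_imp_trans) (intro typeI[OF Id_form[OF W(7)]] lt u v)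
  then have L: "?\<Delta> \<tturnstile> subst (InL (Var 0) #. shift 1) ?C"
    by simp
  have "(Idt A a a \<rightarrow> Empty) # \<Gamma> \<tturnstile> Empty"
    using holds_wk[OF holds_Id_refl[OF A a] N0] var0[OF N0] by (auto intro: holds_mp holdsI)
  moreover have "(Idt A a a \<rightarrow> Empty) # \<Gamma> \<turnstile> InR (Var 0) \<^bold>: subst (shift 1) ?D"
    using Coprod_inr[OF wk_Univ[OF Id N0] wk_Univ[OF N N0] var0[OF N0]] by (simp add: decidable_def)
  then have "(Idt A a a \<rightarrow> Empty) # \<Gamma> \<turnstile> subst (InR (Var 0) #. shift 1) ?C \<^bold>: subst (InR
      (Var 0) #. shift 1) (Univ n)"
    by (intro subst_map_type[OF subst_map_scons[OF subst_map_shift1[OF ctx_consI[OF N0],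
        folded One_nat_def] D0] C])
  ultimately have R: "(Idt A a a \<rightarrow> Empty) # \<Gamma> \<tturnstile> subst (InR (Var 0) #. shift 1) ?C"
    by (auto intro: holds_Empty)
  from holds_Coprod_dep[OF C[unfolded decidable_def] L R Id N z[unfolded decidable_def]]
  have "\<Gamma> \<tturnstile> Idt ?Pa (cast_or A P a a z u w) (cast_or A P a a z v w) \<rightarrow> Idt ?Pa u v"
    by simp
  from holds_mp[OF this h] show ?thesis .
qed

section \<open>Trees at varying indices and the arguments of the constructor\<close>

lemma IW_sig_family:
  "IW_sig n \<Gamma> A I B t s \<Longrightarrow> I # \<Gamma> \<turnstile> IW_family A I B t s \<^bold>: Univ n"
  using IW_sig_IW[OF IW_sig_wk[OF _ typeI[OF IW_sig_I]]] var0[OF typeI[OF IW_sig_I]] by simp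

lemma IW_sig_subtrees_fam:
  "IW_sig n \<Gamma> A I B t s \<Longrightarrow> A # \<Gamma> \<turnstile> subtrees_family A I B t s \<^bold>: Univ n"
  using IW_sig_subtrees[OF IW_sig_wk[OF _ typeI[OF IW_sig_A]]] var0[OF typeI[OF IW_sig_A]] by simp

definition IW_cast :: "tm \<Rightarrow> tm \<Rightarrow> tm \<Rightarrow> tm \<Rightarrow> tm \<Rightarrow> tm \<Rightarrow> tm \<Rightarrow> tm \<Rightarrow> tm \<Rightarrow> tm" where
  "IW_cast A I B t s = transport I (IW_family A I B t s)"

lemma subst_IW_cast [simp]:
  "subst \<sigma> (IW_cast A I B t s i j p u) =
   IW_cast (subst \<sigma> A) (subst \<sigma> I) (subst \<sigma> B) (subst \<sigma> t) (subst \<sigma> s) (subst \<sigma> i) (subst \<sigma> j)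
       (subst \<sigma> p) (subst \<sigma> u)"
  by (simp add: IW_cast_def)

lemma IW_cast_type:
  assumes "IW_sig n \<Gamma> A I B t s" "\<Gamma> \<turnstile> i \<^bold>: I" "\<Gamma> \<turnstile> j \<^bold>: I" "\<Gamma> \<turnstile> p \<^bold>: Idt I i j"
      "\<Gamma> \<turnstile> u \<^bold>: IW A I B t s i"
  shows "\<Gamma> \<turnstile> IW_cast A I B t s i j p u \<^bold>: IW A I B t s j"
  using transport_type[OF IW_sig_I IW_sig_family, OF assms(1,1,2) _ assms(3,4), of u] assms(5)
  unfolding IW_cast_def by simp

lemma IW_cast_Refl:
  assumes "IW_sig n \<Gamma> A I B t s" "\<Gamma> \<turnstile> i \<^bold>: I" "\<Gamma> \<turnstile> u \<^bold>: IW A I B t s i"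
  shows "\<Gamma> \<turnstile> IW_cast A I B t s i i (Refl i) u \<doteq> u \<^bold>: IW A I B t s i"
  using transport_Refl[OF IW_sig_I IW_sig_family, OF assms(1,1,2), of u] assms(3)
  unfolding IW_cast_def by simp

lemma has_decidable_equality_App:
  assumes "\<Gamma> \<turnstile> D \<^bold>: has_decidable_equality A" "\<Gamma> \<turnstile> x \<^bold>: A" "\<Gamma> \<turnstile> y \<^bold>: A"
  shows "\<Gamma> \<turnstile> D \<cdot> x \<cdot> y \<^bold>: decidable (Idt A x y)"
  using App_type[OF App_type[OF assms(1)[unfolded has_decidable_equality_def] assms(2), simplified]
      assms(3)] by simp

lemma IW_rec_App:
  assumes "\<Gamma> \<turnstile> F \<^bold>: Pi I (IW_family A I B t s \<rightarrow> wk 1 X)"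
    and "\<Gamma> \<turnstile> k \<^bold>: I" "\<Gamma> \<turnstile> u \<^bold>: IW A I B t s k"
  shows "\<Gamma> \<turnstile> F \<cdot> k \<cdot> u \<^bold>: X"
  using Arrow_App[OF App_type[OF assms(1,2), simplified] assms(3)] .

lemma IW_rec_ap:
  assumes w: "IW_sig n \<Gamma> A I B t s" and X: "\<Gamma> \<turnstile> X \<^bold>: Univ n"
    and F: "\<Gamma> \<turnstile> F \<^bold>: Pi I (IW_family A I B t s \<rightarrow> wk 1 X)"
    and k: "\<Gamma> \<turnstile> k \<^bold>: I" and u: "\<Gamma> \<turnstile> u \<^bold>: IW A I B t s k" and v: "\<Gamma> \<turnstile> v \<^bold>: IW A I B t s k"
    and h: "\<Gamma> \<tturnstile> Idt (IW A I B t s k) u v"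
  shows "\<Gamma> \<tturnstile> Idt X (F \<cdot> k \<cdot> u) (F \<cdot> k \<cdot> v)"
proof -
  have W: "\<Gamma> \<turnstile> IW A I B t s k type" by (rule typeI[OF IW_sig_IW[OF w k]])
  have "IW A I B t s k # \<Gamma> \<turnstile> wk 1 F \<cdot> wk 1 k \<cdot> Var 0 \<^bold>: wk 1 X"
    using IW_rec_App[of "IW A I B t s k # \<Gamma>" "wk 1 F" "wk 1 I" "wk 1 A" "wk 1 B" "wk 1 t" "wk 1 s"
        "wk 1 X" "wk 1 k" "Var 0"]
      wk_type[OF F W] wk_type[OF k W] var0[OF W] by simp
  from holds_ap[OF h this X IW_sig_IW[OF w k] u v] show ?thesis by simp
qed

text \<open>Let \<open>F\<close> be the shape map. Then \<open>a = F(cast)\<close> because transport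
  preserves the value of \<open>F\<close>, and \<open>F(cast) = a'\<close> by applying
  \<open>F\<close> to the given equation.\<close>

lemma shape_eq:
  assumes w: "IW_sig n \<Gamma> A I B t s" and a: "\<Gamma> \<turnstile> a \<^bold>: A" and f: "\<Gamma> \<turnstile> f \<^bold>: subtrees A I B t s a"
    and a': "\<Gamma> \<turnstile> a' \<^bold>: A" and f': "\<Gamma> \<turnstile> f' \<^bold>: subtrees A I B t s a'"
    and p: "\<Gamma> \<turnstile> p \<^bold>: Idt I (t \<cdot> a) (t \<cdot> a')"
    and h: "\<Gamma> \<tturnstile> Idt (IW A I B t s (t \<cdot> a')) (IW_cast A I B t s (t \<cdot> a) (t \<cdot> a') p (Sup a f))
        (Sup a' f')"
  shows "\<Gamma> \<tturnstile> Idt A a a'"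
proof -
  note A = IW_sig_A[OF w] and I = IW_sig_I[OF w]
  have A0: "\<Gamma> \<turnstile> A type" and I0: "\<Gamma> \<turnstile> I type" using A I by (auto intro: typeI)
  let ?W = "IW_family A I B t s"
  have W: "I # \<Gamma> \<turnstile> ?W \<^bold>: Univ n" by (rule IW_sig_family[OF w])
  have S0: "A # \<Gamma> \<turnstile> subtrees_family A I B t s type"
    by (rule typeI[OF IW_sig_subtrees_fam[OF w]])
  \<comment> \<open>In the branch \<open>Var 0\<close> is the function of subtrees and
    \<open>Var 1\<close> is the shape, so this recursion returns the shape.\<close>
  obtain F where F: "\<Gamma> \<turnstile> F \<^bold>: Pi I (?W \<rightarrow> wk 1 A)"
    and Fe: "\<And>a f. \<Gamma> \<turnstile> a \<^bold>: A \<Longrightarrow> \<Gamma> \<turnstile> f \<^bold>: subtrees A I B t s a \<Longrightarrow> \<Gamma> \<turnstile> F \<cdot> (t \<cdot> a) \<cdot> Sup a f \<doteq> a \<^bold>: A"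
    using IW_rec[OF w A, of "Var 1"] wk_type[OF var0[OF A0] S0] by auto
  have F': "\<Gamma> \<turnstile> F \<cdot> k \<cdot> u \<^bold>: A" if "\<Gamma> \<turnstile> k \<^bold>: I" "\<Gamma> \<turnstile> u \<^bold>: IW A I B t s k" for k u
    by (rule IW_rec_App[OF F that])
  note ta = IW_sig_t[OF w a] and ta' = IW_sig_t[OF w a'] and sup = IW_sig_Sup[OF w a f]
      and sup' = IW_sig_Sup[OF w a' f']
  let ?c = "IW_cast A I B t s (t \<cdot> a) (t \<cdot> a') p (Sup a f)"
  have c: "\<Gamma> \<turnstile> ?c \<^bold>: IW A I B t s (t \<cdot> a')"
    by (rule IW_cast_type[OF w ta ta' p sup])
  have 1: "\<Gamma> \<tturnstile> Idt A (F \<cdot> (t \<cdot> a') \<cdot> ?c) a'"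
    by (rule holds_Id_conv[OF A eq_refl Fe _ _ IW_rec_ap[OF w A F ta' c sup' h]])
        (intro F' ta' c a' f' sup')+
  note W0 = typeI[OF W]
  let ?\<Delta> = "?W # I # \<Gamma>"
  have m: "subst_map ?\<Delta> (shift 2) \<Gamma>"
    using subst_map_shift[of "[?W, I]"] ctx_consI[OF W0] by simp
  have v: "?\<Delta> \<turnstile> Var 1 \<^bold>: wk 2 I" "?\<Delta> \<turnstile> Var 0 \<^bold>: IW (wk 2 A) (wk 2 I) (wk 2 B) (wk 2 t) (wk 2 s)
      (Var 1)"
    using wk_type[OF var0[OF I0] W0] var0[OF W0] by simp_all
  have "?\<Delta> \<turnstile> wk 2 F \<cdot> Var 1 \<cdot> Var 0 \<^bold>: wk 2 A"
    by (rule IW_rec_App[OF _ v]) (use subst_map_type[OF m F] in simp)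
  \<comment> \<open>As a predicate on an index \<open>k\<close> and a tree \<open>u\<close> this
    reads \<open>a = F(k, u)\<close>. It holds of \<open>sup(a, f)\<close> by computation, and
    therefore of its cast.\<close>
  then have Q: "?\<Delta> \<turnstile> Idt (wk 2 A) (wk 2 a) (wk 2 F \<cdot> Var 1 \<cdot> Var 0) \<^bold>: Univ n"
    using subst_map_type[OF m A] subst_map_type[OF m a] by (intro Id_form) simp_all
  have "\<Gamma> \<tturnstile> Idt A a (F \<cdot> (t \<cdot> a) \<cdot> Sup a f)"
    by (rule holds_Id_conv[OF A eq_refl eq_sym[OF Fe] _ _ holds_Id_refl[OF A a]])
        (intro F' ta a f sup)+
  then have 2: "\<Gamma> \<tturnstile> Idt A a (F \<cdot> (t \<cdot> a') \<cdot> ?c)"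
    using transport_induct[OF I W Q ta ta' p, of "Sup a f"] sup by (simp add: IW_cast_def)
  show ?thesis
    by (rule holds_Id_trans[OF 2 1 A]) (intro a a' F' ta' c)+
qed

text \<open>
  Apply to the given equality the map that sends \<open>sup(a', f')\<close> to \<open>f'\<close> cast from \<open>a'\<close> to \<open>a\<close>, with
  default \<open>f\<close>.
\<close>

lemma Sup_inj:
  assumes w: "IW_sig n \<Gamma> A I B t s" and D: "\<Gamma> \<turnstile> D \<^bold>: has_decidable_equality A" and a: "\<Gamma> \<turnstile> a \<^bold>: A"
    and f: "\<Gamma> \<turnstile> f \<^bold>: subtrees A I B t s a" and g: "\<Gamma> \<turnstile> g \<^bold>: subtrees A I B t s a"
    and h: "\<Gamma> \<tturnstile> Idt (IW A I B t s (t \<cdot> a)) (Sup a f) (Sup a g)"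
  shows "\<Gamma> \<tturnstile> Idt (subtrees A I B t s a) f g"
proof -
  note A = IW_sig_A[OF w]
  have A0: "\<Gamma> \<turnstile> A type" using A by (auto intro: typeI)
  let ?S = "subtrees_family A I B t s"
  have S: "A # \<Gamma> \<turnstile> ?S \<^bold>: Univ n" by (rule IW_sig_subtrees_fam[OF w])
  note S0 = typeI[OF S]
  let ?\<Delta> = "?S # A # \<Gamma>"
  have m: "subst_map ?\<Delta> (shift 2) \<Gamma>"
    using subst_map_shift[of "[?S, A]"] ctx_consI[OF S0] by simp
  have v: "?\<Delta> \<turnstile> Var 1 \<^bold>: wk 2 A" "?\<Delta> \<turnstile> Var 0 \<^bold>: subtrees (wk 2 A) (wk 2 I) (wk 2 B) (wk 2 t)
      (wk 2 s) (Var 1)"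
    using wk_type[OF var0[OF A0] S0] var0[OF S0] by simp_all
  note w2 = IW_sig_subst[OF m w, folded wk_eq_subst]
  have a2: "?\<Delta> \<turnstile> wk 2 a \<^bold>: wk 2 A" and f2:
      "?\<Delta> \<turnstile> wk 2 f \<^bold>: subtrees (wk 2 A) (wk 2 I) (wk 2 B) (wk 2 t) (wk 2 s) (wk 2 a)"
    and D2: "?\<Delta> \<turnstile> wk 2 D \<^bold>: has_decidable_equality (wk 2 A)"
    using subst_map_type[OF m a] subst_map_type[OF m f] subst_map_type[OF m D] by simp_all
  \<comment> \<open>\<open>IW_rec\<close> has a constant codomain, so the result cannot have the
    type of subtrees at the shape at hand; every function of subtrees has to be moved to the fixed
    \<open>a\<close>.\<close>
  let ?e = "cast_or (wk 2 A) (subtrees (wk 3 A) (wk 3 I) (wk 3 B) (wk 3 t) (wk 3 s) (Var 0)) (Var 1)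
      (wk 2 a)
     (wk 2 D \<cdot> Var 1 \<cdot> wk 2 a) (Var 0) (wk 2 f)"
  have "?\<Delta> \<turnstile> ?e \<^bold>: wk 2 (subtrees A I B t s a)"
    using cast_or_type[OF IW_sig_A[OF w2] IW_sig_subtrees_fam[OF w2]
        v(1) a2 _ _ has_decidable_equality_App[OF D2 v(1) a2], of "Var 0" "wk 2 f"]
      v(2) f2 by simp
  from IW_rec[OF w IW_sig_subtrees[OF w a] this]
  obtain F where F: "\<Gamma> \<turnstile> F \<^bold>: Pi I (IW_family A I B t s \<rightarrow> wk 1 (subtrees A I B t s a))"
    and Fe: "\<And>g. \<Gamma> \<turnstile> g \<^bold>: subtrees A I B t s a \<Longrightarrow> \<Gamma> \<turnstile> F \<cdot> (t \<cdot> a) \<cdot> Sup a g \<doteq> cast_or A ?S a a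
        (D \<cdot> a \<cdot> a) g f \<^bold>: subtrees A I B t s a"
    using a by auto
  note ap = IW_rec_ap[OF w IW_sig_subtrees[OF w a] F IW_sig_t[OF w a] IW_sig_Sup[OF w a f]
      IW_sig_Sup[OF w a g] h]
  have c: "\<Gamma> \<turnstile> cast_or A ?S a a (D \<cdot> a \<cdot> a) f f \<^bold>: subtrees A I B t s a"
    using cast_or_type[OF A S a a _ _ has_decidable_equality_App[OF D a a], of f f] f by simp
  \<comment> \<open>Both values are computed with the same decision
    \<open>D \<cdot> a \<cdot> a\<close>. This makes \<open>cast_or_inj\<close> applicable.\<close>
  have "\<Gamma> \<tturnstile> Idt (subtrees A I B t s a) (cast_or A ?S a a (D \<cdot> a \<cdot> a) f f) (cast_or A ?S a a
      (D \<cdot> a \<cdot> a) g f)"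
    by (rule holds_Id_conv[OF IW_sig_subtrees[OF w a] Fe[OF f] Fe[OF g]
        IW_rec_App[OF F IW_sig_t[OF w a] IW_sig_Sup[OF w a g]] c ap])
  then show ?thesis
    using cast_or_inj[OF A S a _ _ _ has_decidable_equality_App[OF D a a], of f g f] f g by simp
qed

section \<open>Deciding equality\<close>

text \<open>Motive of the induction on the first tree. It compares trees at one index only; other
  indices enter through a path in the induction on the second tree.\<close>

definition decides :: "tm \<Rightarrow> tm \<Rightarrow> tm \<Rightarrow> tm \<Rightarrow> tm \<Rightarrow> tm \<Rightarrow> tm \<Rightarrow> tm" where
  "decides A I B t s k u = Pi (IW A I B t s k) (decidable (Idt (wk 1 (IW A I B t s k)) (wk 1 u)
      (Var 0)))"

lemma subst_decides [simp]:
  "subst \<sigma> (decides A I B t s k u) =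
   decides (subst \<sigma> A) (subst \<sigma> I) (subst \<sigma> B) (subst \<sigma> t) (subst \<sigma> s) (subst \<sigma> k) (subst \<sigma> u)"
  by (simp add: decides_def)

lemma decides_D:
  "\<Gamma> \<tturnstile> decides A I B t s k u \<Longrightarrow> \<Gamma> \<turnstile> v \<^bold>: IW A I B t s k \<Longrightarrow> \<Gamma> \<tturnstile> decidable (Idt (IW A I B t s k) u v)"
  unfolding decides_def by (drule (1) holds_Pi_D) simp

text \<open>The type of the induction hypotheses for the motive \<open>decides\<close>. It has a
  name because it is carried through many extended contexts before it is opened.\<close>

definition subtrees_decide :: "tm \<Rightarrow> tm \<Rightarrow> tm \<Rightarrow> tm \<Rightarrow> tm \<Rightarrow> tm \<Rightarrow> tm \<Rightarrow> tm" where
  "subtrees_decide A I B t s a f =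
     Pi (B \<cdot> a) (decides (wk 1 A) (wk 1 I) (wk 1 B) (wk 1 t) (wk 1 s) (wk 1 s \<cdot> Tup (wk 1 a)
         (Var 0)) (wk 1 f \<cdot> Var 0))"

lemma subst_subtrees_decide [simp]:
  "subst \<sigma> (subtrees_decide A I B t s a f) =
   subtrees_decide (subst \<sigma> A) (subst \<sigma> I) (subst \<sigma> B) (subst \<sigma> t) (subst \<sigma> s) (subst \<sigma> a)
       (subst \<sigma> f)"
  by (simp add: subtrees_decide_def)

section \<open>The hypotheses, and trees of the same shape\<close>

definition dec_hyps :: "nat \<Rightarrow> tm list \<Rightarrow> tm \<Rightarrow> tm \<Rightarrow> tm \<Rightarrow> tm \<Rightarrow> tm \<Rightarrow> bool" where
  "dec_hyps n \<Gamma> A I B t s \<longleftrightarrow> IW_sig n \<Gamma> A I B t s \<and> \<Gamma> \<tturnstile> has_decidable_equality A \<and>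
     \<Gamma> \<tturnstile> Pi A (Pi_compact n (wk 1 B \<cdot> Var 0)) \<and> \<Gamma> \<tturnstile> is_set I"

lemma dec_hyps_subst:
  "subst_map \<Delta> \<sigma> \<Gamma> \<Longrightarrow> dec_hyps n \<Gamma> A I B t s \<Longrightarrow>
   dec_hyps n \<Delta> (subst \<sigma> A) (subst \<sigma> I) (subst \<sigma> B) (subst \<sigma> t) (subst \<sigma> s)"
  unfolding dec_hyps_def
  by (auto intro: IW_sig_subst dest: subst_map_holds)

lemma dec_hyps_wk:
  "dec_hyps n \<Gamma> A I B t s \<Longrightarrow> \<Gamma> \<turnstile> X type \<Longrightarrow> dec_hyps n (X # \<Gamma>) (wk 1 A) (wk 1 I) (wk 1 B) (wk 1 t)
      (wk 1 s)"
  using dec_hyps_subst[OF subst_map_shift1[OF ctx_consI]] by simp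

definition pointwise_eq :: "tm \<Rightarrow> tm \<Rightarrow> tm \<Rightarrow> tm \<Rightarrow> tm \<Rightarrow> tm \<Rightarrow> tm \<Rightarrow> tm \<Rightarrow> tm" where
  "pointwise_eq A I B t s a f g =
     Pi (B \<cdot> a) (Idt (IW (wk 1 A) (wk 1 I) (wk 1 B) (wk 1 t) (wk 1 s) (wk 1 s \<cdot> Tup (wk 1 a)
         (Var 0)))
       (wk 1 f \<cdot> Var 0) (wk 1 g \<cdot> Var 0))"

lemma subst_pointwise_eq [simp]:
  "subst \<sigma> (pointwise_eq A I B t s a f g) =
   pointwise_eq (subst \<sigma> A) (subst \<sigma> I) (subst \<sigma> B) (subst \<sigma> t) (subst \<sigma> s) (subst \<sigma> a) (subst \<sigma> f)
       (subst \<sigma> g)"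
  by (simp add: pointwise_eq_def)

lemma position_typing:
  assumes w: "IW_sig n \<Gamma> A I B t s" and a: "\<Gamma> \<turnstile> a \<^bold>: A"
  shows "B \<cdot> a # \<Gamma> \<turnstile> IW (wk 1 A) (wk 1 I) (wk 1 B) (wk 1 t) (wk 1 s) (wk 1 s \<cdot> Tup (wk 1 a)
      (Var 0)) \<^bold>: Univ n"
    and "\<Gamma> \<turnstile> f \<^bold>: subtrees A I B t s a \<Longrightarrow>
      B \<cdot> a # \<Gamma> \<turnstile> wk 1 f \<cdot> Var 0 \<^bold>: IW (wk 1 A) (wk 1 I) (wk 1 B) (wk 1 t) (wk 1 s) (wk 1 s \<cdot> Tup
          (wk 1 a) (Var 0))"
proof -
  note Ba0 = typeI[OF IW_sig_B[OF w a]]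
  note w1 = IW_sig_wk[OF w Ba0]
  have b: "B \<cdot> a # \<Gamma> \<turnstile> Var 0 \<^bold>: wk 1 B \<cdot> wk 1 a" using var0[OF Ba0] by simp
  then show "B \<cdot> a # \<Gamma> \<turnstile> IW (wk 1 A) (wk 1 I) (wk 1 B) (wk 1 t) (wk 1 s) (wk 1 s \<cdot> Tup (wk 1 a)
      (Var 0)) \<^bold>: Univ n"
    using IW_sig_IW[OF w1 IW_sig_s[OF w1 _ b]] wk_type[OF a Ba0] by simp
  show "B \<cdot> a # \<Gamma> \<turnstile> wk 1 f \<cdot> Var 0 \<^bold>: IW (wk 1 A) (wk 1 I) (wk 1 B) (wk 1 t) (wk 1 s) (wk 1 s \<cdot> Tup
      (wk 1 a) (Var 0))"
    if "\<Gamma> \<turnstile> f \<^bold>: subtrees A I B t s a"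
    using IW_sig_app[OF w1 _ b] wk_type[OF that Ba0] by simp
qed

lemma pointwise_eq_form:
  assumes "IW_sig n \<Gamma> A I B t s" "\<Gamma> \<turnstile> a \<^bold>: A" "\<Gamma> \<turnstile> f \<^bold>: subtrees A I B t s a"
      "\<Gamma> \<turnstile> g \<^bold>: subtrees A I B t s a"
  shows "\<Gamma> \<turnstile> pointwise_eq A I B t s a f g \<^bold>: Univ n"
  unfolding pointwise_eq_def using assms
  by (intro Pi_form IW_sig_B Id_form position_typing)

lemma Sup_cong:
  assumes w: "IW_sig n \<Gamma> A I B t s" and a: "\<Gamma> \<turnstile> a \<^bold>: A"
    and f: "\<Gamma> \<turnstile> f \<^bold>: subtrees A I B t s a" and g: "\<Gamma> \<turnstile> g \<^bold>: subtrees A I B t s a"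
    and h: "\<Gamma> \<tturnstile> pointwise_eq A I B t s a f g"
  shows "\<Gamma> \<tturnstile> Idt (IW A I B t s (t \<cdot> a)) (Sup a f) (Sup a g)"
proof -
  note S = IW_sig_subtrees[OF w a]
  note S0 = typeI[OF S]
  have fg: "\<Gamma> \<tturnstile> Idt (subtrees A I B t s a) f g"
    unfolding subtrees_def
    by (rule holds_funext[OF h[unfolded pointwise_eq_def]]) (use f g S in \<open>simp_all add:
        subtrees_def\<close>)
  have "subtrees A I B t s a # \<Gamma> \<turnstile> Sup (wk 1 a) (Var 0) \<^bold>: wk 1 (IW A I B t s (t \<cdot> a))"
    using IW_sig_Sup[OF IW_sig_wk[OF w S0], of "wk 1 a"
        "Var 0"] wk_type[OF a S0] var0[OF S0] by simp
  from holds_ap[OF fg this IW_sig_IW[OF w IW_sig_t[OF w a]] S f g] show ?thesis by simp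
qed

text \<open>Pointwise reflexivity at \<open>f\<close> is transported along the equation, in the
  family that varies the second function.\<close>

lemma pointwise_eqI:
  assumes w: "IW_sig n \<Gamma> A I B t s" and a: "\<Gamma> \<turnstile> a \<^bold>: A"
    and f: "\<Gamma> \<turnstile> f \<^bold>: subtrees A I B t s a" and g: "\<Gamma> \<turnstile> g \<^bold>: subtrees A I B t s a"
    and h: "\<Gamma> \<tturnstile> Idt (subtrees A I B t s a) f g"
  shows "\<Gamma> \<tturnstile> pointwise_eq A I B t s a f g"
proof -
  note S = IW_sig_subtrees[OF w a]
  note S0 = typeI[OF S]
  have "subtrees A I B t s a # \<Gamma> \<turnstile> pointwise_eq (wk 1 A) (wk 1 I) (wk 1 B) (wk 1 t) (wk 1 s)
      (wk 1 a) (wk 1 f) (Var 0) \<^bold>: Univ n"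
    by (rule pointwise_eq_form[OF IW_sig_wk[OF w S0]])
      (use wk_type[OF a S0] wk_type[OF f S0] var0[OF S0] in simp_all)
  moreover have "\<Gamma> \<tturnstile> pointwise_eq A I B t s a f f"
    unfolding pointwise_eq_def
    by (intro holds_Pi holds_Id_refl[OF position_typing(1)[OF w a] position_typing(2)[OF w a f]])
  ultimately show ?thesis
    using holds_transport[OF _ h _ S f g] by force
qed

lemma decide_same_shape:
  assumes d: "dec_hyps n \<Gamma> A I B t s" and a: "\<Gamma> \<turnstile> a \<^bold>: A"
    and f: "\<Gamma> \<turnstile> f \<^bold>: subtrees A I B t s a" and g: "\<Gamma> \<turnstile> g \<^bold>: subtrees A I B t s a"
    and IH: "\<Gamma> \<tturnstile> subtrees_decide A I B t s a f"
  shows "\<Gamma> \<tturnstile> decidable (Idt (IW A I B t s (t \<cdot> a)) (Sup a f) (Sup a g))"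
proof -
  have w: "IW_sig n \<Gamma> A I B t s" using d by (simp add: dec_hyps_def)
  \<comment> \<open>A term is wanted here and not only inhabitation: \<open>Sup_inj\<close> builds a
    function on trees that runs this decision.\<close>
  obtain D where D: "\<Gamma> \<turnstile> D \<^bold>: has_decidable_equality A"
      using d by (auto simp: dec_hyps_def holds_def)
  note Ba = IW_sig_B[OF w a]
  note Ba0 = typeI[OF Ba]
  let ?P = "pointwise_eq A I B t s a f g"
  let ?G = "Idt (IW A I B t s (t \<cdot> a)) (Sup a f) (Sup a g)"
  have P: "\<Gamma> \<turnstile> ?P \<^bold>: Univ n" by (rule pointwise_eq_form[OF w a f g])
  have G: "\<Gamma> \<turnstile> ?G \<^bold>: Univ n" by (intro Id_form IW_sig_IW[OF w IW_sig_t[OF w a]] IW_sig_Sup[OF w a]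
      f g)
  have "B \<cdot> a # \<Gamma> \<tturnstile> decides (wk 1 A) (wk 1 I) (wk 1 B) (wk 1 t) (wk 1 s) (wk 1 s \<cdot> Tup (wk 1 a)
      (Var 0)) (wk 1 f \<cdot> Var 0)"
    by (rule holds_Pi_open[OF IH[unfolded subtrees_decide_def] Ba0])
  note e = decides_D[OF this position_typing(2)[OF w a g]]
  have "\<Gamma> \<tturnstile> Pi_compact n (B \<cdot> a)"
    using holds_Pi_D[of \<Gamma> A "Pi_compact n (wk 1 B \<cdot> Var 0)" a] d a by (simp add: dec_hyps_def)
  \<comment> \<open>Compactness at level \<open>n\<close> fits because trees over data in
    \<open>Univ n\<close> form a type in \<open>Univ n\<close>, and so do the equations between them
    at each position.\<close>
  then have "\<Gamma> \<tturnstile> decidable ?P"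
    unfolding pointwise_eq_def
    by (rule Pi_compact_D[OF _ Ba Id_form[OF position_typing(1)[OF w a] position_typing(2)[OF w a f]
        position_typing(2)[OF w a g]] e])
  then show ?thesis
  proof (rule decidable_iff[OF _ P G])
    note P0 = typeI[OF P] and G0 = typeI[OF G]
    show "\<Gamma> \<tturnstile> ?P \<rightarrow> ?G"
      using Sup_cong[OF IW_sig_wk[OF w P0], of "wk 1 a" "wk 1 f" "wk 1 g"]
        wk_type[OF a P0] wk_type[OF f P0] wk_type[OF g P0] holdsI[OF var0[OF P0]]
      by (intro holds_Arrow) simp
    have "?G # \<Gamma> \<tturnstile> Idt (wk 1 (subtrees A I B t s a)) (wk 1 f) (wk 1 g)"
      using Sup_inj[OF IW_sig_wk[OF w G0], of "wk 1 D" "wk 1 a" "wk 1 f" "wk 1 g"]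
        wk_type[OF a G0] wk_type[OF f G0] wk_type[OF g G0] wk_type[OF D G0] holdsI[OF var0[OF G0]]
      by simp
    then show "\<Gamma> \<tturnstile> ?G \<rightarrow> ?P"
      using pointwise_eqI[OF IW_sig_wk[OF w G0], of "wk 1 a" "wk 1 f" "wk 1 g"]
        wk_type[OF a G0] wk_type[OF f G0] wk_type[OF g G0]
      by (intro holds_Arrow) simp
  qed
qed

section \<open>Induction on the two trees\<close>

lemma step_ctx:
  assumes w: "IW_sig n \<Gamma> A I B t s"
    and X: "subtrees_family A I B t s # A # \<Gamma> \<turnstile> X type"
  defines "\<Delta> \<equiv> X # subtrees_family A I B t s # A # \<Gamma>"
  shows "subst_map \<Delta> (shift 3) \<Gamma>"
    and "IW_sig n \<Delta> (wk 3 A) (wk 3 I) (wk 3 B) (wk 3 t) (wk 3 s)"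
    and "\<Delta> \<turnstile> Var 2 \<^bold>: wk 3 A"
    and "\<Delta> \<turnstile> Var 1 \<^bold>: subtrees (wk 3 A) (wk 3 I) (wk 3 B) (wk 3 t) (wk 3 s) (Var 2)"
proof -
  show m: "subst_map \<Delta> (shift 3) \<Gamma>"
    using subst_map_shift[of "[X, _, A]"] ctx_consI[OF X] unfolding \<Delta>_def by simp
  show "IW_sig n \<Delta> (wk 3 A) (wk 3 I) (wk 3 B) (wk 3 t) (wk 3 s)"
    using IW_sig_subst[OF m w] by simp
  show "\<Delta> \<turnstile> Var 2 \<^bold>: wk 3 A"
    "\<Delta> \<turnstile> Var 1 \<^bold>: subtrees (wk 3 A) (wk 3 I) (wk 3 B) (wk 3 t) (wk 3 s) (Var 2)"
    using var[OF ctx_consI[OF X], of 2] var[OF ctx_consI[OF X], of 1] unfolding \<Delta>_def by simp_all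
qed

text \<open>Well-formedness of \<open>H\<close> follows from that of \<open>C\<close> and is handed
  to the step, which needs it to use the variable holding the induction hypotheses.\<close>

lemma holds_IW_induct:
  assumes w: "IW_sig n \<Gamma> A I B t s"
    and C: "IW_family A I B t s # I # \<Gamma> \<turnstile> C \<^bold>: Univ j"
  defines "S \<equiv> subtrees_family A I B t s"
    and "H \<equiv> Pi (wk 2 B \<cdot> Var 1) (subst (Var 1 \<cdot> Var 0 #. wk 3 s \<cdot> Tup (Var 2)
        (Var 0) #. shift 3) C)"
  assumes h: "S # A # \<Gamma> \<turnstile> H type \<Longrightarrow> H # S # A # \<Gamma> \<tturnstile> subst (Sup (Var 2)
      (Var 1) #. wk 3 t \<cdot> Var 2 #. shift 3) C"
    and k: "\<Gamma> \<turnstile> k \<^bold>: I" and u: "\<Gamma> \<turnstile> u \<^bold>: IW A I B t s k"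
  shows "\<Gamma> \<tturnstile> subst (u #. k #. Var) C"
proof -
  note A0 = typeI[OF IW_sig_A[OF w]]
  have S0: "A # \<Gamma> \<turnstile> S type" unfolding S_def by (rule typeI[OF IW_sig_subtrees_fam[OF w]])
  have m: "subst_map (S # A # \<Gamma>) (shift 2) \<Gamma>"
    using subst_map_shift[of "[S, A]"] ctx_consI[OF S0] by simp
  have "S # A # \<Gamma> \<turnstile> Var 1 \<^bold>: wk 2 A" using wk_type[OF var0[OF A0] S0] by simp
  then have B0: "S # A # \<Gamma> \<turnstile> wk 2 B \<cdot> Var 1 type"
    using IW_sig_B[OF IW_sig_subst[OF m w], of "Var 1"] by (auto intro: typeI)
  note X = step_ctx[OF w B0[unfolded S_def], folded S_def]
  have "wk 2 B \<cdot> Var 1 # S # A # \<Gamma> \<turnstile> Var 0 \<^bold>: wk 3 B \<cdot> Var 2" using var0[OF B0] by simp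
  then have "subst_map (wk 2 B \<cdot> Var 1 # S # A # \<Gamma>) (Var 1 \<cdot> Var 0 #. wk 3 s \<cdot> Tup (Var 2)
      (Var 0) #. shift 3)
     (IW_family A I B t s # I # \<Gamma>)"
    using IW_sig_s[OF X(2,3)] IW_sig_app[OF X(2,4)]
    by (intro subst_map_scons X(1) typeI[OF IW_sig_I[OF w]] ctx_head[OF C]) simp_all
  from subst_map_is_type[OF this typeI[OF C]] have "S # A # \<Gamma> \<turnstile> H type"
    unfolding H_def by (rule type_Pi)
  from h[OF this] show ?thesis
    using IWElim_type[OF w C _ subst_map_Var[OF IW_sig_ctx[OF w]], of _ k u] k u
    unfolding holds_def subst_Var S_def H_def by blast
qed

text \<open>Equality of trees at different indices, made homogeneous along \<open>p\<close>. Casting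
  the constructor tree rather than \<open>u\<close> leaves \<open>u\<close> free for
  induction.\<close>

abbreviation cast_goal :: "tm \<Rightarrow> tm \<Rightarrow> tm \<Rightarrow> tm \<Rightarrow> tm \<Rightarrow> tm \<Rightarrow> tm \<Rightarrow> tm \<Rightarrow> tm \<Rightarrow> tm \<Rightarrow> tm" where
  "cast_goal A I B t s a f k p u \<equiv> Idt (IW A I B t s k) (IW_cast A I B t s (t \<cdot> a) k p (Sup a f)) u"

lemma cast_goal_form:
  assumes w: "IW_sig n \<Gamma> A I B t s" and a: "\<Gamma> \<turnstile> a \<^bold>: A" and f: "\<Gamma> \<turnstile> f \<^bold>: subtrees A I B t s a"
    and "\<Gamma> \<turnstile> k \<^bold>: I" "\<Gamma> \<turnstile> p \<^bold>: Idt I (t \<cdot> a) k" "\<Gamma> \<turnstile> u \<^bold>: IW A I B t s k"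
  shows "\<Gamma> \<turnstile> cast_goal A I B t s a f k p u \<^bold>: Univ n"
  by (intro Id_form IW_sig_IW[OF w] IW_cast_type[OF w] IW_sig_Sup[OF w] IW_sig_t[OF w] assms)

text \<open>The cast along \<open>Refl\<close> contracts judgementally. This links casts to plain
  equations at both ends of the argument: for a loop that has been identified with
  \<open>Refl\<close>, and for the final choice of \<open>Refl\<close> as the path.\<close>

lemma decide_cast_Refl:
  assumes w: "IW_sig n \<Gamma> A I B t s" and a: "\<Gamma> \<turnstile> a \<^bold>: A" and f: "\<Gamma> \<turnstile> f \<^bold>: subtrees A I B t s a"
    and u: "\<Gamma> \<turnstile> u \<^bold>: IW A I B t s (t \<cdot> a)"
  shows "\<Gamma> \<tturnstile> decidable (cast_goal A I B t s a f (t \<cdot> a) (Refl (t \<cdot> a)) u) \<longleftrightarrow>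
         \<Gamma> \<tturnstile> decidable (Idt (IW A I B t s (t \<cdot> a)) (Sup a f) u)"
proof -
  note ta = IW_sig_t[OF w a] and sup = IW_sig_Sup[OF w a f]
  have "\<Gamma> \<turnstile> cast_goal A I B t s a f (t \<cdot> a) (Refl (t \<cdot> a)) u \<doteq> Idt (IW A I B t s (t \<cdot> a))
      (Sup a f) u \<^bold>: Univ n"
    by (rule Id_cong[OF IW_sig_IW[OF w ta] IW_cast_Refl[OF w ta sup] eq_refl[OF u] u sup])
  then show ?thesis by (blast intro: decidable_conv eq_sym)
qed

text \<open>Both endpoints of \<open>p\<close> are fixed, so \<open>p\<close> itself cannot be
  contracted. As \<open>I\<close> is a set, there is a path from \<open>Refl\<close> to
  \<open>p\<close> in the type of loops, and the decision at \<open>Refl\<close> is transported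
  along it.\<close>

lemma decide_loop:
  assumes d: "dec_hyps n \<Gamma> A I B t s" and a: "\<Gamma> \<turnstile> a \<^bold>: A"
    and f: "\<Gamma> \<turnstile> f \<^bold>: subtrees A I B t s a" and g: "\<Gamma> \<turnstile> g \<^bold>: subtrees A I B t s a"
    and p: "\<Gamma> \<turnstile> p \<^bold>: Idt I (t \<cdot> a) (t \<cdot> a)" and IH: "\<Gamma> \<tturnstile> subtrees_decide A I B t s a f"
  shows "\<Gamma> \<tturnstile> decidable (cast_goal A I B t s a f (t \<cdot> a) p (Sup a g))"
proof -
  have w: "IW_sig n \<Gamma> A I B t s" and set: "\<Gamma> \<tturnstile> is_set I" using d by (auto simp: dec_hyps_def)
  note ta = IW_sig_t[OF w a] and I = IW_sig_I[OF w]
  let ?L = "Idt I (t \<cdot> a) (t \<cdot> a)"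
  have L: "\<Gamma> \<turnstile> ?L \<^bold>: Univ n" by (intro Id_form I ta)
  have r: "\<Gamma> \<turnstile> Refl (t \<cdot> a) \<^bold>: ?L" by (rule Id_intro[OF I ta])
  note L0 = typeI[OF L]
  have "\<Gamma> \<tturnstile> Pi I (is_proposition (Idt (wk 1 I) (wk 1 (t \<cdot> a)) (Var 0)))"
    using holds_Pi_D[OF set[unfolded is_set_def] ta] by simp
  from holds_Pi_D[OF this ta] have "\<Gamma> \<tturnstile> is_proposition ?L" by simp
  then have "\<Gamma> \<tturnstile> Pi ?L (Idt (wk 1 ?L) (wk 1 (Refl (t \<cdot> a))) (Var 0))"
    unfolding is_proposition_def by (auto dest: holds_Pi_D[OF _ r])
  from holds_Pi_D[OF this p] have e: "\<Gamma> \<tturnstile> Idt ?L (Refl (t \<cdot> a)) p" by simp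
  have "?L # \<Gamma> \<turnstile> decidable (cast_goal (wk 1 A) (wk 1 I) (wk 1 B) (wk 1 t) (wk 1 s) (wk 1 a) (wk 1 f)
      (wk 1 (t \<cdot> a)) (Var 0) (wk 1 (Sup a g)))
      \<^bold>: Univ n"
    using cast_goal_form[OF IW_sig_wk[OF w L0], of "wk 1 a" "wk 1 f" "wk 1 (t \<cdot> a)" "Var 0"
        "wk 1 (Sup a g)"]
      wk_type[OF a L0] wk_type[OF f L0] wk_type[OF ta L0] var0[OF L0]
          wk_type[OF IW_sig_Sup[OF w a g] L0]
    by (intro decidable_form) simp
  from holds_transport[OF this e _ L r p] show ?thesis
    using decide_same_shape[OF d a f g IH] decide_cast_Refl[OF w a f IW_sig_Sup[OF w a g]] by simp
qed

text \<open>The types of \<open>f'\<close> and \<open>p\<close> mention \<open>a'\<close>, so both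
  are generalised before transporting along \<open>a = a'\<close>. The family is a product over all
  subtree functions at \<open>x\<close> and all paths \<open>t(a) = t(x)\<close>; at
  \<open>x = a\<close> these paths are the loops of \<open>decide_loop\<close>.\<close>

lemma decide_eq_shape:
  assumes d: "dec_hyps n \<Gamma> A I B t s" and a: "\<Gamma> \<turnstile> a \<^bold>: A" and a': "\<Gamma> \<turnstile> a' \<^bold>: A"
    and f: "\<Gamma> \<turnstile> f \<^bold>: subtrees A I B t s a" and f': "\<Gamma> \<turnstile> f' \<^bold>: subtrees A I B t s a'"
    and p: "\<Gamma> \<turnstile> p \<^bold>: Idt I (t \<cdot> a) (t \<cdot> a')" and IH: "\<Gamma> \<tturnstile> subtrees_decide A I B t s a f"
    and q: "\<Gamma> \<tturnstile> Idt A a a'"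
  shows "\<Gamma> \<tturnstile> decidable (cast_goal A I B t s a f (t \<cdot> a') p (Sup a' f'))"
proof -
  have w: "IW_sig n \<Gamma> A I B t s" using d by (simp add: dec_hyps_def)
  note A = IW_sig_A[OF w]
  note A0 = typeI[OF A]
  let ?S = "subtrees_family A I B t s"
  let ?L = "Idt (wk 2 I) (wk 2 (t \<cdot> a)) (wk 2 t \<cdot> Var 1)"
  let ?G = "cast_goal (wk 3 A) (wk 3 I) (wk 3 B) (wk 3 t) (wk 3 s) (wk 3 a) (wk 3 f)
      (wk 3 t \<cdot> Var 2) (Var 0) (Sup (Var 2) (Var 1))"
  have S: "A # \<Gamma> \<turnstile> ?S \<^bold>: Univ n" by (rule IW_sig_subtrees_fam[OF w])
  note S0 = typeI[OF S]
  have m2: "subst_map (?S # A # \<Gamma>) (shift 2) \<Gamma>"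
    using subst_map_shift[of "[?S, A]"] ctx_consI[OF S0] by simp
  have v2: "?S # A # \<Gamma> \<turnstile> Var 1 \<^bold>: wk 2 A"
      "?S # A # \<Gamma> \<turnstile> Var 0 \<^bold>: subtrees (wk 2 A) (wk 2 I) (wk 2 B) (wk 2 t) (wk 2 s) (Var 1)"
    using wk_type[OF var0[OF A0] S0] var0[OF S0] by simp_all
  note w2 = IW_sig_subst[OF m2 w, folded wk_eq_subst]
  have L: "?S # A # \<Gamma> \<turnstile> ?L \<^bold>: Univ n"
    using subst_map_type[OF m2 IW_sig_t[OF w a]] by (intro Id_form IW_sig_I[OF w2] IW_sig_t[OF w2]
        v2) simp
  note L0 = typeI[OF L]
  have m3: "subst_map (?L # ?S # A # \<Gamma>) (shift 3) \<Gamma>"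
    using subst_map_shift[of "[?L, ?S, A]"] ctx_consI[OF L0] by simp
  note w3 = IW_sig_subst[OF m3 w, folded wk_eq_subst]
  have v3: "?L # ?S # A # \<Gamma> \<turnstile> Var 2 \<^bold>: wk 3 A"
      "?L # ?S # A # \<Gamma> \<turnstile> Var 1 \<^bold>: subtrees (wk 3 A) (wk 3 I) (wk 3 B) (wk 3 t) (wk 3 s) (Var 2)"
    "?L # ?S # A # \<Gamma> \<turnstile> Var 0 \<^bold>: Idt (wk 3 I) (wk 3 t \<cdot> wk 3 a) (wk 3 t \<cdot> Var 2)"
    using v2[THEN wk_type, OF L0] var0[OF L0] by simp_all
  have a3: "?L # ?S # A # \<Gamma> \<turnstile> wk 3 a \<^bold>: wk 3 A"
      "?L # ?S # A # \<Gamma> \<turnstile> wk 3 f \<^bold>: subtrees (wk 3 A) (wk 3 I) (wk 3 B) (wk 3 t) (wk 3 s) (wk 3 a)"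
    using subst_map_type[OF m3 a] subst_map_type[OF m3 f] by simp_all
  have G: "?L # ?S # A # \<Gamma> \<turnstile> ?G \<^bold>: Univ n"
    by (intro cast_goal_form[OF w3] v3 a3 IW_sig_t[OF w3] IW_sig_Sup[OF w3])
  have P: "A # \<Gamma> \<turnstile> Pi ?S (Pi ?L (decidable ?G)) \<^bold>: Univ n"
    by (intro Pi_form S L decidable_form G)
  let ?Sa = "subtrees A I B t s a"
  let ?La = "Idt (wk 1 I) (wk 1 (t \<cdot> a)) (wk 1 (t \<cdot> a))"
  have Sa0: "\<Gamma> \<turnstile> ?Sa type" by (rule typeI[OF IW_sig_subtrees[OF w a]])
  have La: "?Sa # \<Gamma> \<turnstile> ?La type"
    using wk_type[OF IW_sig_t[OF w a] Sa0] by (intro typeI[OF Id_form[OF IW_sig_I[OF IW_sig_wk[OF w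
        Sa0]]]]) simp_all
  have n2: "subst_map (?La # ?Sa # \<Gamma>) (shift 2) \<Gamma>"
    using subst_map_shift[of "[?La, ?Sa]"] ctx_consI[OF La] by simp
  have "?La # ?Sa # \<Gamma> \<tturnstile> decidable (cast_goal (wk 2 A) (wk 2 I) (wk 2 B) (wk 2 t) (wk 2 s) (wk 2 a)
      (wk 2 f) (wk 2 t \<cdot> wk 2 a) (Var 0) (Sup (wk 2 a) (Var 1)))"
    using subst_map_type[OF n2 a] subst_map_type[OF n2 f] wk_type[OF var0[OF Sa0] La] var0[OF La]
        subst_map_holds[OF n2 IH]
    by (intro decide_loop[OF dec_hyps_subst[OF n2 d, folded wk_eq_subst]]) simp_all
  then have "\<Gamma> \<tturnstile> subst (a #. Var) (Pi ?S (Pi ?L (decidable ?G)))"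
    by (simp add: holds_Pi)
  from holds_transport[OF P q this A a a']
  have "\<Gamma> \<tturnstile> Pi (subtrees A I B t s a') (Pi (Idt (wk 1 I) (wk 1 (t \<cdot> a)) (wk 1 (t \<cdot> a')))
     (decidable (cast_goal (wk 2 A) (wk 2 I) (wk 2 B) (wk 2 t) (wk 2 s) (wk 2 a) (wk 2 f) (wk 2
         (t \<cdot> a')) (Var 0) (Sup (wk 2 a') (Var 1)))))"
    by simp
  from holds_Pi_D[OF this f']
  have "\<Gamma> \<tturnstile> Pi (Idt I (t \<cdot> a) (t \<cdot> a'))
     (decidable (cast_goal (wk 1 A) (wk 1 I) (wk 1 B) (wk 1 t) (wk 1 s) (wk 1 a) (wk 1 f) (wk 1
         (t \<cdot> a')) (Var 0) (Sup (wk 1 a') (wk 1 f'))))"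
    by simp
  from holds_Pi_D[OF this p] show ?thesis by simp
qed

lemma decide_Sup_Sup:
  assumes d: "dec_hyps n \<Gamma> A I B t s" and a: "\<Gamma> \<turnstile> a \<^bold>: A" and a': "\<Gamma> \<turnstile> a' \<^bold>: A"
    and f: "\<Gamma> \<turnstile> f \<^bold>: subtrees A I B t s a" and f': "\<Gamma> \<turnstile> f' \<^bold>: subtrees A I B t s a'"
    and p: "\<Gamma> \<turnstile> p \<^bold>: Idt I (t \<cdot> a) (t \<cdot> a')" and IH: "\<Gamma> \<tturnstile> subtrees_decide A I B t s a f"
  shows "\<Gamma> \<tturnstile> decidable (cast_goal A I B t s a f (t \<cdot> a') p (Sup a' f'))"
proof -
  have w: "IW_sig n \<Gamma> A I B t s" using d by (simp add: dec_hyps_def)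
  obtain D where D: "\<Gamma> \<turnstile> D \<^bold>: has_decidable_equality A"
      using d by (auto simp: dec_hyps_def holds_def)
  let ?G = "cast_goal A I B t s a f (t \<cdot> a') p (Sup a' f')"
  have Id: "\<Gamma> \<turnstile> Idt A a a' \<^bold>: Univ n" by (intro Id_form IW_sig_A[OF w] a a')
  have G: "\<Gamma> \<turnstile> ?G \<^bold>: Univ n"
    by (intro cast_goal_form[OF w] a f p IW_sig_t[OF w] IW_sig_Sup[OF w] a' f')
  show ?thesis
  proof (rule decidable_cases[OF holdsI[OF has_decidable_equality_App[OF D a a']]
      Id decidable_form[OF G]])
    note X0 = typeI[OF Id]
    show "Idt A a a' # \<Gamma> \<tturnstile> subst (shift (Suc 0)) (decidable ?G)"
      using decide_eq_shape[OF dec_hyps_wk[OF d X0], of "wk 1 a" "wk 1 a'" "wk 1 f" "wk 1 f'"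
          "wk 1 p"]
        wk_type[OF a X0] wk_type[OF a' X0] wk_type[OF f X0] wk_type[OF f' X0] wk_type[OF p X0]
        holds_wk[OF IH X0] holdsI[OF var0[OF X0]] by simp
    note N0 = typeI[OF not_form[OF Id]] and G0 = typeI[OF G]
    have "?G # \<Gamma> \<tturnstile> wk 1 (Idt A a a')"
      using shape_eq[OF IW_sig_wk[OF w G0], of "wk 1 a" "wk 1 f" "wk 1 a'" "wk 1 f'" "wk 1 p"]
        wk_type[OF a G0] wk_type[OF a' G0] wk_type[OF f G0] wk_type[OF f' G0] wk_type[OF p G0]
        holdsI[OF var0[OF G0]] by simp
    then have "\<Gamma> \<tturnstile> ?G \<rightarrow> Idt A a a'" by (intro holds_Arrow) simp
    \<comment> \<open>The implication from \<open>?G\<close> to \<open>a = a'\<close> is composed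
      with the refutation of \<open>a = a'\<close> that is held by the context.\<close>
    note i = holds_imp_trans[OF holds_wk[OF this N0, unfolded subst_Arrow]
        holdsI[OF var0[OF N0, unfolded subst_Arrow subst.simps(9)]] typeI[OF wk_Univ[OF G N0]]]
    show "(Idt A a a' \<rightarrow> Empty) # \<Gamma> \<tturnstile> subst (shift (Suc 0)) (decidable ?G)"
      unfolding subst_decidable by (rule decidable_no[OF wk_Univ[OF G N0] i])
  qed
qed

lemma decide_Sup:
  assumes d: "dec_hyps n \<Gamma> A I B t s" and a: "\<Gamma> \<turnstile> a \<^bold>: A" and f: "\<Gamma> \<turnstile> f \<^bold>: subtrees A I B t s a"
    and IH: "\<Gamma> \<tturnstile> subtrees_decide A I B t s a f"
    and k: "\<Gamma> \<turnstile> k \<^bold>: I" and p: "\<Gamma> \<turnstile> p \<^bold>: Idt I (t \<cdot> a) k" and u: "\<Gamma> \<turnstile> u \<^bold>: IW A I B t s k"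
  shows "\<Gamma> \<tturnstile> decidable (cast_goal A I B t s a f k p u)"
proof -
  have w: "IW_sig n \<Gamma> A I B t s" using d by (simp add: dec_hyps_def)
  note I0 = typeI[OF IW_sig_I[OF w]]
  let ?W = "IW_family A I B t s"
  let ?S = "subtrees_family A I B t s"
  note W0 = typeI[OF IW_sig_family[OF w]]
  have m2: "subst_map (?W # I # \<Gamma>) (shift 2) \<Gamma>"
    using subst_map_shift[of "[?W, I]"] ctx_consI[OF W0] by simp
  note w2 = IW_sig_subst[OF m2 w, folded wk_eq_subst]
  have v2: "?W # I # \<Gamma> \<turnstile> Var 1 \<^bold>: wk 2 I"
      "?W # I # \<Gamma> \<turnstile> Var 0 \<^bold>: IW (wk 2 A) (wk 2 I) (wk 2 B) (wk 2 t) (wk 2 s) (Var 1)"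
    using wk_type[OF var0[OF I0] W0] var0[OF W0] by simp_all
  let ?L = "Idt (wk 2 I) (wk 2 (t \<cdot> a)) (Var 1)"
  have L: "?W # I # \<Gamma> \<turnstile> ?L \<^bold>: Univ n"
    using subst_map_type[OF m2 IW_sig_t[OF w a]] by (intro Id_form IW_sig_I[OF w2] v2) simp
  note L0 = typeI[OF L]
  have m3: "subst_map (?L # ?W # I # \<Gamma>) (shift 3) \<Gamma>"
    using subst_map_shift[of "[?L, ?W, I]"] ctx_consI[OF L0] by simp
  note w3 = IW_sig_subst[OF m3 w, folded wk_eq_subst]
  \<comment> \<open>The path must be quantified inside the motive: its type mentions the index,
    which the induction turns into \<open>t(a')\<close>.\<close>
  let ?C = "Pi ?L (decidable (cast_goal (wk 3 A) (wk 3 I) (wk 3 B) (wk 3 t) (wk 3 s) (wk 3 a)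
      (wk 3 f) (Var 2) (Var 0) (Var 1)))"
  have C: "?W # I # \<Gamma> \<turnstile> ?C \<^bold>: Univ n"
    using subst_map_type[OF m3 a] subst_map_type[OF m3 f] v2[THEN wk_type, OF L0] var0[OF L0]
    by (intro Pi_form L decidable_form cast_goal_form[OF w3]) simp_all
  \<comment> \<open>The entry \<open>H\<close> for the hypotheses of this induction is arbitrary, so
    the step is a case analysis on the second tree. The recursion is carried by \<open>IH\<close>,
    which concerns the first tree.\<close>
  have H: "H # ?S # A # \<Gamma> \<tturnstile> subst (Sup (Var 2) (Var 1) #. wk 3 t \<cdot> Var 2 #. shift 3) ?C"
    if H: "?S # A # \<Gamma> \<turnstile> H type" for H
  proof -
    note X = step_ctx[OF w H]
    let ?K = "Idt (wk 3 I) (wk 3 (t \<cdot> a)) (wk 3 t \<cdot> Var 2)"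
    have K: "H # ?S # A # \<Gamma> \<turnstile> ?K type"
      using subst_map_type[OF X(1) IW_sig_t[OF w a]]
      by (intro typeI[OF Id_form[OF IW_sig_I[OF X(2)]]] IW_sig_t[OF X(2)] X(3)) simp
    have m4: "subst_map (?K # H # ?S # A # \<Gamma>) (shift 4) \<Gamma>"
      using subst_map_shift[of "[?K, H, ?S, A]"] ctx_consI[OF K] by simp
    have "?K # H # ?S # A # \<Gamma> \<tturnstile> decidable (cast_goal (wk 4 A) (wk 4 I) (wk 4 B) (wk 4 t) (wk 4 s)
        (wk 4 a) (wk 4 f)
        (wk 4 t \<cdot> Var 3) (Var 0) (Sup (Var 3) (Var 2)))"
      using subst_map_type[OF m4 a] subst_map_type[OF m4 f] X(3,4)[THEN wk_type, OF K] var0[OF K]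
          subst_map_holds[OF m4 IH]
      by (intro decide_Sup_Sup[OF dec_hyps_subst[OF m4 d, folded wk_eq_subst]]) simp_all
    then show ?thesis by (simp add: holds_Pi)
  qed
  have "\<Gamma> \<tturnstile> Pi (Idt I (t \<cdot> a) k) (decidable (cast_goal (wk 1 A) (wk 1 I) (wk 1 B) (wk 1 t) (wk 1 s)
      (wk 1 a) (wk 1 f) (wk 1 k) (Var 0) (wk 1 u)))"
    using holds_IW_induct[OF w C H k u] by simp
  from holds_Pi_D[OF this p] show ?thesis by simp
qed

text \<open>The second tree is at the same index as the first, so the path can be chosen to be
  \<open>Refl\<close> and the cast disappears.\<close>

lemma decides_Sup:
  assumes d: "dec_hyps n \<Gamma> A I B t s" and a: "\<Gamma> \<turnstile> a \<^bold>: A" and f: "\<Gamma> \<turnstile> f \<^bold>: subtrees A I B t s a"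
    and IH: "\<Gamma> \<tturnstile> subtrees_decide A I B t s a f"
  shows "\<Gamma> \<tturnstile> decides A I B t s (t \<cdot> a) (Sup a f)"
proof -
  have w: "IW_sig n \<Gamma> A I B t s" using d by (simp add: dec_hyps_def)
  note ta = IW_sig_t[OF w a]
  note W0 = typeI[OF IW_sig_IW[OF w ta]]
  note d1 = dec_hyps_wk[OF d W0] and w1 = IW_sig_wk[OF w W0]
  let ?\<Delta> = "IW A I B t s (t \<cdot> a) # \<Gamma>"
  have a1: "?\<Delta> \<turnstile> wk 1 a \<^bold>: wk 1 A" and f1:
      "?\<Delta> \<turnstile> wk 1 f \<^bold>: subtrees (wk 1 A) (wk 1 I) (wk 1 B) (wk 1 t) (wk 1 s) (wk 1 a)"
    and u1: "?\<Delta> \<turnstile> Var 0 \<^bold>: IW (wk 1 A) (wk 1 I) (wk 1 B) (wk 1 t) (wk 1 s) (wk 1 t \<cdot> wk 1 a)"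
    using wk_type[OF a W0] wk_type[OF f W0] var0[OF W0] by simp_all
  have "?\<Delta> \<tturnstile> subtrees_decide (wk 1 A) (wk 1 I) (wk 1 B) (wk 1 t) (wk 1 s) (wk 1 a) (wk 1 f)"
    using holds_wk[OF IH W0] by simp
  from decide_Sup[OF d1 a1 f1 this IW_sig_t[OF w1 a1] Id_intro[OF IW_sig_I[OF w1]
      IW_sig_t[OF w1 a1]] u1]
  show ?thesis
    unfolding decides_def decide_cast_Refl[OF w1 a1 f1 u1] by (intro holds_Pi) simp
qed

lemma decides_form:
  assumes w: "IW_sig n \<Gamma> A I B t s" and k: "\<Gamma> \<turnstile> k \<^bold>: I" and u: "\<Gamma> \<turnstile> u \<^bold>: IW A I B t s k"
  shows "\<Gamma> \<turnstile> decides A I B t s k u \<^bold>: Univ n"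
proof -
  note W = IW_sig_IW[OF w k]
  note W0 = typeI[OF W]
  show ?thesis
    unfolding decides_def using wk_Univ[OF W W0] wk_type[OF u W0] var0[OF W0]
    by (intro Pi_form W decidable_form Id_form) simp_all
qed

lemma decides_all:
  assumes d: "dec_hyps n \<Gamma> A I B t s" and k: "\<Gamma> \<turnstile> k \<^bold>: I" and u: "\<Gamma> \<turnstile> u \<^bold>: IW A I B t s k"
  shows "\<Gamma> \<tturnstile> decides A I B t s k u"
proof -
  have w: "IW_sig n \<Gamma> A I B t s" using d by (simp add: dec_hyps_def)
  note I0 = typeI[OF IW_sig_I[OF w]] and W0 = typeI[OF IW_sig_family[OF w]]
  let ?W = "IW_family A I B t s"
  let ?S = "subtrees_family A I B t s"
  have m2: "subst_map (?W # I # \<Gamma>) (shift 2) \<Gamma>"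
    using subst_map_shift[of "[?W, I]"] ctx_consI[OF W0] by simp
  let ?C = "decides (wk 2 A) (wk 2 I) (wk 2 B) (wk 2 t) (wk 2 s) (Var 1) (Var 0)"
  have C: "?W # I # \<Gamma> \<turnstile> ?C \<^bold>: Univ n"
    using wk_type[OF var0[OF I0] W0] var0[OF W0]
    by (intro decides_form[OF IW_sig_subst[OF m2 w, folded wk_eq_subst]]) simp_all
  let ?H = "Pi (wk 2 B \<cdot> Var 1) (subst (Var 1 \<cdot> Var 0 #. wk 3 s \<cdot> Tup (Var 2)
      (Var 0) #. shift 3) ?C)"
  have "?H # ?S # A # \<Gamma> \<tturnstile> subst (Sup (Var 2) (Var 1) #. wk 3 t \<cdot> Var 2 #. shift 3) ?C"
    if H: "?S # A # \<Gamma> \<turnstile> ?H type"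
  proof -
    note X = step_ctx[OF w H]
    \<comment> \<open>Unfolded, this is the type of \<open>Var 0\<close>: the hypothesis of the
      induction on the first tree.\<close>
    have "?H # ?S # A # \<Gamma> \<tturnstile> subtrees_decide (wk 3 A) (wk 3 I) (wk 3 B) (wk 3 t) (wk 3 s) (Var 2)
        (Var 1)"
      using holdsI[OF var0[OF H]] by (simp add: subtrees_decide_def)
    from decides_Sup[OF dec_hyps_subst[OF X(1) d, folded wk_eq_subst] X(3,4) this] show ?thesis
      by simp
  qed
  from holds_IW_induct[OF w C this k u] show ?thesis by simp
qed

theorem theorem8p17:
  fixes \<Gamma> :: "tm list" and A I B t s :: tm and n :: nat
  assumes "\<Gamma> \<turnstile> A \<^bold>: Univ n"
    and "\<Gamma> \<turnstile> I \<^bold>: Univ n"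
    and "\<Gamma> \<turnstile> B \<^bold>: A \<rightarrow> Univ n"
    and "\<Gamma> \<turnstile> t \<^bold>: A \<rightarrow> I"
    and "\<Gamma> \<turnstile> s \<^bold>: Sig A B \<rightarrow> I"
    and "\<Gamma> \<tturnstile> has_decidable_equality A"
    and "\<Gamma> \<tturnstile> Pi A (Pi_compact n (wk 1 B \<cdot> Var 0))"
    and "\<Gamma> \<tturnstile> is_set I"
  shows "\<Gamma> \<tturnstile> Pi I (has_decidable_equality
           (IW (wk 1 A) (wk 1 I) (wk 1 B) (wk 1 t) (wk 1 s) (Var 0)))"
proof -
  have d: "dec_hyps n \<Gamma> A I B t s" and w: "IW_sig n \<Gamma> A I B t s"
    using assms by (simp_all add: dec_hyps_def IW_sig_def)
  note I0 = typeI[OF IW_sig_I[OF w]]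
  let ?W = "IW_family A I B t s"
  note W0 = typeI[OF IW_sig_family[OF w]]
  let ?\<Delta> = "?W # I # \<Gamma>"
  have m2: "subst_map ?\<Delta> (shift 2) \<Gamma>"
    using subst_map_shift[of "[?W, I]"] ctx_consI[OF W0] by simp
  note d2 = dec_hyps_subst[OF m2 d, folded wk_eq_subst]
  have k: "?\<Delta> \<turnstile> Var 1 \<^bold>: wk 2 I" and u:
      "?\<Delta> \<turnstile> Var 0 \<^bold>: IW (wk 2 A) (wk 2 I) (wk 2 B) (wk 2 t) (wk 2 s) (Var 1)"
    using wk_type[OF var0[OF I0] W0] var0[OF W0] by simp_all
  \<comment> \<open>The index and the first tree are the two variables of the context; the product
    over the second tree is the one inside \<open>decides\<close>.\<close>
  have "?\<Delta> \<tturnstile> decides (wk 2 A) (wk 2 I) (wk 2 B) (wk 2 t) (wk 2 s) (Var 1) (Var 0)"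
    by (rule decides_all[OF d2 k u])
  then show ?thesis
    unfolding has_decidable_equality_def decides_def
    by (intro holds_Pi[OF holds_Pi]) simp
qed

end
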